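(* Let $R:(\mathcal C\times\mathcal C)^{op}\to\mathsf{Pos}$ be an extensional relational doctrine with quotients, let $S:(\mathcal D\times\mathcal D)^{op}\to\mathsf{Pos}$ be a relational doctrine, and let $F=\langle\widehat F,\overline F\rangle:S\to R$ be a fully faithful 1-arrow in $\mathbf{RD}$. Then the following are equivalent: (1) the 1-arrow $F^\sharp:S^{eq}\to R$ is an equivalence in $\mathbf{EQRD}$; (2) $F$ factors through $\mathsf{Proj}^R$ (that is, $\widehat F A$ is $R$-projective for every object $A$ of $\mathcal D$) and for every object $X$ of $\mathcal C$ there are an object $P_X$ of $\mathcal D$ and a quotient arrow $q_X:\widehat F P_X\to X$ in $\mathcal C$.
   Context: A relational doctrine consists of a category $\mathcal C$ (its base) and a functor $R:(\mathcal C\times\mathcal C)^{op}\to\mathsf{Pos}$ (posets and monotone maps; $R_{f,g}:R(X,Y)\to R(A,B)$ for $f:A\to X$, $g:B\to Y$), together with monotone maps $;:R(X,Y)\times R(Y,Z)\to R(X,Z)$, elements $\mathsf d_X\in R(X,X)$ and monotone maps $(-)^\bot:R(X,Y)\to R(Y,X)$ such that $\alpha;(\beta;\gamma)=(\alpha;\beta);\gamma$, $\mathsf d_X;\alpha=\alpha=\alpha;\mathsf d_Y$, $(\alpha;\beta)^\bot=\beta^\bot;\alpha^\bot$, $\mathsf d_X^\bot=\mathsf d_X$, $\alpha^{\bot\bot}=\alpha$, and $R_{f,g}(\alpha);R_{g,h}(\beta)\le R_{f,h}(\alpha;\beta)$, $\mathsf d_A\le R_{f,f}(\mathsf d_X)$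 for $f:A\to X$, $(R_{f,g}(\alpha))^\bot\le R_{g,f}(\alpha^\bot)$. The graph of $f:X\to Y$ is $\Gamma_f=R_{f,\mathrm{id}_Y}(\mathsf d_Y)\in R(X,Y)$. $R$ is extensional if $\Gamma_f=\Gamma_g$ implies $f=g$ for all parallel $f,g$. Quotients. An $R$-equivalence relation on $X$ is $\rho\in R(X,X)$ with $\mathsf d_X\le\rho$, $\rho^\bot\le\rho$, $\rho;\rho\le\rho$. A quotient arrow of $\rho$ is $q:X\to W$ with $\rho\le\Gamma_q;\Gamma_q^\bot$ such that for every $f:X\to Z$ with $\rho\le\Gamma_f;\Gamma_f^\bot$ there is a unique $h:W\to Z$ with $f=h\circ q$; it is effective if $\rho=\Gamma_q;\Gamma_q^\bot$ and descent if $\Gamma_q^\bot;\Gamma_q=\mathsf d_W$. $R$ has quotients if every $R$-equivalence relation has an effective descent quotient arrow. "Quotient arrow" without further specification means quotient arrow of some $R$-equivalence relation. If $R$ has quotients, an object $P$ is $R$-projective if for every $f:P\to Y$ and every quotient arrow $q:X\to Y$ there is $h:P\to X$ with $f=q\circ h$. $\mathsf{Proj}^R$ denotes the restriction of $R$ to the full subcategory of its base on the $R$-projective objects. 2-categories. $\mathbf{RD}$ has relational doctrines as objects. A 1-arrow $F:R\to S$ (bases $\mathcal C,\mathcal D$) is a pair $\langle\widehat F,\overline F\rangle$ of a functor $\widehat F:\mathcal C\to\mathcal D$ and a natural family of monotone maps $\overline F_{X,Y}:R(X,Y)\to S(\widehat FX,\widehat FY)$ preserving $\mathsf d$, $;$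 and $(-)^\bot$. A 2-arrow $\theta:F\Rightarrow G$ is a natural transformation $\theta:\widehat F\to\widehat G$ with $\overline F_{X,Y}(\alpha)\le S_{\theta_X,\theta_Y}(\overline G_{X,Y}(\alpha))$ for all $\alpha$. A 1-arrow $F:R\to S$ preserves quotients if whenever $q$ is a quotient arrow of an $R$-equivalence relation $\rho$ on $X$, $\widehat Fq$ is a quotient arrow of $\overline F_{X,X}(\rho)$. $\mathbf{EQRD}$ is the 2-category of extensional relational doctrines with quotients, quotient-preserving 1-arrows, and all 2-arrows of $\mathbf{RD}$ between them. A 1-arrow $F$ is fully faithful if $\widehat F$ is a full and faithful functor and every $\overline F_{X,Y}$ is an isomorphism of posets. Extensional quotient completion. For a relational doctrine $S$ on $\mathcal D$, the relational doctrine $S^{eq}$ has as base the category whose objects are pairs $\langle X,\rho\rangle$ with $X$ in $\mathcal D$ and $\rho$ an $S$-equivalence relation on $X$, and whose arrows $[f]:\langle X,\rho\rangle\to\langle Y,\sigma\rangle$ are classes of arrows $f:X\to Y$ with $\rho\le\Gamma_f;\sigma;\Gamma_f^\bot$, where $f\sim g$ iff $\rho\le\Gamma_f;\sigma;\Gamma_g^\bot$. Its fibres are $S^{eq}(\langle X,\rho\rangle,\langle Y,\sigma\rangle)=\{\alpha\in S(X,Y)\mid\rho;\alpha;\sigma\le\alpha\}$, with $S^{eq}_{[f],[g]}=S_{f,g}$, composition and converse as in $S$, and $\mathsf d_{\langle X,\rho\rangle}=\rho$. It is extensional and has quotients. The 1-arrow $F^\sharp$. For $F:S\to R$ in $\mathbf{RD}$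 with $R$ extensional and with quotients, $F^\sharp:S^{eq}\to R$ is the quotient-preserving 1-arrow (determined up to isomorphism) obtained as follows: choose for each $\langle X,\rho\rangle$ an effective descent quotient arrow $q_{\langle X,\rho\rangle}:\widehat FX\to\widehat{F^\sharp}\langle X,\rho\rangle$ of $\overline F_{X,X}(\rho)$ in $R$; $\widehat{F^\sharp}[f]$, for $[f]:\langle X,\rho\rangle\to\langle Y,\sigma\rangle$, is the unique arrow with $\widehat{F^\sharp}[f]\circ q_{\langle X,\rho\rangle}=q_{\langle Y,\sigma\rangle}\circ\widehat Ff$; and $\overline{F^\sharp}(\alpha)=\Gamma_{q_{\langle X,\rho\rangle}}^\bot;\overline F_{X,Y}(\alpha);\Gamma_{q_{\langle Y,\sigma\rangle}}$. *)

theory Defs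
  imports Main
begin

text \<open>All structures live on explicit carriers: the fields of the records below are only
  constrained on objects, on (composable) arrows and on elements of fibres.
  \<open>Comp C g f\<close> is the composite "g after f".\<close>

record ('o, 'a) cat =
  Obj :: "'o set"
  Arr :: "'a set"
  Dom :: "'a \<Rightarrow> 'o"
  Cod :: "'a \<Rightarrow> 'o"
  Ide :: "'o \<Rightarrow> 'a"
  Comp :: "'a \<Rightarrow> 'a \<Rightarrow> 'a"

definition hom :: "('o, 'a, 'm) cat_scheme \<Rightarrow> 'o \<Rightarrow> 'o \<Rightarrow> 'a set" where
  "hom C X Y = {f \<in> Arr C. Dom C f = X \<and> Cod C f = Y}"

locale category =
  fixes C :: "('o, 'a, 'm) cat_scheme"
  assumes Dom_Obj: "f \<in> Arr C \<Longrightarrow> Dom C f \<in> Obj C"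
    and Cod_Obj: "f \<in> Arr C \<Longrightarrow> Cod C f \<in> Obj C"
    and Ide_hom: "X \<in> Obj C \<Longrightarrow> Ide C X \<in> hom C X X"
    and Comp_hom: "f \<in> hom C X Y \<Longrightarrow> g \<in> hom C Y Z \<Longrightarrow> Comp C g f \<in> hom C X Z"
    and Comp_Ide: "f \<in> hom C X Y \<Longrightarrow> Comp C f (Ide C X) = f"
    and Ide_Comp: "f \<in> hom C X Y \<Longrightarrow> Comp C (Ide C Y) f = f"
    and Comp_assoc: "f \<in> hom C X Y \<Longrightarrow> g \<in> hom C Y Z \<Longrightarrow> h \<in> hom C Z W \<Longrightarrow>
      Comp C h (Comp C g f) = Comp C (Comp C h g) f"


subsection \<open>Relational doctrines\<close>

text \<open>A relational doctrine is a category (its base) with additional structure.  The fibres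
  need not be disjoint, hence order, composition and converse carry the objects as arguments:
  for \<open>\<alpha> \<in> Fib R X Y\<close> and \<open>\<beta> \<in> Fib R Y Z\<close>, \<open>Rcomp R X Y Z \<alpha> \<beta>\<close> is
  \<open>\<alpha> ; \<beta>\<close> (in diagrammatic order) and \<open>Conv R X Y \<alpha>\<close> is the converse of \<open>\<alpha>\<close>.
  \<open>Pull R f g\<close> is the action of the functor on the pair of arrows \<open>(f, g)\<close>.\<close>

record ('o, 'a, 'r) reldoc = "('o, 'a) cat" +
  Fib :: "'o \<Rightarrow> 'o \<Rightarrow> 'r set"
  Leq :: "'o \<Rightarrow> 'o \<Rightarrow> 'r \<Rightarrow> 'r \<Rightarrow> bool"
  Pull :: "'a \<Rightarrow> 'a \<Rightarrow> 'r \<Rightarrow> 'r"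
  Rcomp :: "'o \<Rightarrow> 'o \<Rightarrow> 'o \<Rightarrow> 'r \<Rightarrow> 'r \<Rightarrow> 'r"
  Diag :: "'o \<Rightarrow> 'r"
  Conv :: "'o \<Rightarrow> 'o \<Rightarrow> 'r \<Rightarrow> 'r"

locale relational_doctrine = category R
  for R :: "('o, 'a, 'r) reldoc" +
  assumes Leq_refl: "X \<in> Obj R \<Longrightarrow> Y \<in> Obj R \<Longrightarrow> \<alpha> \<in> Fib R X Y \<Longrightarrow> Leq R X Y \<alpha> \<alpha>"
    and Leq_trans: "X \<in> Obj R \<Longrightarrow> Y \<in> Obj R \<Longrightarrow>
      \<alpha> \<in> Fib R X Y \<Longrightarrow> \<beta> \<in> Fib R X Y \<Longrightarrow> \<gamma> \<in> Fib R X Y \<Longrightarrow>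
      Leq R X Y \<alpha> \<beta> \<Longrightarrow> Leq R X Y \<beta> \<gamma> \<Longrightarrow> Leq R X Y \<alpha> \<gamma>"
    and Leq_antisym: "X \<in> Obj R \<Longrightarrow> Y \<in> Obj R \<Longrightarrow>
      \<alpha> \<in> Fib R X Y \<Longrightarrow> \<beta> \<in> Fib R X Y \<Longrightarrow>
      Leq R X Y \<alpha> \<beta> \<Longrightarrow> Leq R X Y \<beta> \<alpha> \<Longrightarrow> \<alpha> = \<beta>"
    and Pull_Fib: "f \<in> hom R A X \<Longrightarrow> g \<in> hom R B Y \<Longrightarrow> \<alpha> \<in> Fib R X Y \<Longrightarrow>
      Pull R f g \<alpha> \<in> Fib R A B"
    and Pull_mono: "f \<in> hom R A X \<Longrightarrow> g \<in> hom R B Y \<Longrightarrow>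
      \<alpha> \<in> Fib R X Y \<Longrightarrow> \<beta> \<in> Fib R X Y \<Longrightarrow> Leq R X Y \<alpha> \<beta> \<Longrightarrow>
      Leq R A B (Pull R f g \<alpha>) (Pull R f g \<beta>)"
    and Pull_Ide: "X \<in> Obj R \<Longrightarrow> Y \<in> Obj R \<Longrightarrow> \<alpha> \<in> Fib R X Y \<Longrightarrow>
      Pull R (Ide R X) (Ide R Y) \<alpha> = \<alpha>"
    and Pull_Comp: "f' \<in> hom R A' A \<Longrightarrow> f \<in> hom R A X \<Longrightarrow>
      g' \<in> hom R B' B \<Longrightarrow> g \<in> hom R B Y \<Longrightarrow> \<alpha> \<in> Fib R X Y \<Longrightarrow>
      Pull R (Comp R f f') (Comp R g g') \<alpha> = Pull R f' g' (Pull R f g \<alpha>)"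
    and Rcomp_Fib: "X \<in> Obj R \<Longrightarrow> Y \<in> Obj R \<Longrightarrow> Z \<in> Obj R \<Longrightarrow>
      \<alpha> \<in> Fib R X Y \<Longrightarrow> \<beta> \<in> Fib R Y Z \<Longrightarrow> Rcomp R X Y Z \<alpha> \<beta> \<in> Fib R X Z"
    and Rcomp_mono: "X \<in> Obj R \<Longrightarrow> Y \<in> Obj R \<Longrightarrow> Z \<in> Obj R \<Longrightarrow>
      \<alpha> \<in> Fib R X Y \<Longrightarrow> \<alpha>' \<in> Fib R X Y \<Longrightarrow> \<beta> \<in> Fib R Y Z \<Longrightarrow> \<beta>' \<in> Fib R Y Z \<Longrightarrow>
      Leq R X Y \<alpha> \<alpha>' \<Longrightarrow> Leq R Y Z \<beta> \<beta>' \<Longrightarrow>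
      Leq R X Z (Rcomp R X Y Z \<alpha> \<beta>) (Rcomp R X Y Z \<alpha>' \<beta>')"
    and Diag_Fib: "X \<in> Obj R \<Longrightarrow> Diag R X \<in> Fib R X X"
    and Conv_Fib: "X \<in> Obj R \<Longrightarrow> Y \<in> Obj R \<Longrightarrow> \<alpha> \<in> Fib R X Y \<Longrightarrow>
      Conv R X Y \<alpha> \<in> Fib R Y X"
    and Conv_mono: "X \<in> Obj R \<Longrightarrow> Y \<in> Obj R \<Longrightarrow>
      \<alpha> \<in> Fib R X Y \<Longrightarrow> \<beta> \<in> Fib R X Y \<Longrightarrow> Leq R X Y \<alpha> \<beta> \<Longrightarrow>
      Leq R Y X (Conv R X Y \<alpha>) (Conv R X Y \<beta>)"
    and Rcomp_assoc: "X \<in> Obj R \<Longrightarrow> Y \<in> Obj R \<Longrightarrow> Z \<in> Obj R \<Longrightarrow> W \<in> Obj R \<Longrightarrow>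
      \<alpha> \<in> Fib R X Y \<Longrightarrow> \<beta> \<in> Fib R Y Z \<Longrightarrow> \<gamma> \<in> Fib R Z W \<Longrightarrow>
      Rcomp R X Y W \<alpha> (Rcomp R Y Z W \<beta> \<gamma>) = Rcomp R X Z W (Rcomp R X Y Z \<alpha> \<beta>) \<gamma>"
    and Diag_Rcomp: "X \<in> Obj R \<Longrightarrow> Y \<in> Obj R \<Longrightarrow> \<alpha> \<in> Fib R X Y \<Longrightarrow>
      Rcomp R X X Y (Diag R X) \<alpha> = \<alpha>"
    and Rcomp_Diag: "X \<in> Obj R \<Longrightarrow> Y \<in> Obj R \<Longrightarrow> \<alpha> \<in> Fib R X Y \<Longrightarrow>
      Rcomp R X Y Y \<alpha> (Diag R Y) = \<alpha>"
    and Conv_Rcomp: "X \<in> Obj R \<Longrightarrow> Y \<in> Obj R \<Longrightarrow> Z \<in> Obj R \<Longrightarrow>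
      \<alpha> \<in> Fib R X Y \<Longrightarrow> \<beta> \<in> Fib R Y Z \<Longrightarrow>
      Conv R X Z (Rcomp R X Y Z \<alpha> \<beta>) = Rcomp R Z Y X (Conv R Y Z \<beta>) (Conv R X Y \<alpha>)"
    and Conv_Diag: "X \<in> Obj R \<Longrightarrow> Conv R X X (Diag R X) = Diag R X"
    and Conv_Conv: "X \<in> Obj R \<Longrightarrow> Y \<in> Obj R \<Longrightarrow> \<alpha> \<in> Fib R X Y \<Longrightarrow>
      Conv R Y X (Conv R X Y \<alpha>) = \<alpha>"
    and Pull_Rcomp: "f \<in> hom R A X \<Longrightarrow> g \<in> hom R B Y \<Longrightarrow> h \<in> hom R C Z \<Longrightarrow>
      \<alpha> \<in> Fib R X Y \<Longrightarrow> \<beta> \<in> Fib R Y Z \<Longrightarrow>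
      Leq R A C (Rcomp R A B C (Pull R f g \<alpha>) (Pull R g h \<beta>))
        (Pull R f h (Rcomp R X Y Z \<alpha> \<beta>))"
    and Pull_Diag: "f \<in> hom R A X \<Longrightarrow> Leq R A A (Diag R A) (Pull R f f (Diag R X))"
    and Pull_Conv: "f \<in> hom R A X \<Longrightarrow> g \<in> hom R B Y \<Longrightarrow> \<alpha> \<in> Fib R X Y \<Longrightarrow>
      Leq R B A (Conv R A B (Pull R f g \<alpha>)) (Pull R g f (Conv R X Y \<alpha>))"

definition graph :: "('o, 'a, 'r) reldoc \<Rightarrow> 'a \<Rightarrow> 'r" where
  "graph R f = Pull R f (Ide R (Cod R f)) (Diag R (Cod R f))"

definition cograph :: "('o, 'a, 'r) reldoc \<Rightarrow> 'a \<Rightarrow> 'r" where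
  "cograph R f = Conv R (Dom R f) (Cod R f) (graph R f)"

definition kernel :: "('o, 'a, 'r) reldoc \<Rightarrow> 'a \<Rightarrow> 'r" where
  "kernel R f = Rcomp R (Dom R f) (Cod R f) (Dom R f) (graph R f) (cograph R f)"

definition extensional :: "('o, 'a, 'r) reldoc \<Rightarrow> bool" where
  "extensional R \<longleftrightarrow>
    (\<forall>X \<in> Obj R. \<forall>Y \<in> Obj R. \<forall>f \<in> hom R X Y. \<forall>g \<in> hom R X Y. graph R f = graph R g \<longrightarrow> f = g)"


subsection \<open>Quotients and projective objects\<close>

definition equiv_rel :: "('o, 'a, 'r) reldoc \<Rightarrow> 'o \<Rightarrow> 'r \<Rightarrow> bool" where
  "equiv_rel R X \<rho> \<longleftrightarrow> X \<in> Obj R \<and> \<rho> \<in> Fib R X X \<and>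
    Leq R X X (Diag R X) \<rho> \<and> Leq R X X (Conv R X X \<rho>) \<rho> \<and> Leq R X X (Rcomp R X X X \<rho> \<rho>) \<rho>"

definition quotient_arrow_of :: "('o, 'a, 'r) reldoc \<Rightarrow> 'o \<Rightarrow> 'r \<Rightarrow> 'a \<Rightarrow> bool" where
  "quotient_arrow_of R X \<rho> q \<longleftrightarrow> equiv_rel R X \<rho> \<and> q \<in> Arr R \<and> Dom R q = X \<and>
    Leq R X X \<rho> (kernel R q) \<and>
    (\<forall>Z \<in> Obj R. \<forall>f \<in> hom R X Z. Leq R X X \<rho> (kernel R f) \<longrightarrow>
      (\<exists>!h. h \<in> hom R (Cod R q) Z \<and> f = Comp R h q))"

definition effective :: "('o, 'a, 'r) reldoc \<Rightarrow> 'r \<Rightarrow> 'a \<Rightarrow> bool" where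
  "effective R \<rho> q \<longleftrightarrow> \<rho> = kernel R q"

definition descent :: "('o, 'a, 'r) reldoc \<Rightarrow> 'a \<Rightarrow> bool" where
  "descent R q \<longleftrightarrow>
    Rcomp R (Cod R q) (Dom R q) (Cod R q) (cograph R q) (graph R q) = Diag R (Cod R q)"

definition has_quotients :: "('o, 'a, 'r) reldoc \<Rightarrow> bool" where
  "has_quotients R \<longleftrightarrow> (\<forall>X \<rho>. equiv_rel R X \<rho> \<longrightarrow>
    (\<exists>q. quotient_arrow_of R X \<rho> q \<and> effective R \<rho> q \<and> descent R q))"

definition quotient_arrow :: "('o, 'a, 'r) reldoc \<Rightarrow> 'a \<Rightarrow> bool" where
  "quotient_arrow R q \<longleftrightarrow> (\<exists>\<rho>. quotient_arrow_of R (Dom R q) \<rho> q)"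

definition projective :: "('o, 'a, 'r) reldoc \<Rightarrow> 'o \<Rightarrow> bool" where
  "projective R P \<longleftrightarrow> P \<in> Obj R \<and>
    (\<forall>X \<in> Obj R. \<forall>Y \<in> Obj R. \<forall>f \<in> hom R P Y. \<forall>q \<in> hom R X Y. quotient_arrow R q \<longrightarrow>
      (\<exists>h \<in> hom R P X. f = Comp R q h))"

definition Proj :: "('o, 'a, 'r) reldoc \<Rightarrow> ('o, 'a, 'r) reldoc" where
  "Proj R = R\<lparr>
    Obj := {P \<in> Obj R. projective R P},
    Arr := {f \<in> Arr R. projective R (Dom R f) \<and> projective R (Cod R f)}\<rparr>"


subsection \<open>The 2-category of relational doctrines\<close>

record ('p, 'b, 's, 'o, 'a, 'r) rd_map =
  fobj :: "'p \<Rightarrow> 'o"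
  farr :: "'b \<Rightarrow> 'a"
  frel :: "'p \<Rightarrow> 'p \<Rightarrow> 's \<Rightarrow> 'r"

locale is_functor = dom: category C + cod: category D
  for C :: "('p, 'b, 'm) cat_scheme" and D :: "('o, 'a, 'n) cat_scheme"
    and F_obj :: "'p \<Rightarrow> 'o" and F_arr :: "'b \<Rightarrow> 'a" +
  assumes F_Obj: "X \<in> Obj C \<Longrightarrow> F_obj X \<in> Obj D"
    and F_hom: "f \<in> hom C X Y \<Longrightarrow> F_arr f \<in> hom D (F_obj X) (F_obj Y)"
    and F_Ide: "X \<in> Obj C \<Longrightarrow> F_arr (Ide C X) = Ide D (F_obj X)"
    and F_Comp: "f \<in> hom C X Y \<Longrightarrow> g \<in> hom C Y Z \<Longrightarrow>
      F_arr (Comp C g f) = Comp D (F_arr g) (F_arr f)"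

locale rd_arrow =
  dom: relational_doctrine S + cod: relational_doctrine R + is_functor S R "fobj F" "farr F"
  for S :: "('p, 'b, 's) reldoc" and R :: "('o, 'a, 'r) reldoc"
    and F :: "('p, 'b, 's, 'o, 'a, 'r) rd_map" +
  assumes frel_Fib: "X \<in> Obj S \<Longrightarrow> Y \<in> Obj S \<Longrightarrow> \<alpha> \<in> Fib S X Y \<Longrightarrow>
      frel F X Y \<alpha> \<in> Fib R (fobj F X) (fobj F Y)"
    and frel_mono: "X \<in> Obj S \<Longrightarrow> Y \<in> Obj S \<Longrightarrow>
      \<alpha> \<in> Fib S X Y \<Longrightarrow> \<beta> \<in> Fib S X Y \<Longrightarrow> Leq S X Y \<alpha> \<beta> \<Longrightarrow>
      Leq R (fobj F X) (fobj F Y) (frel F X Y \<alpha>) (frel F X Y \<beta>)"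
    and frel_natural: "f \<in> hom S A X \<Longrightarrow> g \<in> hom S B Y \<Longrightarrow> \<alpha> \<in> Fib S X Y \<Longrightarrow>
      frel F A B (Pull S f g \<alpha>) = Pull R (farr F f) (farr F g) (frel F X Y \<alpha>)"
    and frel_Diag: "X \<in> Obj S \<Longrightarrow> frel F X X (Diag S X) = Diag R (fobj F X)"
    and frel_Rcomp: "X \<in> Obj S \<Longrightarrow> Y \<in> Obj S \<Longrightarrow> Z \<in> Obj S \<Longrightarrow>
      \<alpha> \<in> Fib S X Y \<Longrightarrow> \<beta> \<in> Fib S Y Z \<Longrightarrow>
      frel F X Z (Rcomp S X Y Z \<alpha> \<beta>) =
        Rcomp R (fobj F X) (fobj F Y) (fobj F Z) (frel F X Y \<alpha>) (frel F Y Z \<beta>)"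
    and frel_Conv: "X \<in> Obj S \<Longrightarrow> Y \<in> Obj S \<Longrightarrow> \<alpha> \<in> Fib S X Y \<Longrightarrow>
      frel F Y X (Conv S X Y \<alpha>) = Conv R (fobj F X) (fobj F Y) (frel F X Y \<alpha>)"

definition id_map :: "('o, 'a, 'r, 'o, 'a, 'r) rd_map" where
  "id_map = \<lparr>fobj = \<lambda>X. X, farr = \<lambda>f. f, frel = \<lambda>X Y \<alpha>. \<alpha>\<rparr>"

definition comp_map :: "('o, 'a, 'r, 'k, 'c, 't) rd_map \<Rightarrow> ('p, 'b, 's, 'o, 'a, 'r) rd_map
    \<Rightarrow> ('p, 'b, 's, 'k, 'c, 't) rd_map" where
  "comp_map G F = \<lparr>fobj = \<lambda>X. fobj G (fobj F X), farr = \<lambda>f. farr G (farr F f),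
    frel = \<lambda>X Y \<alpha>. frel G (fobj F X) (fobj F Y) (frel F X Y \<alpha>)\<rparr>"

definition two_arrow :: "('p, 'b, 's) reldoc \<Rightarrow> ('o, 'a, 'r) reldoc
    \<Rightarrow> ('p, 'b, 's, 'o, 'a, 'r) rd_map \<Rightarrow> ('p, 'b, 's, 'o, 'a, 'r) rd_map \<Rightarrow> ('p \<Rightarrow> 'a) \<Rightarrow> bool" where
  "two_arrow S R F G \<theta> \<longleftrightarrow>
    (\<forall>X \<in> Obj S. \<theta> X \<in> hom R (fobj F X) (fobj G X)) \<and>
    (\<forall>X \<in> Obj S. \<forall>Y \<in> Obj S. \<forall>f \<in> hom S X Y.
      Comp R (\<theta> Y) (farr F f) = Comp R (farr G f) (\<theta> X)) \<and>
    (\<forall>X \<in> Obj S. \<forall>Y \<in> Obj S. \<forall>\<alpha> \<in> Fib S X Y.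
      Leq R (fobj F X) (fobj F Y) (frel F X Y \<alpha>) (Pull R (\<theta> X) (\<theta> Y) (frel G X Y \<alpha>)))"

definition iso_two_arrow :: "('p, 'b, 's) reldoc \<Rightarrow> ('o, 'a, 'r) reldoc
    \<Rightarrow> ('p, 'b, 's, 'o, 'a, 'r) rd_map \<Rightarrow> ('p, 'b, 's, 'o, 'a, 'r) rd_map \<Rightarrow> ('p \<Rightarrow> 'a) \<Rightarrow> bool" where
  "iso_two_arrow S R F G \<theta> \<longleftrightarrow> two_arrow S R F G \<theta> \<and>
    (\<exists>\<theta>'. two_arrow S R G F \<theta>' \<and>
      (\<forall>X \<in> Obj S. Comp R (\<theta>' X) (\<theta> X) = Ide R (fobj F X) \<and>
        Comp R (\<theta> X) (\<theta>' X) = Ide R (fobj G X)))"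

definition fully_faithful :: "('p, 'b, 's) reldoc \<Rightarrow> ('o, 'a, 'r) reldoc
    \<Rightarrow> ('p, 'b, 's, 'o, 'a, 'r) rd_map \<Rightarrow> bool" where
  "fully_faithful S R F \<longleftrightarrow>
    (\<forall>X \<in> Obj S. \<forall>Y \<in> Obj S.
      bij_betw (farr F) (hom S X Y) (hom R (fobj F X) (fobj F Y)) \<and>
      bij_betw (frel F X Y) (Fib S X Y) (Fib R (fobj F X) (fobj F Y)) \<and>
      (\<forall>\<alpha> \<in> Fib S X Y. \<forall>\<beta> \<in> Fib S X Y.
        Leq S X Y \<alpha> \<beta> \<longleftrightarrow>
        Leq R (fobj F X) (fobj F Y) (frel F X Y \<alpha>) (frel F X Y \<beta>)))"

text \<open>Corestricting along the inclusion of \<open>Proj R\<close> into \<open>R\<close> does not change the underlying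
  maps, so "F factors through \<open>Proj R\<close>" says that \<open>F\<close> is itself a 1-arrow into \<open>Proj R\<close>.\<close>

definition factors_through_Proj :: "('p, 'b, 's) reldoc \<Rightarrow> ('o, 'a, 'r) reldoc
    \<Rightarrow> ('p, 'b, 's, 'o, 'a, 'r) rd_map \<Rightarrow> bool" where
  "factors_through_Proj S R F \<longleftrightarrow> rd_arrow S (Proj R) F"

lemma factors_through_Proj_iff:
  assumes "rd_arrow S R F"
  shows "factors_through_Proj S R F \<longleftrightarrow> (\<forall>A \<in> Obj S. projective R (fobj F A))"
proof
  assume "factors_through_Proj S R F"
  then have "rd_arrow S (Proj R) F" by (simp add: factors_through_Proj_def)
  then interpret P: rd_arrow S "Proj R" F .
  show "\<forall>A \<in> Obj S. projective R (fobj F A)"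
    using P.F_Obj by (auto simp: Proj_def)
next
  assume proj: "\<forall>A \<in> Obj S. projective R (fobj F A)"
  interpret F: rd_arrow S R F by fact
  have homD: "f \<in> hom R X Y" if "f \<in> hom (Proj R) X Y" for f X Y
    using that by (auto simp: hom_def Proj_def)
  have ObjD: "X \<in> Obj R" if "X \<in> Obj (Proj R)" for X
    using that by (auto simp: Proj_def)
  have sel: "Dom (Proj R) = Dom R" "Cod (Proj R) = Cod R" "Ide (Proj R) = Ide R"
    "Comp (Proj R) = Comp R" "Fib (Proj R) = Fib R" "Leq (Proj R) = Leq R"
    "Pull (Proj R) = Pull R" "Rcomp (Proj R) = Rcomp R" "Diag (Proj R) = Diag R"
    "Conv (Proj R) = Conv R"
    by (simp_all add: Proj_def)
  have "category (Proj R)"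
  proof
    fix f assume "f \<in> Arr (Proj R)"
    then show "Dom (Proj R) f \<in> Obj (Proj R)" and "Cod (Proj R) f \<in> Obj (Proj R)"
      by (auto simp: Proj_def F.cod.Dom_Obj F.cod.Cod_Obj)
  next
    fix X assume "X \<in> Obj (Proj R)"
    then show "Ide (Proj R) X \<in> hom (Proj R) X X"
      using F.cod.Ide_hom[of X] by (auto simp: Proj_def hom_def)
  next
    fix f g X Y Z assume "f \<in> hom (Proj R) X Y" "g \<in> hom (Proj R) Y Z"
    then show "Comp (Proj R) g f \<in> hom (Proj R) X Z"
      using F.cod.Comp_hom[of f X Y g Z] by (auto simp: Proj_def hom_def)
  qed (use F.cod.Comp_Ide F.cod.Ide_Comp F.cod.Comp_assoc in \<open>auto simp: sel dest!: homD\<close>)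
  then interpret P: category "Proj R" .
  have "relational_doctrine (Proj R)"
    by unfold_locales
      (simp_all only: sel,
        (blast dest: homD ObjD
          intro: F.cod.Leq_refl F.cod.Leq_trans F.cod.Leq_antisym F.cod.Pull_Fib F.cod.Pull_mono
            F.cod.Pull_Ide F.cod.Pull_Comp F.cod.Rcomp_Fib F.cod.Rcomp_mono F.cod.Diag_Fib
            F.cod.Conv_Fib F.cod.Conv_mono F.cod.Rcomp_assoc F.cod.Diag_Rcomp F.cod.Rcomp_Diag
            F.cod.Conv_Rcomp F.cod.Conv_Diag F.cod.Conv_Conv F.cod.Pull_Rcomp F.cod.Pull_Diag
            F.cod.Pull_Conv)+)
  then interpret P: relational_doctrine "Proj R" .
  have homI: "f \<in> hom (Proj R) (fobj F X) (fobj F Y)"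
    if "f \<in> hom R (fobj F X) (fobj F Y)" "X \<in> Obj S" "Y \<in> Obj S" for f X Y
    using that proj by (auto simp: hom_def Proj_def)
  have dc: "X \<in> Obj S \<and> Y \<in> Obj S" if "f \<in> hom S X Y" for f X Y
    using that F.dom.Dom_Obj F.dom.Cod_Obj by (auto simp: hom_def)
  have "rd_arrow S (Proj R) F"
  proof
    fix X assume "X \<in> Obj S"
    then show "fobj F X \<in> Obj (Proj R)" using proj F.F_Obj by (simp add: Proj_def)
  next
    fix f X Y assume "f \<in> hom S X Y"
    then show "farr F f \<in> hom (Proj R) (fobj F X) (fobj F Y)"
      using homI dc F.F_hom by blast
  qed (simp_all add: sel F.F_Ide F.F_Comp F.frel_Fib F.frel_mono F.frel_natural F.frel_Diag
      F.frel_Rcomp F.frel_Conv)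
  then show "factors_through_Proj S R F" by (simp add: factors_through_Proj_def)
qed


subsection \<open>The 2-category of extensional relational doctrines with quotients\<close>

definition preserves_quotients :: "('p, 'b, 's) reldoc \<Rightarrow> ('o, 'a, 'r) reldoc
    \<Rightarrow> ('p, 'b, 's, 'o, 'a, 'r) rd_map \<Rightarrow> bool" where
  "preserves_quotients S R F \<longleftrightarrow> (\<forall>X \<rho> q. quotient_arrow_of S X \<rho> q \<longrightarrow>
    quotient_arrow_of R (fobj F X) (frel F X X \<rho>) (farr F q))"

definition EQRD_obj :: "('o, 'a, 'r) reldoc \<Rightarrow> bool" where
  "EQRD_obj R \<longleftrightarrow> relational_doctrine R \<and> extensional R \<and> has_quotients R"

definition EQRD_arrow :: "('p, 'b, 's) reldoc \<Rightarrow> ('o, 'a, 'r) reldoc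
    \<Rightarrow> ('p, 'b, 's, 'o, 'a, 'r) rd_map \<Rightarrow> bool" where
  "EQRD_arrow S R F \<longleftrightarrow>
    EQRD_obj S \<and> EQRD_obj R \<and> rd_arrow S R F \<and> preserves_quotients S R F"

definition EQRD_equivalence :: "('p, 'b, 's) reldoc \<Rightarrow> ('o, 'a, 'r) reldoc
    \<Rightarrow> ('p, 'b, 's, 'o, 'a, 'r) rd_map \<Rightarrow> bool" where
  "EQRD_equivalence S R F \<longleftrightarrow> EQRD_arrow S R F \<and>
    (\<exists>G \<eta> \<epsilon>. EQRD_arrow R S G \<and>
      iso_two_arrow S S id_map (comp_map G F) \<eta> \<and>
      iso_two_arrow R R (comp_map F G) id_map \<epsilon>)"


subsection \<open>The extensional quotient completion\<close>

definition eq_pre_hom :: "('p, 'b, 's) reldoc \<Rightarrow> 'p \<times> 's \<Rightarrow> 'p \<times> 's \<Rightarrow> 'b set" where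
  "eq_pre_hom S = (\<lambda>(X, \<rho>) (Y, \<sigma>). {f \<in> hom S X Y.
    Leq S X X \<rho> (Rcomp S X Y X (Rcomp S X Y Y (graph S f) \<sigma>) (cograph S f))})"

definition eq_sim :: "('p, 'b, 's) reldoc \<Rightarrow> 'p \<times> 's \<Rightarrow> 'p \<times> 's \<Rightarrow> ('b \<times> 'b) set" where
  "eq_sim S = (\<lambda>(X, \<rho>) (Y, \<sigma>).
    {(f, g). f \<in> eq_pre_hom S (X, \<rho>) (Y, \<sigma>) \<and> g \<in> eq_pre_hom S (X, \<rho>) (Y, \<sigma>) \<and>
      Leq S X X \<rho> (Rcomp S X Y X (Rcomp S X Y Y (graph S f) \<sigma>) (cograph S g))})"

text \<open>An arrow from \<open>A\<close> to \<open>B\<close> is stored as a triple of \<open>A\<close>, \<open>B\<close> and an equivalence class of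
  arrows of \<open>S\<close>.  The composite of two classes is the class of the composites of their members;
  reindexing is computed on arbitrary members of the two classes.\<close>

definition eq_completion :: "('p, 'b, 's) reldoc
    \<Rightarrow> ('p \<times> 's, ('p \<times> 's) \<times> ('p \<times> 's) \<times> 'b set, 's) reldoc" where
  "eq_completion S = \<lparr>
    Obj = {(X, \<rho>). equiv_rel S X \<rho>},
    Arr = {(A, B, c). (case A of (X, \<rho>) \<Rightarrow> equiv_rel S X \<rho>) \<and>
      (case B of (Y, \<sigma>) \<Rightarrow> equiv_rel S Y \<sigma>) \<and> c \<in> eq_pre_hom S A B // eq_sim S A B},
    Dom = (\<lambda>(A, B, c). A),
    Cod = (\<lambda>(A, B, c). B),
    Ide = (\<lambda>A. (A, A, eq_sim S A A `` {Ide S (fst A)})),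
    Comp = (\<lambda>(B', D, d) (A, B, c). (A, D, eq_sim S A D `` {Comp S g f | g f. g \<in> d \<and> f \<in> c})),
    Fib = (\<lambda>(X, \<rho>) (Y, \<sigma>). {\<alpha> \<in> Fib S X Y.
      Leq S X Y (Rcomp S X Y Y (Rcomp S X X Y \<rho> \<alpha>) \<sigma>) \<alpha>}),
    Leq = (\<lambda>(X, \<rho>) (Y, \<sigma>). Leq S X Y),
    Pull = (\<lambda>(A, B, c) (A', B', c'). Pull S (SOME f. f \<in> c) (SOME g. g \<in> c')),
    Rcomp = (\<lambda>(X, \<rho>) (Y, \<sigma>) (Z, \<tau>). Rcomp S X Y Z),
    Diag = (\<lambda>(X, \<rho>). \<rho>),
    Conv = (\<lambda>(X, \<rho>) (Y, \<sigma>). Conv S X Y)\<rparr>"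


subsection \<open>The 1-arrow induced by a choice of quotients\<close>

definition quotient_choice :: "('p, 'b, 's) reldoc \<Rightarrow> ('o, 'a, 'r) reldoc
    \<Rightarrow> ('p, 'b, 's, 'o, 'a, 'r) rd_map \<Rightarrow> ('p \<times> 's \<Rightarrow> 'a) \<Rightarrow> bool" where
  "quotient_choice S R F q \<longleftrightarrow> (\<forall>X \<rho>. equiv_rel S X \<rho> \<longrightarrow>
    quotient_arrow_of R (fobj F X) (frel F X X \<rho>) (q (X, \<rho>)) \<and>
    effective R (frel F X X \<rho>) (q (X, \<rho>)) \<and> descent R (q (X, \<rho>)))"

definition sharp :: "('o, 'a, 'r) reldoc \<Rightarrow> ('p, 'b, 's, 'o, 'a, 'r) rd_map \<Rightarrow> ('p \<times> 's \<Rightarrow> 'a)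
    \<Rightarrow> ('p \<times> 's, ('p \<times> 's) \<times> ('p \<times> 's) \<times> 'b set, 's, 'o, 'a, 'r) rd_map" where
  "sharp R F q = \<lparr>
    fobj = (\<lambda>A. Cod R (q A)),
    farr = (\<lambda>(A, B, c). THE h. h \<in> hom R (Cod R (q A)) (Cod R (q B)) \<and>
      (\<forall>f \<in> c. Comp R h (q A) = Comp R (q B) (farr F f))),
    frel = (\<lambda>(X, \<rho>) (Y, \<sigma>) \<alpha>.
      Rcomp R (Cod R (q (X, \<rho>))) (fobj F Y) (Cod R (q (Y, \<sigma>)))
        (Rcomp R (Cod R (q (X, \<rho>))) (fobj F X) (fobj F Y)
          (cograph R (q (X, \<rho>))) (frel F X Y \<alpha>))
        (graph R (q (Y, \<sigma>))))\<rparr>"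

end

(* Since F is fully faithful and q A, for A = (X, \<rho>), is an effective descent quotient arrow, the
   fibre of the completion over (A, B) is identified with R(F# A, F# B) by pulling back along q A
   and q B, and its arrows A -> B with those h : F# A -> F# B that lift along q A and q B to an
   arrow in the image of F.  So F# is always faithful and bijective on fibres.  It is full if the
   objects F X are projective, and essentially surjective if and only if every object of R is covered
   by some F P, as quotient arrows of the same equivalence relation are isomorphic.  Conversely, an
   equivalence is full and essentially surjective, and then fullness on arrows out of (P, d_P) gives
   projectivity of F P.  That the completion is an extensional doctrine with quotients, when it is
   needed, is transported back from R along F#. *)
theory Submission
  imports Defs
begin

subsection \<open>The calculus of graphs\<close>

text \<open>The obstacle is laxness: for \<open>Pull\<close> against \<open>Rcomp\<close> and
  \<open>Conv\<close> the axioms give inequalities only. It is overcome by writing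
  \<open>Pull R f g \<alpha>\<close> as \<open>\<alpha>\<close> composed with the graph of
  \<open>f\<close> and the cograph of \<open>g\<close>. If the middle arrow of a composite is
  descent, its cograph and graph cancel, so reindexing along the chosen quotients preserves
  composition strictly. Isomorphisms are descent too, which serves the quasi-inverse in the same
  way. The completion consists of classes, with arbitrary representatives in \<open>Pull\<close>.
  Instead of computing with representatives, each class is replaced by the one arrow that it induces
  between quotients in \<open>R\<close>. This rests on extensionality: two representatives of a
  class become equal, not merely related, after composition with the quotient of their target.
  Projectivity must be tested on quotient arrows with arbitrary domain in \<open>R\<close>. Covering
  the domain from the image of \<open>F\<close> gives a composite of two quotient arrows; descent of
  the first makes it a quotient arrow of its own kernel, and this kernel comes from a relation of
  \<open>S\<close>.\<close>

definition iso_pair :: "('o, 'a, 'm) cat_scheme \<Rightarrow> 'o \<Rightarrow> 'o \<Rightarrow> 'a \<Rightarrow> 'a \<Rightarrow> bool" where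
  "iso_pair C X Y u v \<longleftrightarrow> u \<in> hom C X Y \<and> v \<in> hom C Y X \<and>
    Comp C v u = Ide C X \<and> Comp C u v = Ide C Y"

text \<open>The direct image of a relation along two arrows. On descent arrows it undoes
  \<open>Pull\<close>; at two chosen quotients, applied to the image under \<open>F\<close>, it is
  the action of \<open>sharp\<close> on fibres.\<close>

definition dimage :: "('o, 'a, 'r) reldoc \<Rightarrow> 'a \<Rightarrow> 'a \<Rightarrow> 'r \<Rightarrow> 'r" where
  "dimage R f g \<alpha> = Rcomp R (Cod R f) (Dom R g) (Cod R g)
    (Rcomp R (Cod R f) (Dom R f) (Dom R g) (cograph R f) \<alpha>) (graph R g)"

lemma iso_pair_sym: "iso_pair C X Y u v \<Longrightarrow> iso_pair C Y X v u"
  by (simp add: iso_pair_def)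

context category
begin

lemma homD:
  assumes "f \<in> hom C X Y"
  shows "f \<in> Arr C" "Dom C f = X" "Cod C f = Y" "X \<in> Obj C" "Y \<in> Obj C"
  using assms Dom_Obj Cod_Obj by (auto simp: hom_def)

lemma iso_pair_cancel:
  assumes "iso_pair C X Y u v"
  shows "f \<in> hom C A X \<Longrightarrow> Comp C v (Comp C u f) = f"
    and "f \<in> hom C A Y \<Longrightarrow> Comp C u (Comp C v f) = f"
    and "f \<in> hom C X Z \<Longrightarrow> Comp C (Comp C f v) u = f"
    and "f \<in> hom C Y Z \<Longrightarrow> Comp C (Comp C f u) v = f"
proof -
  have uv: "u \<in> hom C X Y" "v \<in> hom C Y X" "Comp C v u = Ide C X" "Comp C u v = Ide C Y"
    using assms by (auto simp: iso_pair_def)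
  show "f \<in> hom C A X \<Longrightarrow> Comp C v (Comp C u f) = f"
    using Comp_assoc[OF _ uv(1,2)] by (simp add: uv Ide_Comp)
  show "f \<in> hom C A Y \<Longrightarrow> Comp C u (Comp C v f) = f"
    using Comp_assoc[OF _ uv(2,1)] by (simp add: uv Ide_Comp)
  show "f \<in> hom C X Z \<Longrightarrow> Comp C (Comp C f v) u = f"
    using Comp_assoc[OF uv(1,2)] by (simp add: uv Comp_Ide flip: Comp_assoc)
  show "f \<in> hom C Y Z \<Longrightarrow> Comp C (Comp C f u) v = f"
    using Comp_assoc[OF uv(2,1)] by (simp add: uv Comp_Ide flip: Comp_assoc)
qed

end

context relational_doctrine
begin

text \<open>\<open>Pull_Conv\<close> at the converse relation, followed by \<open>Conv\<close>, is
  the reverse inequality, since \<open>Conv\<close> is a monotone involution.\<close>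

lemma Conv_Pull:
  assumes f: "f \<in> hom R A X" and g: "g \<in> hom R B Y" and a: "\<alpha> \<in> Fib R X Y"
  shows "Conv R A B (Pull R f g \<alpha>) = Pull R g f (Conv R X Y \<alpha>)"
proof -
  note ob = homD(4,5)[OF f] homD(4,5)[OF g]
  let ?c = "Pull R g f (Conv R X Y \<alpha>)" and ?p = "Pull R f g \<alpha>"
  have p: "?p \<in> Fib R A B" by (rule Pull_Fib[OF f g a])
  have c: "?c \<in> Fib R B A" by (rule Pull_Fib[OF g f Conv_Fib]) (simp_all add: ob a)
  have "Leq R A B (Conv R B A ?c) ?p"
    using Pull_Conv[OF g f Conv_Fib[OF _ _ a]] by (simp add: ob a Conv_Conv)
  from Conv_mono[OF _ _ _ p this] have "Leq R B A ?c (Conv R A B ?p)"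
    by (simp add: ob c Conv_Fib Conv_Conv)
  with Pull_Conv[OF f g a] show ?thesis
    by (intro Leq_antisym[of B A]) (simp_all add: ob c p Conv_Fib)
qed

lemma graph_hom: "f \<in> hom R X Y \<Longrightarrow> graph R f = Pull R f (Ide R Y) (Diag R Y)"
  by (simp add: graph_def homD)

lemma cograph_hom:
  assumes f: "f \<in> hom R X Y"
  shows "cograph R f = Pull R (Ide R Y) f (Diag R Y)"
  using Conv_Pull[OF f Ide_hom Diag_Fib] homD[OF f]
  by (simp add: cograph_def graph_hom[OF f] Conv_Diag)

lemma graph_Fib: "f \<in> hom R X Y \<Longrightarrow> graph R f \<in> Fib R X Y"
  using Pull_Fib[OF _ Ide_hom Diag_Fib] by (simp add: graph_hom homD)

lemma cograph_Fib: "f \<in> hom R X Y \<Longrightarrow> cograph R f \<in> Fib R Y X"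
  using Pull_Fib[OF Ide_hom _ Diag_Fib] by (simp add: cograph_hom homD)

text \<open>This is \<open>Pull_Rcomp\<close> at two diagonals, with \<open>f\<close> in the middle
  and identities outside.\<close>

lemma graph_functional:
  assumes f: "f \<in> hom R X Y"
  shows "Leq R Y Y (Rcomp R Y X Y (cograph R f) (graph R f)) (Diag R Y)"
  using Pull_Rcomp[OF Ide_hom f Ide_hom Diag_Fib Diag_Fib] homD[OF f]
  by (simp add: cograph_hom[OF f] graph_hom[OF f] Diag_Rcomp Diag_Fib Pull_Ide)

text \<open>Lax functoriality is usually an upper bound for composites; with identities on the outside and
  \<open>f\<close> in the middle it becomes a lower bound for \<open>graph f ; cograph f\<close>.\<close>

lemma graph_total:
  assumes f: "f \<in> hom R X Y"
  shows "Leq R X X (Diag R X) (Rcomp R X Y X (graph R f) (cograph R f))"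
proof -
  note ob = homD(4,5)[OF f]
  let ?k = "Pull R f f (Diag R Y)"
  have k: "?k \<in> Fib R X X" by (rule Pull_Fib[OF f f Diag_Fib[OF ob(2)]])
  have 1: "Pull R (Ide R X) f (graph R f) = ?k"
    using Pull_Comp[OF Ide_hom f f Ide_hom Diag_Fib] ob
    by (simp add: graph_hom[OF f] Comp_Ide[OF f] Ide_Comp[OF f])
  have 2: "Pull R f (Ide R X) (cograph R f) = ?k"
    using Pull_Comp[OF f Ide_hom Ide_hom f Diag_Fib] ob
    by (simp add: cograph_hom[OF f] Comp_Ide[OF f] Ide_Comp[OF f])
  have gc: "Rcomp R X Y X (graph R f) (cograph R f) \<in> Fib R X X"
    by (intro Rcomp_Fib graph_Fib cograph_Fib f ob)
  have 3: "Leq R X X (Rcomp R X X X ?k ?k) (Rcomp R X Y X (graph R f) (cograph R f))"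
    using Pull_Rcomp[OF Ide_hom f Ide_hom graph_Fib[OF f] cograph_Fib[OF f]] ob gc
    by (simp add: 1 2 Pull_Ide)
  have 4: "Leq R X X (Diag R X) ?k" by (rule Pull_Diag[OF f])
  have "Leq R X X (Rcomp R X X X (Diag R X) (Diag R X)) (Rcomp R X X X ?k ?k)"
    using 4 by (intro Rcomp_mono) (simp_all add: ob Diag_Fib k)
  then have 5: "Leq R X X (Diag R X) (Rcomp R X X X ?k ?k)"
    by (simp add: Diag_Rcomp Diag_Fib ob)
  show ?thesis
    by (rule Leq_trans[OF _ _ _ _ _ 5 3]) (simp_all add: ob Diag_Fib Rcomp_Fib k gc)
qed

text \<open>One inequality is laxness at \<open>\<alpha>\<close> composed with a diagonal. For the
  other, \<open>graph_total\<close> inserts \<open>graph R g\<close> and \<open>cograph R g\<close>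
  on the right of the pullback, and laxness absorbs the graph into
  \<open>Pull R f (Ide R Y) \<alpha>\<close>.\<close>

lemma Pull_right:
  assumes f: "f \<in> hom R A X" and g: "g \<in> hom R B Y" and a: "\<alpha> \<in> Fib R X Y"
  shows "Pull R f g \<alpha> = Rcomp R A Y B (Pull R f (Ide R Y) \<alpha>) (cograph R g)"
proof -
  note ob = homD(4,5)[OF f] homD(4,5)[OF g]
  note I = Ide_hom[OF ob(4)]
  let ?p = "Pull R f g \<alpha>" and ?pI = "Pull R f (Ide R Y) \<alpha>"
  have p: "?p \<in> Fib R A B" by (rule Pull_Fib[OF f g a])
  have pI: "?pI \<in> Fib R A Y" by (rule Pull_Fib[OF f I a])
  note gf = graph_Fib[OF g] cograph_Fib[OF g]
  have ge: "Leq R A B (Rcomp R A Y B ?pI (cograph R g)) ?p"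
    using Pull_Rcomp[OF f I g a Diag_Fib] ob a by (simp add: cograph_hom[OF g] Rcomp_Diag)
  have 1: "Leq R A Y (Rcomp R A B Y ?p (graph R g)) ?pI"
    using Pull_Rcomp[OF f g I a Diag_Fib] ob a by (simp add: graph_hom[OF g] Rcomp_Diag)
  have "Leq R A B (Rcomp R A B B ?p (Diag R B))
      (Rcomp R A B B ?p (Rcomp R B Y B (graph R g) (cograph R g)))"
    by (intro Rcomp_mono graph_total[OF g] Leq_refl) (simp_all add: ob p Diag_Fib Rcomp_Fib gf)
  then have 2: "Leq R A B ?p (Rcomp R A Y B (Rcomp R A B Y ?p (graph R g)) (cograph R g))"
    by (simp add: Rcomp_assoc Rcomp_Diag ob p gf)
  have 3: "Leq R A B (Rcomp R A Y B (Rcomp R A B Y ?p (graph R g)) (cograph R g))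
      (Rcomp R A Y B ?pI (cograph R g))"
    by (intro Rcomp_mono 1 Leq_refl) (simp_all add: ob p pI Rcomp_Fib gf)
  have le: "Leq R A B ?p (Rcomp R A Y B ?pI (cograph R g))"
    by (rule Leq_trans[OF _ _ _ _ _ 2 3]) (simp_all add: ob p pI Rcomp_Fib gf)
  show ?thesis
    by (rule Leq_antisym[OF _ _ _ _ le ge]) (simp_all add: ob p pI Rcomp_Fib gf)
qed

text \<open>The mirror image of \<open>Pull_right\<close>, obtained by taking converses.\<close>

lemma Pull_left:
  assumes f: "f \<in> hom R A X" and Y: "Y \<in> Obj R" and a: "\<alpha> \<in> Fib R X Y"
  shows "Pull R f (Ide R Y) \<alpha> = Rcomp R A X Y (graph R f) \<alpha>"
proof -
  note ob = homD(4,5)[OF f] Y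
  note I = Ide_hom[OF Y]
  have a': "Conv R X Y \<alpha> \<in> Fib R Y X" by (simp add: Conv_Fib ob a)
  have "Pull R f (Ide R Y) \<alpha> = Conv R Y A (Pull R (Ide R Y) f (Conv R X Y \<alpha>))"
    using Conv_Pull[OF I f a'] by (simp add: Conv_Conv ob a)
  also have "\<dots> = Conv R Y A (Rcomp R Y X A (Conv R X Y \<alpha>) (cograph R f))"
    using Pull_right[OF I f a'] by (simp add: Pull_Ide ob a')
  also have "\<dots> = Rcomp R A X Y (graph R f) \<alpha>"
    using graph_Fib[OF f] cograph_Fib[OF f] homD[OF f]
    by (simp add: Conv_Rcomp ob a a' Conv_Conv cograph_def)
  finally show ?thesis .
qed

text \<open>Reindexing thus reduces to composition with graphs, and laws of \<open>Pull\<close>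
  become computations with associativity.\<close>

lemma Pull_eq:
  assumes f: "f \<in> hom R A X" and g: "g \<in> hom R B Y" and a: "\<alpha> \<in> Fib R X Y"
  shows "Pull R f g \<alpha> = Rcomp R A Y B (Rcomp R A X Y (graph R f) \<alpha>) (cograph R g)"
  using Pull_right[OF f g a] Pull_left[OF f homD(5)[OF g] a] by simp

section \<open>Kernels, and a criterion for equality of graphs\<close>

lemma kernel_eq: "f \<in> hom R X Y \<Longrightarrow> kernel R f = Pull R f f (Diag R Y)"
  using Pull_eq[of f X Y f X Y "Diag R Y"] homD[of f X Y]
  by (simp add: kernel_def Diag_Fib graph_Fib Rcomp_Diag)

lemma kernel_Fib: "f \<in> hom R X Y \<Longrightarrow> kernel R f \<in> Fib R X X"
  by (simp add: kernel_eq Pull_Fib Diag_Fib homD)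

lemma kernel_Comp:
  assumes "f \<in> hom R X Y" "g \<in> hom R Y Z"
  shows "kernel R (Comp R g f) = Pull R f f (kernel R g)"
  using assms Pull_Comp[OF assms assms Diag_Fib] homD[OF assms(2)]
  by (simp add: kernel_eq[OF assms(2)] kernel_eq[OF Comp_hom[OF assms]])

text \<open>The axiom \<open>Pull_Diag\<close> for \<open>g\<close>, pulled back along
  \<open>f\<close>.\<close>

lemma kernel_le_Comp:
  assumes f: "f \<in> hom R X Y" and g: "g \<in> hom R Y Z"
  shows "Leq R X X (kernel R f) (kernel R (Comp R g f))"
  using Pull_mono[OF f f Diag_Fib kernel_Fib[OF g]] Pull_Diag[OF g] homD[OF f]
  by (simp add: kernel_eq[OF f] kernel_Comp[OF f g] kernel_eq[OF g])

lemma kernel_Ide: "X \<in> Obj R \<Longrightarrow> kernel R (Ide R X) = Diag R X"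
  by (simp add: kernel_eq[OF Ide_hom] Pull_Ide Diag_Fib)

text \<open>Kernels only grow under composition, and \<open>w\<close> takes the composite back to
  \<open>f\<close>.\<close>

lemma kernel_iso_Comp:
  assumes "iso_pair R Y Z v w" and f: "f \<in> hom R X Y"
  shows "kernel R (Comp R v f) = kernel R f"
proof -
  have v: "v \<in> hom R Y Z" and w: "w \<in> hom R Z Y" using assms by (auto simp: iso_pair_def)
  have vf: "Comp R v f \<in> hom R X Z" by (rule Comp_hom[OF f v])
  have "Leq R X X (kernel R (Comp R v f)) (kernel R f)"
    using kernel_le_Comp[OF vf w] iso_pair_cancel(1)[OF assms] by simp
  then show ?thesis
    using kernel_le_Comp[OF f v] homD[OF f]
    by (intro Leq_antisym[of X X]) (simp_all add: kernel_Fib[OF f] kernel_Fib[OF vf])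
qed

lemma kernel_iso:
  assumes "iso_pair R X Y v w"
  shows "kernel R v = Diag R X"
proof -
  have "v \<in> hom R X Y" using assms by (auto simp: iso_pair_def)
  then show ?thesis
    using kernel_iso_Comp[OF assms Ide_hom] kernel_Ide homD[of v X Y] Comp_Ide[of v X Y] by simp
qed

text \<open>The form in which extensionality gets applied. Composing the hypothesis with one graph
  on the right bounds it by the other graph; the converse of the hypothesis gives the opposite
  bound.\<close>

lemma graph_eqI:
  assumes f: "f \<in> hom R X Y" and g: "g \<in> hom R X Y"
    and le: "Leq R X X (Diag R X) (Pull R f g (Diag R Y))"
  shows "graph R f = graph R g"
proof -
  note ob = homD(4,5)[OF f]
  note I = Ide_hom[OF ob(2)]
  have step: "Leq R X Y (graph R h) (graph R k)"
    if h: "h \<in> hom R X Y" and k: "k \<in> hom R X Y"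
      and l: "Leq R X X (Diag R X) (Pull R k h (Diag R Y))" for h k
  proof -
    note F = graph_Fib[OF h] graph_Fib[OF k] Pull_Fib[OF k h Diag_Fib[OF ob(2)]]
    have 1: "Leq R X Y (Rcomp R X X Y (Diag R X) (graph R h))
        (Rcomp R X X Y (Pull R k h (Diag R Y)) (graph R h))"
      by (intro Rcomp_mono l Leq_refl) (simp_all add: ob F Diag_Fib)
    have 2: "Leq R X Y (Rcomp R X X Y (Pull R k h (Diag R Y)) (graph R h)) (graph R k)"
      using Pull_Rcomp[OF k h I Diag_Fib Diag_Fib] ob
      by (simp add: graph_hom[OF h] graph_hom[OF k] Diag_Rcomp Diag_Fib)
    show ?thesis
      using Leq_trans[OF _ _ _ _ _ 1 2] by (simp add: ob F Diag_Fib Diag_Rcomp Rcomp_Fib)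
  qed
  have "Leq R X X (Diag R X) (Pull R g f (Diag R Y))"
    using Conv_mono[OF _ _ _ _ le] Conv_Pull[OF f g Diag_Fib[OF ob(2)]]
      Pull_Fib[OF f g Diag_Fib[OF ob(2)]]
    by (simp add: ob Diag_Fib Conv_Diag)
  then show ?thesis
    using step[OF f g] step[OF g f le]
    by (intro Leq_antisym[of X Y]) (simp_all add: ob graph_Fib f g)
qed

section \<open>Descent arrows\<close>

lemma descentD:
  assumes "descent R f" "f \<in> hom R X Y"
  shows "Rcomp R Y X Y (cograph R f) (graph R f) = Diag R Y"
  using assms homD[OF assms(2)] by (simp add: descent_def)

lemma graph_Comp:
  assumes f: "f \<in> hom R X Y" and g: "g \<in> hom R Y Z"
  shows "graph R (Comp R g f) = Rcomp R X Y Z (graph R f) (graph R g)"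
proof -
  note ob = homD(4,5)[OF f] homD(4,5)[OF g]
  note I = Ide_hom[OF ob(4)]
  have "graph R (Comp R g f) = Pull R f (Ide R Z) (graph R g)"
    using Pull_Comp[OF f g I I Diag_Fib] ob Comp_Ide[OF I]
    by (simp add: graph_hom[OF Comp_hom[OF f g]] graph_hom[OF g])
  then show ?thesis using Pull_left[OF f _ graph_Fib[OF g]] ob by simp
qed

lemma cograph_Comp:
  assumes f: "f \<in> hom R X Y" and g: "g \<in> hom R Y Z"
  shows "cograph R (Comp R g f) = Rcomp R Z Y X (cograph R g) (cograph R f)"
  using graph_Comp[OF f g] homD[OF Comp_hom[OF f g]] homD[OF f] homD[OF g]
    graph_Fib[OF f] graph_Fib[OF g]
  by (simp add: cograph_def Conv_Rcomp)

text \<open>Totality of \<open>v\<close> yields that the graph of the inverse \<open>w\<close> lies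
  below the cograph of \<open>v\<close>. Composed with \<open>graph R v\<close>, the former is
  already the diagonal, which is the missing half of descent next to
  \<open>graph_functional\<close>.\<close>

lemma descent_iso:
  assumes "iso_pair R X Y v w"
  shows "descent R v"
proof -
  have v: "v \<in> hom R X Y" and w: "w \<in> hom R Y X" and vw: "Comp R v w = Ide R Y"
    using assms by (auto simp: iso_pair_def)
  note ob = homD(4,5)[OF v]
  note F = graph_Fib[OF v] graph_Fib[OF w] cograph_Fib[OF v]
  have gwv: "Rcomp R Y X Y (graph R w) (graph R v) = Diag R Y"
    using graph_Comp[OF w v] vw graph_hom[OF Ide_hom] Pull_Ide[OF _ _ Diag_Fib] ob by simp
  have "Leq R Y X (Rcomp R Y X X (graph R w) (Diag R X))
      (Rcomp R Y X X (graph R w) (Rcomp R X Y X (graph R v) (cograph R v)))"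
    by (intro Rcomp_mono graph_total[OF v] Leq_refl) (simp_all add: ob F Rcomp_Fib Diag_Fib)
  then have "Leq R Y X (graph R w) (cograph R v)"
    by (simp add: Rcomp_assoc ob F gwv Rcomp_Diag Diag_Rcomp)
  then have "Leq R Y Y (Rcomp R Y X Y (graph R w) (graph R v))
      (Rcomp R Y X Y (cograph R v) (graph R v))"
    by (intro Rcomp_mono Leq_refl) (simp_all add: ob F)
  then have "Leq R Y Y (Diag R Y) (Rcomp R Y X Y (cograph R v) (graph R v))"
    by (simp add: gwv)
  then have "Rcomp R Y X Y (cograph R v) (graph R v) = Diag R Y"
    using graph_functional[OF v] by (intro Leq_antisym[of Y Y]) (simp_all add: ob F Rcomp_Fib Diag_Fib)
  then show ?thesis using homD[OF v] by (simp add: descent_def)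
qed

lemma descent_Comp:
  assumes f: "f \<in> hom R X Y" and g: "g \<in> hom R Y Z" and "descent R f" "descent R g"
  shows "descent R (Comp R g f)"
proof -
  note ob = homD(4,5)[OF f] homD(4,5)[OF g]
  note F = graph_Fib[OF f] graph_Fib[OF g] cograph_Fib[OF f] cograph_Fib[OF g]
  have "Rcomp R Z X Z (Rcomp R Z Y X (cograph R g) (cograph R f)) (Rcomp R X Y Z (graph R f) (graph R g))
     = Rcomp R Z Y Z (cograph R g) (Rcomp R Y Y Z (Rcomp R Y X Y (cograph R f) (graph R f)) (graph R g))"
    by (simp add: Rcomp_assoc[symmetric] ob F Rcomp_Fib)
  also have "\<dots> = Diag R Z"
    using descentD[OF assms(3) f] descentD[OF assms(4) g] by (simp add: Diag_Rcomp ob F)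
  finally show ?thesis
    using homD[OF Comp_hom[OF f g]] by (simp add: descent_def graph_Comp[OF f g] cograph_Comp[OF f g])
qed

section \<open>Direct images, and reindexing along descent arrows\<close>

lemma dimage_eq:
  "f \<in> hom R A X \<Longrightarrow> g \<in> hom R B Y \<Longrightarrow> dimage R f g \<alpha> =
    Rcomp R X B Y (Rcomp R X A B (cograph R f) \<alpha>) (graph R g)"
  by (simp add: dimage_def homD)

lemma dimage_Fib:
  "f \<in> hom R A X \<Longrightarrow> g \<in> hom R B Y \<Longrightarrow> \<alpha> \<in> Fib R A B \<Longrightarrow> dimage R f g \<alpha> \<in> Fib R X Y"
  by (simp add: dimage_eq Rcomp_Fib graph_Fib cograph_Fib homD)

lemma dimage_mono:
  assumes f: "f \<in> hom R A X" and g: "g \<in> hom R B Y"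
    and "\<alpha> \<in> Fib R A B" "\<beta> \<in> Fib R A B" "Leq R A B \<alpha> \<beta>"
  shows "Leq R X Y (dimage R f g \<alpha>) (dimage R f g \<beta>)"
  unfolding dimage_eq[OF f g]
  using assms homD[OF f] homD[OF g] graph_Fib[OF g] cograph_Fib[OF f]
  by (intro Rcomp_mono Leq_refl) (simp_all add: Rcomp_Fib)

text \<open>On either side of \<open>\<alpha>\<close> a cograph meets its graph, and descent cancels
  the pair.\<close>

lemma dimage_Pull:
  assumes f: "f \<in> hom R A X" and g: "g \<in> hom R B Y" and df: "descent R f" and dg: "descent R g"
    and a: "\<alpha> \<in> Fib R X Y"
  shows "dimage R f g (Pull R f g \<alpha>) = \<alpha>"
proof -
  note ob = homD(4,5)[OF f] homD(4,5)[OF g]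
  note F = graph_Fib[OF f] graph_Fib[OF g] cograph_Fib[OF f] cograph_Fib[OF g] a
  have "dimage R f g (Pull R f g \<alpha>) = Rcomp R X Y Y (Rcomp R X X Y
      (Rcomp R X A X (cograph R f) (graph R f)) \<alpha>) (Rcomp R Y B Y (cograph R g) (graph R g))"
    by (simp add: dimage_eq[OF f g] Pull_eq[OF f g a] Rcomp_assoc[symmetric] ob F Rcomp_Fib)
  also have "\<dots> = \<alpha>"
    by (simp add: descentD[OF df f] descentD[OF dg g] Diag_Rcomp Rcomp_Diag ob a)
  finally show ?thesis .
qed

text \<open>The right-hand side is the saturation of \<open>\<alpha>\<close> by the two kernels. For
  kernels of chosen quotients it is the left side of the condition that defines the fibres of the
  completion.\<close>

lemma Pull_dimage:
  assumes f: "f \<in> hom R A X" and g: "g \<in> hom R B Y" and a: "\<alpha> \<in> Fib R A B"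
  shows "Pull R f g (dimage R f g \<alpha>) =
    Rcomp R A B B (Rcomp R A A B (kernel R f) \<alpha>) (kernel R g)"
proof -
  note ob = homD(4,5)[OF f] homD(4,5)[OF g]
  note F = graph_Fib[OF f] graph_Fib[OF g] cograph_Fib[OF f] cograph_Fib[OF g] a
  show ?thesis
    by (subst Pull_eq[OF f g dimage_Fib[OF f g a]])
      (simp add: dimage_eq[OF f g] kernel_def homD[OF f] homD[OF g] Rcomp_assoc[symmetric] F
        Rcomp_Fib)
qed

lemma le_Pull_dimage:
  assumes f: "f \<in> hom R A X" and g: "g \<in> hom R B Y" and a: "\<alpha> \<in> Fib R A B"
  shows "Leq R A B \<alpha> (Pull R f g (dimage R f g \<alpha>))"
proof -
  note ob = homD(4,5)[OF f] homD(4,5)[OF g]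
  have t: "Leq R A A (Diag R A) (kernel R f)" "Leq R B B (Diag R B) (kernel R g)"
    using graph_total[OF f] graph_total[OF g] by (simp_all add: kernel_def homD[OF f] homD[OF g])
  have "Leq R A B (Rcomp R A B B (Rcomp R A A B (Diag R A) \<alpha>) (Diag R B))
      (Rcomp R A B B (Rcomp R A A B (kernel R f) \<alpha>) (kernel R g))"
    by (intro Rcomp_mono t Leq_refl)
      (simp_all add: ob a kernel_Fib[OF f] kernel_Fib[OF g] Diag_Fib Rcomp_Fib)
  then show ?thesis
    by (simp add: Pull_dimage[OF f g a] Diag_Rcomp Rcomp_Diag ob a)
qed

text \<open>The order is reflected because \<open>dimage\<close> is monotone and undoes
  \<open>Pull\<close>.\<close>

lemma Pull_reflect:
  assumes f: "f \<in> hom R A X" and g: "g \<in> hom R B Y" and df: "descent R f" and dg: "descent R g"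
    and a: "\<alpha> \<in> Fib R X Y" and b: "\<beta> \<in> Fib R X Y"
  shows "Leq R A B (Pull R f g \<alpha>) (Pull R f g \<beta>) \<longleftrightarrow> Leq R X Y \<alpha> \<beta>"
  using dimage_mono[OF f g Pull_Fib[OF f g a] Pull_Fib[OF f g b]] Pull_mono[OF f g a b]
  by (auto simp: dimage_Pull[OF f g df dg a] dimage_Pull[OF f g df dg b])

text \<open>Lax functoriality becomes strict: between \<open>\<alpha>\<close> and
  \<open>\<beta>\<close> stands the cograph of \<open>g\<close> followed by its graph, which is the
  diagonal by descent.\<close>

lemma Pull_Rcomp_descent:
  assumes f: "f \<in> hom R A X" and g: "g \<in> hom R B Y" and h: "h \<in> hom R C Z" and dg: "descent R g"
    and a: "\<alpha> \<in> Fib R X Y" and b: "\<beta> \<in> Fib R Y Z"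
  shows "Rcomp R A B C (Pull R f g \<alpha>) (Pull R g h \<beta>) = Pull R f h (Rcomp R X Y Z \<alpha> \<beta>)"
proof -
  note ob = homD(4,5)[OF f] homD(4,5)[OF g] homD(4,5)[OF h]
  note F = graph_Fib[OF f] graph_Fib[OF g] cograph_Fib[OF h] cograph_Fib[OF g] a b
  have "Rcomp R A B C (Pull R f g \<alpha>) (Pull R g h \<beta>) = Rcomp R A Y C (Rcomp R A X Y (graph R f) \<alpha>)
      (Rcomp R Y Y C (Rcomp R Y B Y (cograph R g) (graph R g)) (Rcomp R Y Z C \<beta> (cograph R h)))"
    by (simp add: Pull_eq[OF f g a] Pull_eq[OF g h b] Rcomp_assoc[symmetric] ob F Rcomp_Fib)
  also have "\<dots> = Pull R f h (Rcomp R X Y Z \<alpha> \<beta>)"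
    by (simp add: descentD[OF dg g] Diag_Rcomp Pull_eq[OF f h Rcomp_Fib] Rcomp_assoc[symmetric]
        ob F Rcomp_Fib)
  finally show ?thesis .
qed

lemma Pull_iso_cancel:
  assumes u: "iso_pair R A X u u'" and v: "iso_pair R B Y v v'" and a: "\<alpha> \<in> Fib R X Y"
  shows "Pull R u' v' (Pull R u v \<alpha>) = \<alpha>"
proof -
  have h: "u \<in> hom R A X" "u' \<in> hom R X A" "v \<in> hom R B Y" "v' \<in> hom R Y B"
    and e: "Comp R u u' = Ide R X" "Comp R v v' = Ide R Y"
    using u v by (auto simp: iso_pair_def)
  show ?thesis
    using Pull_Comp[OF h(2,1) h(4,3) a] homD[OF h(1)] homD[OF h(3)] a by (simp add: e Pull_Ide)
qed

end

subsection \<open>Quotient arrows\<close>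

context relational_doctrine
begin

lemma equiv_rel_Diag: "X \<in> Obj R \<Longrightarrow> equiv_rel R X (Diag R X)"
  by (simp add: equiv_rel_def Diag_Fib Conv_Diag Diag_Rcomp Leq_refl)

lemma equiv_rel_Pull:
  assumes f: "f \<in> hom R A X" and e: "equiv_rel R X \<rho>"
  shows "equiv_rel R A (Pull R f f \<rho>)"
proof -
  note ob = homD(4,5)[OF f]
  have r: "\<rho> \<in> Fib R X X" and d: "Leq R X X (Diag R X) \<rho>" and s: "Leq R X X (Conv R X X \<rho>) \<rho>"
    and t: "Leq R X X (Rcomp R X X X \<rho> \<rho>) \<rho>"
    using e by (auto simp: equiv_rel_def)
  note F = Pull_Fib[OF f f r] r Pull_Fib[OF f f Diag_Fib[OF ob(2)]]
  have 1: "Leq R A A (Diag R A) (Pull R f f \<rho>)"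
    by (rule Leq_trans[OF _ _ _ _ _ Pull_Diag[OF f] Pull_mono[OF f f _ _ d]])
      (simp_all add: ob F Diag_Fib)
  have 2: "Leq R A A (Conv R A A (Pull R f f \<rho>)) (Pull R f f \<rho>)"
    using Pull_mono[OF f f _ _ s] by (simp add: Conv_Pull[OF f f r] ob F Conv_Fib)
  have 3: "Leq R A A (Rcomp R A A A (Pull R f f \<rho>) (Pull R f f \<rho>)) (Pull R f f \<rho>)"
    by (rule Leq_trans[OF _ _ _ _ _ Pull_Rcomp[OF f f f r r] Pull_mono[OF f f _ _ t]])
      (simp_all add: ob F Rcomp_Fib Pull_Fib[OF f f])
  show ?thesis using 1 2 3 by (simp add: equiv_rel_def ob F)
qed

lemma equiv_rel_kernel: "f \<in> hom R X Y \<Longrightarrow> equiv_rel R X (kernel R f)"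
  by (simp add: kernel_eq equiv_rel_Pull equiv_rel_Diag homD)

lemma quotient_arrow_ofD:
  assumes "quotient_arrow_of R X \<rho> p"
  shows "equiv_rel R X \<rho>" "X \<in> Obj R" "\<rho> \<in> Fib R X X" "p \<in> hom R X (Cod R p)" "Cod R p \<in> Obj R"
    "Leq R X X \<rho> (kernel R p)"
  using assms Cod_Obj by (auto simp: quotient_arrow_of_def hom_def equiv_rel_def)

lemma quotient_factor:
  assumes "quotient_arrow_of R X \<rho> p" "f \<in> hom R X Z" "Leq R X X \<rho> (kernel R f)"
  shows "\<exists>!h. h \<in> hom R (Cod R p) Z \<and> f = Comp R h p"
  using assms homD[OF assms(2)] by (simp add: quotient_arrow_of_def)

lemma quotient_arrow_ofI:
  assumes "equiv_rel R X \<rho>" "p \<in> hom R X W" "Leq R X X \<rho> (kernel R p)"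
    and "\<And>Z f. f \<in> hom R X Z \<Longrightarrow> Leq R X X \<rho> (kernel R f) \<Longrightarrow>
      \<exists>!h. h \<in> hom R W Z \<and> f = Comp R h p"
  shows "quotient_arrow_of R X \<rho> p"
  using assms homD[OF assms(2)] by (auto simp: quotient_arrow_of_def)

text \<open>Every arrow that passes through \<open>p\<close> is compatible with
  \<open>\<rho>\<close>, so that \<open>quotient_factor\<close> applies to it.\<close>

lemma quotient_le_kernel_Comp:
  assumes p: "quotient_arrow_of R X \<rho> p" and k: "k \<in> hom R (Cod R p) Z"
  shows "Leq R X X \<rho> (kernel R (Comp R k p))"
  using Leq_trans[OF _ _ _ _ _ quotient_arrow_ofD(6)[OF p]
      kernel_le_Comp[OF quotient_arrow_ofD(4)[OF p] k]] quotient_arrow_ofD[OF p]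
    kernel_Fib[OF Comp_hom[OF quotient_arrow_ofD(4)[OF p] k]] kernel_Fib[of p]
  by simp

text \<open>Both \<open>h\<close> and \<open>k\<close> are mediating arrows for the compatible arrow
  \<open>Comp R k p\<close>.\<close>

lemma quotient_epi:
  assumes p: "quotient_arrow_of R X \<rho> p"
    and h: "h \<in> hom R (Cod R p) Z" and k: "k \<in> hom R (Cod R p) Z"
    and eq: "Comp R h p = Comp R k p"
  shows "h = k"
proof (rule ex1E[OF quotient_factor[OF p Comp_hom[OF quotient_arrow_ofD(4)[OF p] k]
      quotient_le_kernel_Comp[OF p k]]])
  fix l assume "\<forall>y. y \<in> hom R (Cod R p) Z \<and> Comp R k p = Comp R y p \<longrightarrow> y = l"
  then show "h = k" using h k eq[symmetric] by metis
qed

lemma quotient_arrow_unique: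
  assumes p: "quotient_arrow_of R X \<rho> p" and p': "quotient_arrow_of R X \<rho> p'"
  shows "\<exists>v w. iso_pair R (Cod R p) (Cod R p') v w \<and> p' = Comp R v p"
proof -
  note P = quotient_arrow_ofD[OF p] and P' = quotient_arrow_ofD[OF p']
  obtain v where v: "v \<in> hom R (Cod R p) (Cod R p')" and vp: "p' = Comp R v p"
    using quotient_factor[OF p P'(4,6)] by blast
  obtain w where w: "w \<in> hom R (Cod R p') (Cod R p)" and wp: "p = Comp R w p'"
    using quotient_factor[OF p' P(4,6)] by blast
  have "Comp R (Comp R w v) p = Comp R (Ide R (Cod R p)) p"
    by (simp add: Ide_Comp[OF P(4)] vp[symmetric] wp[symmetric] flip: Comp_assoc[OF P(4) v w])
  from quotient_epi[OF p Comp_hom[OF v w] Ide_hom[OF P(5)] this]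
  have "Comp R w v = Ide R (Cod R p)" .
  moreover have "Comp R (Comp R v w) p' = Comp R (Ide R (Cod R p')) p'"
    by (simp add: Ide_Comp[OF P'(4)] vp[symmetric] wp[symmetric] flip: Comp_assoc[OF P'(4) w v])
  from quotient_epi[OF p' Comp_hom[OF w v] Ide_hom[OF P'(5)] this]
  have "Comp R v w = Ide R (Cod R p')" .
  ultimately show ?thesis using v w vp by (auto simp: iso_pair_def)
qed

lemma quotient_arrow_iso_Comp:
  assumes p: "quotient_arrow_of R X \<rho> p" and i: "iso_pair R (Cod R p) W v w"
  shows "quotient_arrow_of R X \<rho> (Comp R v p)"
proof -
  note P = quotient_arrow_ofD[OF p]
  have v: "v \<in> hom R (Cod R p) W" and w: "w \<in> hom R W (Cod R p)"
    using i by (auto simp: iso_pair_def)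
  show ?thesis
  proof (rule quotient_arrow_ofI[OF P(1) Comp_hom[OF P(4) v]])
    show "Leq R X X \<rho> (kernel R (Comp R v p))" by (rule quotient_le_kernel_Comp[OF p v])
    fix Z f assume "f \<in> hom R X Z" "Leq R X X \<rho> (kernel R f)"
    from quotient_factor[OF p this]
    obtain h where h: "h \<in> hom R (Cod R p) Z" and hp: "f = Comp R h p" by blast
    show "\<exists>!h. h \<in> hom R W Z \<and> f = Comp R h (Comp R v p)"
    proof (rule ex1I)
      show "Comp R h w \<in> hom R W Z \<and> f = Comp R (Comp R h w) (Comp R v p)"
        using Comp_hom[OF w h] Comp_assoc[OF P(4) v Comp_hom[OF w h]] iso_pair_cancel(3)[OF i h] hp
        by simp
      fix k assume k: "k \<in> hom R W Z \<and> f = Comp R k (Comp R v p)"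
      then have kv: "Comp R k v \<in> hom R (Cod R p) Z" using Comp_hom[OF v] by blast
      have "Comp R k v = h"
        using k hp Comp_assoc[OF P(4) v] by (intro quotient_epi[OF p kv h]) auto
      then show "k = Comp R h w" using iso_pair_cancel(4)[OF i] k by auto
    qed
  qed
qed

text \<open>Changing the domain by an isomorphism moves the relation along: compatibility of
  \<open>f\<close> with the pulled-back relation is compatibility of \<open>Comp R f v\<close> with
  \<open>\<rho>\<close>.\<close>

lemma quotient_arrow_Comp_iso:
  assumes p: "quotient_arrow_of R X \<rho> p" and i: "iso_pair R X' X u v"
  shows "quotient_arrow_of R X' (Pull R u u \<rho>) (Comp R p u)"
proof -
  note P = quotient_arrow_ofD[OF p]
  have u: "u \<in> hom R X' X" and v: "v \<in> hom R X X'"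
    using i by (auto simp: iso_pair_def)
  show ?thesis
  proof (rule quotient_arrow_ofI[OF equiv_rel_Pull[OF u P(1)] Comp_hom[OF u P(4)]])
    show "Leq R X' X' (Pull R u u \<rho>) (kernel R (Comp R p u))"
      by (simp add: kernel_Comp[OF u P(4)] Pull_mono[OF u u] P(3,6) kernel_Fib[OF P(4)])
    fix Z f assume f: "f \<in> hom R X' Z" and le: "Leq R X' X' (Pull R u u \<rho>) (kernel R f)"
    have fv: "Comp R f v \<in> hom R X Z" by (rule Comp_hom[OF v f])
    have "Leq R X X \<rho> (kernel R (Comp R f v))"
      using Pull_mono[OF v v Pull_Fib[OF u u P(3)] kernel_Fib[OF f] le]
      by (simp add: kernel_Comp[OF v f] Pull_iso_cancel[OF i i P(3)])
    from quotient_factor[OF p fv this]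
    obtain h where h: "h \<in> hom R (Cod R p) Z" and hp: "Comp R f v = Comp R h p" by blast
    show "\<exists>!h. h \<in> hom R (Cod R p) Z \<and> f = Comp R h (Comp R p u)"
    proof (rule ex1I)
      show "h \<in> hom R (Cod R p) Z \<and> f = Comp R h (Comp R p u)"
        using Comp_assoc[OF u P(4) h] iso_pair_cancel(3)[OF i f] hp h by simp
      fix k assume k: "k \<in> hom R (Cod R p) Z \<and> f = Comp R k (Comp R p u)"
      then have "Comp R f v = Comp R k p"
        using Comp_assoc[OF u P(4)] iso_pair_cancel(4)[OF i Comp_hom[OF P(4)]] by auto
      then show "k = h" using quotient_epi[OF p _ h] k hp by auto
    qed
  qed
qed

lemma effective_iso_Comp:
  assumes "effective R \<rho> p" "p \<in> hom R X Y" "iso_pair R Y W v w"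
  shows "effective R \<rho> (Comp R v p)"
  using assms by (simp add: effective_def kernel_iso_Comp)

lemma descent_iso_Comp:
  assumes "descent R p" "p \<in> hom R X Y" "iso_pair R Y W v w"
  shows "descent R (Comp R v p)"
  using assms descent_Comp[OF assms(2) _ assms(1) descent_iso[OF assms(3)]]
  by (auto simp: iso_pair_def)

text \<open>\<open>has_quotients\<close> supplies only one effective descent quotient arrow for each
  relation. Any other quotient arrow of that relation is isomorphic to it, and both properties
  survive the isomorphism.\<close>

lemma effective_descent:
  assumes "has_quotients R" and p: "quotient_arrow_of R X \<rho> p"
  shows "effective R \<rho> p" and "descent R p"
proof -
  obtain r where r: "quotient_arrow_of R X \<rho> r" "effective R \<rho> r" "descent R r"
    using assms quotient_arrow_ofD(1)[OF p] unfolding has_quotients_def by blast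
  obtain v w where i: "iso_pair R (Cod R r) (Cod R p) v w" and "p = Comp R v r"
    using quotient_arrow_unique[OF r(1) p] by blast
  then show "effective R \<rho> p" and "descent R p"
    using effective_iso_Comp[OF r(2) quotient_arrow_ofD(4)[OF r(1)] i]
      descent_iso_Comp[OF r(3) quotient_arrow_ofD(4)[OF r(1)] i]
    by simp_all
qed

text \<open>A compatible arrow factors through \<open>p\<close> because \<open>\<rho>\<close> lies
  below the kernel of the composite; the factor \<open>g\<close> must then be shown compatible with
  \<open>\<sigma>\<close> in order to pass through \<open>r\<close>.\<close>

lemma quotient_arrow_Comp:
  assumes p: "quotient_arrow_of R X \<rho> p" "effective R \<rho> p" "descent R p"
    and r: "quotient_arrow_of R (Cod R p) \<sigma> r" "effective R \<sigma> r"
  shows "quotient_arrow_of R X (kernel R (Comp R r p)) (Comp R r p)"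
proof -
  note P = quotient_arrow_ofD[OF p(1)] and Q = quotient_arrow_ofD[OF r(1)]
  have rp: "Comp R r p \<in> hom R X (Cod R r)" by (rule Comp_hom[OF P(4) Q(4)])
  show ?thesis
  proof (rule quotient_arrow_ofI[OF equiv_rel_kernel[OF rp] rp])
    show "Leq R X X (kernel R (Comp R r p)) (kernel R (Comp R r p))"
      by (simp add: Leq_refl P kernel_Fib[OF rp])
    fix Z f assume f: "f \<in> hom R X Z" and le: "Leq R X X (kernel R (Comp R r p)) (kernel R f)"
    have "Leq R X X \<rho> (kernel R f)"
      by (rule Leq_trans[OF _ _ _ _ _ quotient_le_kernel_Comp[OF p(1) Q(4)] le])
        (simp_all add: P kernel_Fib[OF f] kernel_Fib[OF rp])
    from quotient_factor[OF p(1) f this]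
    obtain g where g: "g \<in> hom R (Cod R p) Z" and gp: "f = Comp R g p" by blast
    \<comment> \<open>Both kernels in \<open>le\<close> are pullbacks along \<open>p\<close> of
      kernels on its codomain, and descent of \<open>p\<close> reflects the order between
      them.\<close>
    have "Leq R (Cod R p) (Cod R p) (kernel R r) (kernel R g)"
      using le Pull_reflect[OF P(4) P(4) p(3) p(3) kernel_Fib[OF Q(4)] kernel_Fib[OF g]]
      by (simp add: gp kernel_Comp[OF P(4) g] kernel_Comp[OF P(4) Q(4)])
    then have "Leq R (Cod R p) (Cod R p) \<sigma> (kernel R g)"
      using r(2) by (simp add: effective_def)
    from quotient_factor[OF r(1) g this]
    obtain h where h: "h \<in> hom R (Cod R r) Z" and hr: "g = Comp R h r" by blast
    show "\<exists>!h. h \<in> hom R (Cod R r) Z \<and> f = Comp R h (Comp R r p)"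
    proof (rule ex1I)
      show "h \<in> hom R (Cod R r) Z \<and> f = Comp R h (Comp R r p)"
        using h by (simp add: Comp_assoc[OF P(4) Q(4) h] gp hr)
      fix k assume k: "k \<in> hom R (Cod R r) Z \<and> f = Comp R k (Comp R r p)"
      then have kr: "Comp R k r \<in> hom R (Cod R p) Z" using Comp_hom[OF Q(4)] by blast
      have "Comp R k r = g"
        using k Comp_assoc[OF P(4) Q(4)] gp by (intro quotient_epi[OF p(1) kr g]) auto
      then show "k = h" using quotient_epi[OF r(1) _ h] k hr by auto
    qed
  qed
qed

text \<open>Compared with the chosen quotient of \<open>(P, Diag S P)\<close>, this shows that
  quotient to be an isomorphism.\<close>

lemma quotient_arrow_Ide:
  assumes X: "X \<in> Obj R"
  shows "quotient_arrow_of R X (Diag R X) (Ide R X)"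
proof (rule quotient_arrow_ofI[OF equiv_rel_Diag[OF X] Ide_hom[OF X]])
  show "Leq R X X (Diag R X) (kernel R (Ide R X))"
    by (simp add: kernel_Ide X Leq_refl Diag_Fib)
  fix Z f assume f: "f \<in> hom R X Z"
  then show "\<exists>!h. h \<in> hom R X Z \<and> f = Comp R h (Ide R X)"
    by (intro ex1I[of _ f]) (auto simp: Comp_Ide)
qed

end

subsection \<open>Fully faithful 1-arrows\<close>

context rd_arrow
begin

lemma frel_graph:
  assumes f: "f \<in> hom S X Y"
  shows "frel F X Y (graph S f) = graph R (farr F f)"
  using frel_natural[OF f dom.Ide_hom dom.Diag_Fib] dom.homD[OF f] cod.graph_hom[OF F_hom[OF f]]
  by (simp add: dom.graph_hom[OF f] F_Ide frel_Diag)

lemma frel_cograph: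
  assumes f: "f \<in> hom S X Y"
  shows "frel F Y X (cograph S f) = cograph R (farr F f)"
  using frel_Conv[OF _ _ dom.graph_Fib[OF f]] dom.homD[OF f] cod.homD[OF F_hom[OF f]]
  by (simp add: cograph_def frel_graph[OF f])

lemma frel_kernel:
  assumes f: "f \<in> hom S X Y"
  shows "frel F X X (kernel S f) = kernel R (farr F f)"
  using frel_natural[OF f f dom.Diag_Fib] dom.homD[OF f]
  by (simp add: dom.kernel_eq[OF f] cod.kernel_eq[OF F_hom[OF f]] frel_Diag)

end

locale ff_arrow = rd_arrow +
  assumes ff: "fully_faithful S R F"
begin

lemma ff_bij_betw:
  assumes "X \<in> Obj S" "Y \<in> Obj S"
  shows "bij_betw (farr F) (hom S X Y) (hom R (fobj F X) (fobj F Y))"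
    and "bij_betw (frel F X Y) (Fib S X Y) (Fib R (fobj F X) (fobj F Y))"
  using assms ff by (simp_all add: fully_faithful_def)

lemma farr_inj:
  assumes "f \<in> hom S X Y" "g \<in> hom S X Y" "farr F f = farr F g"
  shows "f = g"
  using inj_onD[OF bij_betw_imp_inj_on[OF ff_bij_betw(1)] assms(3,1,2)] dom.homD[OF assms(1)] by simp

lemma farr_surj:
  assumes "X \<in> Obj S" "Y \<in> Obj S" "h \<in> hom R (fobj F X) (fobj F Y)"
  obtains f where "f \<in> hom S X Y" "farr F f = h"
  by (rule imageE[OF assms(3)[folded bij_betw_imp_surj_on[OF ff_bij_betw(1)[OF assms(1,2)]]]])
    (use that in simp)

lemma frel_inj:
  assumes "X \<in> Obj S" "Y \<in> Obj S" "\<alpha> \<in> Fib S X Y" "\<beta> \<in> Fib S X Y"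
    and "frel F X Y \<alpha> = frel F X Y \<beta>"
  shows "\<alpha> = \<beta>"
  using inj_onD[OF bij_betw_imp_inj_on[OF ff_bij_betw(2)] assms(5,3,4)] assms(1,2) by simp

lemma frel_surj:
  assumes "X \<in> Obj S" "Y \<in> Obj S" "\<beta> \<in> Fib R (fobj F X) (fobj F Y)"
  obtains \<alpha> where "\<alpha> \<in> Fib S X Y" "frel F X Y \<alpha> = \<beta>"
  by (rule imageE[OF assms(3)[folded bij_betw_imp_surj_on[OF ff_bij_betw(2)[OF assms(1,2)]]]])
    (use that in simp)

lemma frel_Leq_iff:
  "X \<in> Obj S \<Longrightarrow> Y \<in> Obj S \<Longrightarrow> \<alpha> \<in> Fib S X Y \<Longrightarrow> \<beta> \<in> Fib S X Y \<Longrightarrow>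
    Leq R (fobj F X) (fobj F Y) (frel F X Y \<alpha>) (frel F X Y \<beta>) \<longleftrightarrow> Leq S X Y \<alpha> \<beta>"
  using ff by (simp add: fully_faithful_def)

lemma equiv_rel_iff:
  "X \<in> Obj S \<Longrightarrow> \<rho> \<in> Fib S X X \<Longrightarrow>
    equiv_rel R (fobj F X) (frel F X X \<rho>) \<longleftrightarrow> equiv_rel S X \<rho>"
  unfolding equiv_rel_def
  by (simp add: frel_Diag[symmetric] frel_Conv[symmetric] frel_Rcomp[symmetric] frel_Leq_iff
      frel_Fib F_Obj dom.Diag_Fib dom.Conv_Fib dom.Rcomp_Fib)

lemma Leq_kernel_iff:
  assumes f: "f \<in> hom S X Y" and r: "\<rho> \<in> Fib S X X"
  shows "Leq R (fobj F X) (fobj F X) (frel F X X \<rho>) (kernel R (farr F f)) \<longleftrightarrow>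
    Leq S X X \<rho> (kernel S f)"
  using frel_Leq_iff[OF _ _ r dom.kernel_Fib[OF f]] dom.homD[OF f] by (simp add: frel_kernel[OF f])

lemma descent_iff:
  assumes f: "f \<in> hom S X Y"
  shows "descent R (farr F f) \<longleftrightarrow> descent S f"
proof -
  note ob = dom.homD(4,5)[OF f]
  note F = dom.graph_Fib[OF f] dom.cograph_Fib[OF f]
  have "frel F Y Y (Rcomp S Y X Y (cograph S f) (graph S f)) = frel F Y Y (Diag S Y) \<longleftrightarrow>
      Rcomp S Y X Y (cograph S f) (graph S f) = Diag S Y"
    using frel_inj[of Y Y] by (auto simp: ob F dom.Rcomp_Fib dom.Diag_Fib)
  then show ?thesis
    using dom.homD[OF f] cod.homD[OF F_hom[OF f]]
    by (simp add: descent_def frel_Rcomp[OF _ _ _ F(2,1)] frel_graph[OF f] frel_cograph[OF f]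
        frel_Diag)
qed

lemma effective_iff:
  assumes f: "f \<in> hom S X Y" and r: "\<rho> \<in> Fib S X X"
  shows "effective R (frel F X X \<rho>) (farr F f) \<longleftrightarrow> effective S \<rho> f"
  using frel_inj[OF _ _ r dom.kernel_Fib[OF f]] dom.homD[OF f]
  by (auto simp: effective_def frel_kernel[OF f, symmetric])

text \<open>Testing in \<open>S\<close> involves only targets in the image of \<open>F\<close>, so
  fullness lifts the mediating arrow of \<open>R\<close>, while faithfulness reflects the equation
  and the uniqueness.\<close>

lemma quotient_arrow_reflect:
  assumes p: "p \<in> hom S X W" and r: "\<rho> \<in> Fib S X X"
    and Q: "quotient_arrow_of R (fobj F X) (frel F X X \<rho>) (farr F p)"
  shows "quotient_arrow_of S X \<rho> p"
proof (rule dom.quotient_arrow_ofI[OF _ p])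
  note ob = dom.homD(4,5)[OF p]
  have Cp: "Cod R (farr F p) = fobj F W" using cod.homD[OF F_hom[OF p]] by simp
  show "equiv_rel S X \<rho>"
    using cod.quotient_arrow_ofD(1)[OF Q] equiv_rel_iff[OF ob(1) r] by simp
  show "Leq S X X \<rho> (kernel S p)"
    using cod.quotient_arrow_ofD(6)[OF Q] Leq_kernel_iff[OF p r] by simp
  fix Z f assume f: "f \<in> hom S X Z" and le: "Leq S X X \<rho> (kernel S f)"
  note Z = dom.homD(5)[OF f]
  obtain h' where h': "h' \<in> hom R (fobj F W) (fobj F Z)" "farr F f = Comp R h' (farr F p)"
    using cod.quotient_factor[OF Q F_hom[OF f]] le Leq_kernel_iff[OF f r] Cp by auto
  obtain h where h: "h \<in> hom S W Z" "farr F h = h'"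
    using farr_surj[OF ob(2) Z h'(1)] by blast
  show "\<exists>!h. h \<in> hom S W Z \<and> f = Comp S h p"
  proof (rule ex1I)
    show "h \<in> hom S W Z \<and> f = Comp S h p"
      using farr_inj[OF f dom.Comp_hom[OF p h(1)]] F_Comp[OF p h(1)] h h' by simp
    fix k assume "k \<in> hom S W Z \<and> f = Comp S k p"
    then have k: "k \<in> hom S W Z" and fk: "f = Comp S k p" by auto
    have "Comp R (farr F k) (farr F p) = Comp R h' (farr F p)"
      using h'(2) F_Comp[OF p k] by (simp add: fk)
    then have "farr F k = farr F h"
      unfolding h(2) by (intro cod.quotient_epi[OF Q, unfolded Cp, OF F_hom[OF k] h'(1)])
    then show "k = h" by (rule farr_inj[OF k h(1)])
  qed
qed

end

subsection \<open>Equivalences\<close>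

text \<open>The witnesses of essential surjectivity are fixed as functions, since the quasi-inverse
  and its unit and counit are built from them.\<close>

locale ff_ess_surj = G: ff_arrow T R G
  for T :: "('p, 'b, 's) reldoc" and R :: "('o, 'a, 'r) reldoc"
    and G :: "('p, 'b, 's, 'o, 'a, 'r) rd_map" +
  fixes A :: "'o \<Rightarrow> 'p" and u v :: "'o \<Rightarrow> 'a"
  assumes A_Obj: "X \<in> Obj R \<Longrightarrow> A X \<in> Obj T"
    and iso: "X \<in> Obj R \<Longrightarrow> iso_pair R (fobj G (A X)) X (u X) (v X)"
begin

lemma u_hom: "X \<in> Obj R \<Longrightarrow> u X \<in> hom R (fobj G (A X)) X"
  and v_hom: "X \<in> Obj R \<Longrightarrow> v X \<in> hom R X (fobj G (A X))"
  and vu: "X \<in> Obj R \<Longrightarrow> Comp R (v X) (u X) = Ide R (fobj G (A X))"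
  and uv: "X \<in> Obj R \<Longrightarrow> Comp R (u X) (v X) = Ide R X"
  using iso by (auto simp: iso_pair_def)

text \<open>A test object \<open>Z\<close> may lie outside the image of \<open>G\<close>. Composing
  with \<open>v Z\<close> moves the problem into the image without changing kernels;
  \<open>u Z\<close> carries the solution back.\<close>

lemma quotient_arrow_preserve:
  assumes Q: "quotient_arrow_of T X \<rho> p"
  shows "quotient_arrow_of R (fobj G X) (frel G X X \<rho>) (farr G p)"
proof -
  let ?W = "Cod T p"
  note P = G.dom.quotient_arrow_ofD[OF Q]
  note p = P(4) and r = P(3)
  show ?thesis
  proof (rule G.cod.quotient_arrow_ofI[OF _ G.F_hom[OF p]])
    show "equiv_rel R (fobj G X) (frel G X X \<rho>)"
      using P(1) G.equiv_rel_iff[OF P(2) r] by simp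
    show "Leq R (fobj G X) (fobj G X) (frel G X X \<rho>) (kernel R (farr G p))"
      using P(6) G.Leq_kernel_iff[OF p r] by simp
    fix Z f
    assume f: "f \<in> hom R (fobj G X) Z"
      and le: "Leq R (fobj G X) (fobj G X) (frel G X X \<rho>) (kernel R f)"
    note Z = G.cod.homD(5)[OF f]
    note i = G.cod.iso_pair_cancel[OF iso[OF Z]]
    note vZ = v_hom[OF Z] and uZ = u_hom[OF Z] and AZ = A_Obj[OF Z]
    obtain g where g: "g \<in> hom T X (A Z)" and gf: "farr G g = Comp R (v Z) f"
      by (rule G.farr_surj[OF P(2) AZ G.cod.Comp_hom[OF f vZ]])
    have "Leq T X X \<rho> (kernel T g)"
      using le G.Leq_kernel_iff[OF g r]
        G.cod.kernel_iso_Comp[OF iso_pair_sym[OF iso[OF Z]] f] gf by simp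
    from G.dom.quotient_factor[OF Q g this]
    obtain h where h: "h \<in> hom T ?W (A Z)" and hp: "g = Comp T h p" by blast
    note Gh = G.F_hom[OF h] and Gp = G.F_hom[OF p]
    have e: "Comp R (v Z) f = Comp R (farr G h) (farr G p)"
      using gf hp G.F_Comp[OF p h] by simp
    show "\<exists>!k. k \<in> hom R (fobj G ?W) Z \<and> f = Comp R k (farr G p)"
    proof (rule ex1I)
      have "f = Comp R (u Z) (Comp R (v Z) f)" using i(2)[OF f] by simp
      also have "\<dots> = Comp R (Comp R (u Z) (farr G h)) (farr G p)"
        unfolding e by (rule G.cod.Comp_assoc[OF Gp Gh uZ])
      finally show "Comp R (u Z) (farr G h) \<in> hom R (fobj G ?W) Z \<and>
          f = Comp R (Comp R (u Z) (farr G h)) (farr G p)"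
        using G.cod.Comp_hom[OF Gh uZ] by blast
      fix k assume "k \<in> hom R (fobj G ?W) Z \<and> f = Comp R k (farr G p)"
      then have k: "k \<in> hom R (fobj G ?W) Z" and fk: "f = Comp R k (farr G p)" by auto
      obtain l where l: "l \<in> hom T ?W (A Z)" and lk: "farr G l = Comp R (v Z) k"
        by (rule G.farr_surj[OF P(5) AZ G.cod.Comp_hom[OF k vZ]])
      have "farr G (Comp T l p) = farr G g"
        using G.F_Comp[OF p l] G.cod.Comp_assoc[OF Gp k vZ] by (simp add: lk gf fk)
      then have "Comp T l p = Comp T h p"
        using G.farr_inj[OF G.dom.Comp_hom[OF p l] g] hp by simp
      then have "l = h" by (rule G.dom.quotient_epi[OF Q l h])
      then show "k = Comp R (u Z) (farr G h)" using i(2)[OF k] lk[symmetric] by simp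
    qed
  qed
qed

text \<open>Arrows are conjugated by \<open>u\<close> and \<open>v\<close>, relations are pulled
  back along \<open>u\<close>; the result lies between objects in the image of \<open>G\<close> and
  has a unique preimage there.\<close>

definition inverse_map :: "('o, 'a, 'r, 'p, 'b, 's) rd_map" where
  "inverse_map = \<lparr>fobj = A,
    farr = (\<lambda>f. inv_into (hom T (A (Dom R f)) (A (Cod R f))) (farr G)
      (Comp R (v (Cod R f)) (Comp R f (u (Dom R f))))),
    frel = (\<lambda>X Y \<alpha>. inv_into (Fib T (A X) (A Y)) (frel G (A X) (A Y)) (Pull R (u X) (u Y) \<alpha>))\<rparr>"

lemma inverse_fobj [simp]: "fobj inverse_map X = A X"
  by (simp add: inverse_map_def)

lemma inverse_farr:
  assumes f: "f \<in> hom R X Y"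
  shows "farr inverse_map f \<in> hom T (A X) (A Y)"
    and "farr G (farr inverse_map f) = Comp R (v Y) (Comp R f (u X))"
proof -
  note ob = G.cod.homD(4,5)[OF f]
  have "bij_betw (farr G) (hom T (A X) (A Y)) (hom R (fobj G (A X)) (fobj G (A Y)))"
    using G.ff_bij_betw(1) A_Obj ob by simp
  moreover have "Comp R (v Y) (Comp R f (u X)) \<in> hom R (fobj G (A X)) (fobj G (A Y))"
    using G.cod.Comp_hom[OF G.cod.Comp_hom[OF u_hom f] v_hom] ob by simp
  ultimately show "farr inverse_map f \<in> hom T (A X) (A Y)"
    and "farr G (farr inverse_map f) = Comp R (v Y) (Comp R f (u X))"
    using G.cod.homD(2,3)[OF f]
    by (simp_all add: inverse_map_def bij_betw_def f_inv_into_f inv_into_into)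
qed

lemma inverse_frel:
  assumes X: "X \<in> Obj R" and Y: "Y \<in> Obj R" and a: "\<alpha> \<in> Fib R X Y"
  shows "frel inverse_map X Y \<alpha> \<in> Fib T (A X) (A Y)"
    and "frel G (A X) (A Y) (frel inverse_map X Y \<alpha>) = Pull R (u X) (u Y) \<alpha>"
proof -
  have "bij_betw (frel G (A X) (A Y)) (Fib T (A X) (A Y)) (Fib R (fobj G (A X)) (fobj G (A Y)))"
    using G.ff_bij_betw(2) A_Obj X Y by simp
  moreover have "Pull R (u X) (u Y) \<alpha> \<in> Fib R (fobj G (A X)) (fobj G (A Y))"
    by (rule G.cod.Pull_Fib[OF u_hom u_hom a]) (simp_all add: X Y)
  ultimately show "frel inverse_map X Y \<alpha> \<in> Fib T (A X) (A Y)"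
    and "frel G (A X) (A Y) (frel inverse_map X Y \<alpha>) = Pull R (u X) (u Y) \<alpha>"
    by (simp_all add: inverse_map_def bij_betw_def f_inv_into_f inv_into_into)
qed

text \<open>The image under \<open>G\<close> of naturality of \<open>inverse_map\<close>. It holds
  because \<open>u\<close> cancels the \<open>v\<close> of the conjugated arrows.\<close>

lemma Pull_u_Comp:
  assumes f: "f \<in> hom R B X" and g: "g \<in> hom R C Y" and a: "\<alpha> \<in> Fib R X Y"
  shows "Pull R (Comp R (v X) (Comp R f (u B))) (Comp R (v Y) (Comp R g (u C)))
      (Pull R (u X) (u Y) \<alpha>) = Pull R (u B) (u C) (Pull R f g \<alpha>)"
proof -
  note ob = G.cod.homD(4,5)[OF f] G.cod.homD(4,5)[OF g]
  note fu = G.cod.Comp_hom[OF u_hom[OF ob(1)] f] and gu = G.cod.Comp_hom[OF u_hom[OF ob(3)] g]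
  have "Comp R (u X) (Comp R (v X) (Comp R f (u B))) = Comp R f (u B)"
    "Comp R (u Y) (Comp R (v Y) (Comp R g (u C))) = Comp R g (u C)"
    using G.cod.iso_pair_cancel(2)[OF iso] fu gu ob by auto
  moreover have "Pull R (Comp R (u X) (Comp R (v X) (Comp R f (u B))))
      (Comp R (u Y) (Comp R (v Y) (Comp R g (u C)))) \<alpha> =
    Pull R (Comp R (v X) (Comp R f (u B))) (Comp R (v Y) (Comp R g (u C))) (Pull R (u X) (u Y) \<alpha>)"
    using ob by (intro G.cod.Pull_Comp[OF G.cod.Comp_hom[OF fu v_hom] u_hom
          G.cod.Comp_hom[OF gu v_hom] u_hom a]) simp_all
  ultimately show ?thesis
    using G.cod.Pull_Comp[OF u_hom f u_hom g a] ob by simp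
qed

text \<open>All equations are checked after applying \<open>G\<close>. For composition of relations
  laxness would not suffice: strictness comes from \<open>u Y\<close> being an isomorphism, hence
  descent.\<close>

lemma rd_arrow_inverse: "rd_arrow R T inverse_map"
proof
  fix X assume X: "X \<in> Obj R"
  then show "fobj inverse_map X \<in> Obj T" by (simp add: A_Obj)
  have I: "Ide R X \<in> hom R X X" by (rule G.cod.Ide_hom[OF X])
  show "farr inverse_map (Ide R X) = Ide T (fobj inverse_map X)"
    using G.farr_inj[OF inverse_farr(1)[OF I] G.dom.Ide_hom[OF A_Obj[OF X]]] X
    by (simp add: inverse_farr[OF I] G.F_Ide A_Obj G.cod.Ide_Comp[OF u_hom] vu)
  note D = G.cod.Diag_Fib[OF X]
  \<comment> \<open>The left side is the kernel of the isomorphism \<open>u X\<close>.\<close>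
  have "Pull R (u X) (u X) (Diag R X) = Diag R (fobj G (A X))"
    using G.cod.kernel_iso[OF iso[OF X]] G.cod.kernel_eq[OF u_hom[OF X]] by simp
  then show "frel inverse_map X X (Diag R X) = Diag T (fobj inverse_map X)"
    using G.frel_inj[OF _ _ inverse_frel(1)[OF X X D] G.dom.Diag_Fib] X
    by (simp add: inverse_frel[OF X X D] G.frel_Diag A_Obj)
next
  fix f X Y assume f: "f \<in> hom R X Y"
  then show "farr inverse_map f \<in> hom T (fobj inverse_map X) (fobj inverse_map Y)"
    by (simp add: inverse_farr)
next
  fix f g X Y Z assume f: "f \<in> hom R X Y" and g: "g \<in> hom R Y Z"
  note ob = G.cod.homD(4,5)[OF f] G.cod.homD(4,5)[OF g]
  note gf = G.cod.Comp_hom[OF f g]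
  note fu = G.cod.Comp_hom[OF u_hom[OF ob(1)] f]
  note vfu = G.cod.Comp_hom[OF fu v_hom[OF ob(2)]]
  note gu = G.cod.Comp_hom[OF u_hom[OF ob(2)] g]
  have "Comp R (Comp R (v Z) (Comp R g (u Y))) (Comp R (v Y) (Comp R f (u X))) =
      Comp R (v Z) (Comp R (Comp R g (u Y)) (Comp R (v Y) (Comp R f (u X))))"
    by (rule G.cod.Comp_assoc[OF vfu gu v_hom[OF ob(4)], symmetric])
  also have "Comp R (Comp R g (u Y)) (Comp R (v Y) (Comp R f (u X))) = Comp R g (Comp R f (u X))"
    using G.cod.Comp_assoc[OF vfu u_hom[OF ob(2)] g] G.cod.iso_pair_cancel(2)[OF iso[OF ob(2)] fu]
    by simp
  also have "\<dots> = Comp R (Comp R g f) (u X)"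
    by (rule G.cod.Comp_assoc[OF u_hom[OF ob(1)] f g])
  finally show "farr inverse_map (Comp R g f) = Comp T (farr inverse_map g) (farr inverse_map f)"
    using G.farr_inj[OF inverse_farr(1)[OF gf]
        G.dom.Comp_hom[OF inverse_farr(1)[OF f] inverse_farr(1)[OF g]]]
    by (simp add: inverse_farr(2)[OF f] inverse_farr(2)[OF g] inverse_farr(2)[OF gf]
        G.F_Comp[OF inverse_farr(1)[OF f] inverse_farr(1)[OF g]])
next
  fix X Y \<alpha> assume X: "X \<in> Obj R" and Y: "Y \<in> Obj R" and a: "\<alpha> \<in> Fib R X Y"
  note ia = inverse_frel[OF X Y a] and AX = A_Obj[OF X] and AY = A_Obj[OF Y]
  show "frel inverse_map X Y \<alpha> \<in> Fib T (fobj inverse_map X) (fobj inverse_map Y)"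
    using ia by simp
  have ca: "Conv R X Y \<alpha> \<in> Fib R Y X" by (rule G.cod.Conv_Fib[OF X Y a])
  note ica = inverse_frel[OF Y X ca]
  show "frel inverse_map Y X (Conv R X Y \<alpha>) =
      Conv T (fobj inverse_map X) (fobj inverse_map Y) (frel inverse_map X Y \<alpha>)"
    using G.frel_inj[OF AY AX ica(1) G.dom.Conv_Fib[OF AX AY ia(1)]]
    by (simp add: ica ia(2) G.frel_Conv[OF AX AY ia(1)] G.cod.Conv_Pull[OF u_hom[OF X] u_hom[OF Y] a])
next
  fix X Y \<alpha> \<beta>
  assume X: "X \<in> Obj R" and Y: "Y \<in> Obj R" and a: "\<alpha> \<in> Fib R X Y" and b: "\<beta> \<in> Fib R X Y"
    and le: "Leq R X Y \<alpha> \<beta>"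
  show "Leq T (fobj inverse_map X) (fobj inverse_map Y) (frel inverse_map X Y \<alpha>)
      (frel inverse_map X Y \<beta>)"
    using G.frel_Leq_iff[OF A_Obj[OF X] A_Obj[OF Y] inverse_frel(1)[OF X Y a]
        inverse_frel(1)[OF X Y b]] G.cod.Pull_mono[OF u_hom[OF X] u_hom[OF Y] a b le]
    by (simp add: inverse_frel(2)[OF X Y a] inverse_frel(2)[OF X Y b])
next
  fix f g B C X Y \<alpha>
  assume f: "f \<in> hom R B X" and g: "g \<in> hom R C Y" and a: "\<alpha> \<in> Fib R X Y"
  note ob = G.cod.homD(4,5)[OF f] G.cod.homD(4,5)[OF g]
  note P = G.cod.Pull_Fib[OF f g a]
  note ia = inverse_frel[OF ob(2,4) a] and iP = inverse_frel[OF ob(1,3) P]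
  note Hf = inverse_farr[OF f] and Hg = inverse_farr[OF g]
  show "frel inverse_map B C (Pull R f g \<alpha>) =
      Pull T (farr inverse_map f) (farr inverse_map g) (frel inverse_map X Y \<alpha>)"
    using G.frel_inj[OF A_Obj[OF ob(1)] A_Obj[OF ob(3)] iP(1) G.dom.Pull_Fib[OF Hf(1) Hg(1) ia(1)]]
    by (simp add: iP(2) ia(2) G.frel_natural[OF Hf(1) Hg(1) ia(1)] Hf(2) Hg(2)
        Pull_u_Comp[OF f g a])
next
  fix X Y Z \<alpha> \<beta>
  assume X: "X \<in> Obj R" and Y: "Y \<in> Obj R" and Z: "Z \<in> Obj R"
    and a: "\<alpha> \<in> Fib R X Y" and b: "\<beta> \<in> Fib R Y Z"
  note ob = A_Obj[OF X] A_Obj[OF Y] A_Obj[OF Z]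
  note ab = G.cod.Rcomp_Fib[OF X Y Z a b]
  note ia = inverse_frel[OF X Y a] and ib = inverse_frel[OF Y Z b] and iab = inverse_frel[OF X Z ab]
  show "frel inverse_map X Z (Rcomp R X Y Z \<alpha> \<beta>) =
      Rcomp T (fobj inverse_map X) (fobj inverse_map Y) (fobj inverse_map Z)
        (frel inverse_map X Y \<alpha>) (frel inverse_map Y Z \<beta>)"
    using G.frel_inj[OF ob(1,3) iab(1) G.dom.Rcomp_Fib[OF ob ia(1) ib(1)]]
      G.cod.Pull_Rcomp_descent[OF u_hom[OF X] u_hom[OF Y] u_hom[OF Z]
        G.cod.descent_iso[OF iso[OF Y]] a b]
    by (simp add: iab(2) ia(2) ib(2) G.frel_Rcomp[OF ob ia(1) ib(1)])
qed

text \<open>Composition with isomorphisms on both sides keeps \<open>p\<close> a quotient arrow. The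
  conjugate is the image under \<open>G\<close> of \<open>farr inverse_map p\<close>, so the
  property can be reflected to \<open>T\<close>.\<close>

lemma preserves_quotients_inverse: "preserves_quotients R T inverse_map"
  unfolding preserves_quotients_def
proof (intro allI impI)
  fix X \<rho> p assume Q: "quotient_arrow_of R X \<rho> p"
  note P = G.cod.quotient_arrow_ofD[OF Q]
  have pu: "Comp R p (u X) \<in> hom R (fobj G (A X)) (Cod R p)"
    by (rule G.cod.Comp_hom[OF u_hom[OF P(2)] P(4)])
  note Hp = inverse_farr[OF P(4)] and Hr = inverse_frel[OF P(2,2,3)]
  have "quotient_arrow_of R (fobj G (A X)) (Pull R (u X) (u X) \<rho>)
      (Comp R (v (Cod R p)) (Comp R p (u X)))"
    by (rule G.cod.quotient_arrow_iso_Comp[OF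
          G.cod.quotient_arrow_Comp_iso[OF Q iso[OF P(2)]]])
      (use iso_pair_sym[OF iso[OF P(5)]] G.cod.homD(3)[OF pu] in simp)
  then have "quotient_arrow_of T (A X) (frel inverse_map X X \<rho>) (farr inverse_map p)"
    by (intro G.quotient_arrow_reflect[OF Hp(1) Hr(1)]) (simp add: Hp(2) Hr(2))
  then show "quotient_arrow_of T (fobj inverse_map X) (frel inverse_map X X \<rho>) (farr inverse_map p)"
    by simp
qed

section \<open>Structure inherited by the source; unit and counit\<close>

lemma extensional_source:
  assumes "extensional R"
  shows "extensional T"
  unfolding extensional_def
proof (intro ballI impI)
  fix X Y f g assume ob: "X \<in> Obj T" "Y \<in> Obj T" and f: "f \<in> hom T X Y" and g: "g \<in> hom T X Y"
    and eq: "graph T f = graph T g"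
  have "graph R (farr G f) = graph R (farr G g)"
    using G.frel_graph[OF f] G.frel_graph[OF g] eq by simp
  then have "farr G f = farr G g"
    using assms G.F_hom[OF f] G.F_hom[OF g] G.F_Obj ob unfolding extensional_def by blast
  then show "f = g" by (rule G.farr_inj[OF f g])
qed

text \<open>The quotient formed in \<open>R\<close> is composed with \<open>v\<close> to end in the
  image of \<open>G\<close>; fullness then lifts it to \<open>T\<close>, where its properties are
  reflected.\<close>

lemma has_quotients_source:
  assumes "has_quotients R"
  shows "has_quotients T"
  unfolding has_quotients_def
proof (intro allI impI)
  fix X \<rho> assume e: "equiv_rel T X \<rho>"
  then have X: "X \<in> Obj T" and r: "\<rho> \<in> Fib T X X" by (auto simp: equiv_rel_def)
  have "equiv_rel R (fobj G X) (frel G X X \<rho>)" using e G.equiv_rel_iff[OF X r] by simp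
  then obtain p where p: "quotient_arrow_of R (fobj G X) (frel G X X \<rho>) p"
      "effective R (frel G X X \<rho>) p" "descent R p"
    using assms unfolding has_quotients_def by blast
  note P = G.cod.quotient_arrow_ofD[OF p(1)]
  note i = iso_pair_sym[OF iso[OF P(5)]]
  obtain r where r': "r \<in> hom T X (A (Cod R p))" "farr G r = Comp R (v (Cod R p)) p"
    by (rule G.farr_surj[OF X A_Obj[OF P(5)] G.cod.Comp_hom[OF P(4) v_hom[OF P(5)]]])
  have "quotient_arrow_of T X \<rho> r"
    using G.cod.quotient_arrow_iso_Comp[OF p(1) i]
    by (intro G.quotient_arrow_reflect[OF r'(1) r]) (simp add: r'(2))
  moreover have "effective T \<rho> r"
    using G.effective_iff[OF r'(1) r] G.cod.effective_iso_Comp[OF p(2) P(4) i] by (simp add: r'(2))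
  moreover have "descent T r"
    using G.descent_iff[OF r'(1)] G.cod.descent_iso_Comp[OF p(3) P(4) i] by (simp add: r'(2))
  ultimately show "\<exists>q. quotient_arrow_of T X \<rho> q \<and> effective T \<rho> q \<and> descent T q" by blast
qed

text \<open>Both inequalities on relations are equalities here, since \<open>inverse_map\<close>
  acts on relations by pulling back along \<open>u\<close>.\<close>

lemma iso_two_arrow_counit: "iso_two_arrow R R (comp_map G inverse_map) id_map u"
proof -
  have "Comp R (u Y) (farr G (farr inverse_map f)) = Comp R f (u X)"
    if f: "f \<in> hom R X Y" for f X Y
    using G.cod.iso_pair_cancel(2)[OF iso G.cod.Comp_hom[OF u_hom f]] G.cod.homD[OF f]
    by (simp add: inverse_farr[OF f])
  moreover have "Leq R (fobj G (A X)) (fobj G (A Y))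
      (frel G (A X) (A Y) (frel inverse_map X Y \<alpha>)) (Pull R (u X) (u Y) \<alpha>)"
    if "X \<in> Obj R" "Y \<in> Obj R" "\<alpha> \<in> Fib R X Y" for X Y \<alpha>
    using that
    by (simp add: inverse_frel G.cod.Leq_refl G.F_Obj A_Obj G.cod.Pull_Fib[OF u_hom u_hom])
  ultimately have 1: "two_arrow R R (comp_map G inverse_map) id_map u"
    by (simp add: two_arrow_def comp_map_def id_map_def u_hom)
  have "Comp R (v Y) f = Comp R (farr G (farr inverse_map f)) (v X)"
    if f: "f \<in> hom R X Y" for f X Y
  proof -
    note ob = G.cod.homD(4,5)[OF f]
    have "Comp R (Comp R (v Y) (Comp R f (u X))) (v X) = Comp R (Comp R (Comp R (v Y) f) (u X)) (v X)"
      using G.cod.Comp_assoc[OF u_hom[OF ob(1)] f v_hom[OF ob(2)]] by simp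
    then show ?thesis
      using G.cod.iso_pair_cancel(4)[OF iso[OF ob(1)] G.cod.Comp_hom[OF f v_hom[OF ob(2)]]]
      by (simp add: inverse_farr[OF f])
  qed
  moreover have "Leq R X Y \<alpha> (Pull R (v X) (v Y) (frel G (A X) (A Y) (frel inverse_map X Y \<alpha>)))"
    if "X \<in> Obj R" "Y \<in> Obj R" "\<alpha> \<in> Fib R X Y" for X Y \<alpha>
    using that by (simp add: inverse_frel G.cod.Pull_iso_cancel[OF iso iso] G.cod.Leq_refl)
  ultimately have 2: "two_arrow R R id_map (comp_map G inverse_map) v"
    by (simp add: two_arrow_def comp_map_def id_map_def v_hom)
  show ?thesis
    unfolding iso_two_arrow_def using 1 2
    by (intro conjI exI[of _ v]) (simp_all add: comp_map_def id_map_def uv vu)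
qed

text \<open>Fullness supplies arrows of \<open>T\<close> over \<open>v\<close> and \<open>u\<close>
  at each object in the image; naturality, the order conditions and invertibility are reflected from
  \<open>R\<close>.\<close>

lemma iso_two_arrow_unit: "\<exists>\<eta>. iso_two_arrow T T id_map (comp_map inverse_map G) \<eta>"
proof -
  define \<eta> where "\<eta> X = (SOME f. f \<in> hom T X (A (fobj G X)) \<and> farr G f = v (fobj G X))" for X
  define \<eta>' where "\<eta>' X = (SOME f. f \<in> hom T (A (fobj G X)) X \<and> farr G f = u (fobj G X))" for X
  have E: "\<eta> X \<in> hom T X (A (fobj G X)) \<and> farr G (\<eta> X) = v (fobj G X)" if X: "X \<in> Obj T" for X
    unfolding \<eta>_def
    by (rule someI_ex, rule G.farr_surj[OF X A_Obj[OF G.F_Obj[OF X]] v_hom[OF G.F_Obj[OF X]]]) blast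
  have E': "\<eta>' X \<in> hom T (A (fobj G X)) X \<and> farr G (\<eta>' X) = u (fobj G X)" if X: "X \<in> Obj T" for X
    unfolding \<eta>'_def
    by (rule someI_ex, rule G.farr_surj[OF A_Obj[OF G.F_Obj[OF X]] X u_hom[OF G.F_Obj[OF X]]]) blast
  note eta = conjunct1[OF E] conjunct2[OF E] and eta' = conjunct1[OF E'] conjunct2[OF E']
  have "Comp T (\<eta> Y) f = Comp T (farr inverse_map (farr G f)) (\<eta> X)"
    if f: "f \<in> hom T X Y" for f X Y
  proof -
    note ob = G.dom.homD(4,5)[OF f] and Gf = G.F_hom[OF f]
    note H = inverse_farr[OF Gf]
    note gob = G.F_Obj[OF ob(1)] G.F_Obj[OF ob(2)]
    have "Comp R (v (fobj G Y)) (farr G f) = Comp R (farr G (farr inverse_map (farr G f))) (v (fobj G X))"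
      unfolding H(2)
      using G.cod.Comp_assoc[OF u_hom[OF gob(1)] Gf v_hom[OF gob(2)]]
        G.cod.iso_pair_cancel(4)[OF iso[OF gob(1)] G.cod.Comp_hom[OF Gf v_hom[OF gob(2)]]]
      by simp
    then show ?thesis
      by (intro G.farr_inj[OF G.dom.Comp_hom[OF f eta(1)[OF ob(2)]]
            G.dom.Comp_hom[OF eta(1)[OF ob(1)] H(1)]])
        (simp add: G.F_Comp[OF f eta(1)[OF ob(2)]] G.F_Comp[OF eta(1)[OF ob(1)] H(1)] eta(2) ob)
  qed
  moreover have "Leq T X Y \<alpha> (Pull T (\<eta> X) (\<eta> Y) (frel inverse_map (fobj G X) (fobj G Y) (frel G X Y \<alpha>)))"
    if ob: "X \<in> Obj T" "Y \<in> Obj T" and a: "\<alpha> \<in> Fib T X Y" for X Y \<alpha>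
  proof -
    note gob = G.F_Obj[OF ob(1)] G.F_Obj[OF ob(2)] and Ga = G.frel_Fib[OF ob a]
    note H = inverse_frel[OF gob Ga] and ex = eta(1)[OF ob(1)] and ey = eta(1)[OF ob(2)]
    show ?thesis
      using G.frel_Leq_iff[OF ob a G.dom.Pull_Fib[OF ex ey H(1)]]
        G.cod.Leq_refl[OF gob Ga] G.cod.Pull_iso_cancel[OF iso[OF gob(1)] iso[OF gob(2)] Ga]
      by (simp add: G.frel_natural[OF ex ey H(1)] H(2) eta(2)[OF ob(1)] eta(2)[OF ob(2)])
  qed
  ultimately have 1: "two_arrow T T id_map (comp_map inverse_map G) \<eta>"
    by (simp add: two_arrow_def comp_map_def id_map_def eta(1))
  have "Comp T (\<eta>' Y) (farr inverse_map (farr G f)) = Comp T f (\<eta>' X)"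
    if f: "f \<in> hom T X Y" for f X Y
  proof -
    note ob = G.dom.homD(4,5)[OF f] and Gf = G.F_hom[OF f]
    note H = inverse_farr[OF Gf]
    note gob = G.F_Obj[OF ob(1)] G.F_Obj[OF ob(2)]
    have "Comp R (u (fobj G Y)) (farr G (farr inverse_map (farr G f))) = Comp R (farr G f) (u (fobj G X))"
      unfolding H(2)
      by (rule G.cod.iso_pair_cancel(2)[OF iso[OF gob(2)] G.cod.Comp_hom[OF u_hom[OF gob(1)] Gf]])
    then show ?thesis
      by (intro G.farr_inj[OF G.dom.Comp_hom[OF H(1) eta'(1)[OF ob(2)]]
            G.dom.Comp_hom[OF eta'(1)[OF ob(1)] f]])
        (simp add: G.F_Comp[OF H(1) eta'(1)[OF ob(2)]] G.F_Comp[OF eta'(1)[OF ob(1)] f] eta'(2) ob)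
  qed
  moreover have "Leq T (A (fobj G X)) (A (fobj G Y))
      (frel inverse_map (fobj G X) (fobj G Y) (frel G X Y \<alpha>)) (Pull T (\<eta>' X) (\<eta>' Y) \<alpha>)"
    if ob: "X \<in> Obj T" "Y \<in> Obj T" and a: "\<alpha> \<in> Fib T X Y" for X Y \<alpha>
  proof -
    note gob = G.F_Obj[OF ob(1)] G.F_Obj[OF ob(2)] and Ga = G.frel_Fib[OF ob a]
    note H = inverse_frel[OF gob Ga] and ex = eta'(1)[OF ob(1)] and ey = eta'(1)[OF ob(2)]
    note aob = A_Obj[OF gob(1)] A_Obj[OF gob(2)]
    show ?thesis
      using G.frel_Leq_iff[OF aob H(1) G.dom.Pull_Fib[OF ex ey a]]
        G.cod.Leq_refl[OF G.F_Obj[OF aob(1)] G.F_Obj[OF aob(2)]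
          G.cod.Pull_Fib[OF u_hom[OF gob(1)] u_hom[OF gob(2)] Ga]]
      by (simp add: G.frel_natural[OF ex ey a] H(2) eta'(2)[OF ob(1)] eta'(2)[OF ob(2)])
  qed
  ultimately have 2: "two_arrow T T (comp_map inverse_map G) id_map \<eta>'"
    by (simp add: two_arrow_def comp_map_def id_map_def eta'(1))
  have "Comp T (\<eta>' X) (\<eta> X) = Ide T X \<and> Comp T (\<eta> X) (\<eta>' X) = Ide T (A (fobj G X))"
    if X: "X \<in> Obj T" for X
  proof
    note ex = eta(1)[OF X] eta'(1)[OF X] and GX = G.F_Obj[OF X]
    show "Comp T (\<eta>' X) (\<eta> X) = Ide T X"
      by (rule G.farr_inj[OF G.dom.Comp_hom[OF ex] G.dom.Ide_hom[OF X]])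
        (simp add: G.F_Comp[OF ex] eta(2) eta'(2) X uv GX G.F_Ide)
    show "Comp T (\<eta> X) (\<eta>' X) = Ide T (A (fobj G X))"
      by (rule G.farr_inj[OF G.dom.Comp_hom[OF ex(2,1)] G.dom.Ide_hom[OF A_Obj[OF GX]]])
        (simp add: G.F_Comp[OF ex(2,1)] eta(2) eta'(2) X vu GX G.F_Ide A_Obj)
  qed
  then show ?thesis
    unfolding iso_two_arrow_def using 1 2
    by (intro exI[of _ \<eta>] conjI exI[of _ \<eta>']) (simp_all add: comp_map_def id_map_def)
qed

lemma EQRD_equivalence:
  assumes "EQRD_obj R"
  shows "EQRD_equivalence T R G"
proof -
  have T: "EQRD_obj T"
    using assms extensional_source has_quotients_source G.dom.relational_doctrine_axioms
    by (simp add: EQRD_obj_def)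
  moreover have "preserves_quotients T R G"
    by (simp add: preserves_quotients_def quotient_arrow_preserve)
  ultimately have "EQRD_arrow T R G"
    using assms G.rd_arrow_axioms by (simp add: EQRD_arrow_def)
  moreover have "EQRD_arrow R T inverse_map"
    using assms T rd_arrow_inverse preserves_quotients_inverse by (simp add: EQRD_arrow_def)
  ultimately show ?thesis
    using iso_two_arrow_unit iso_two_arrow_counit unfolding EQRD_equivalence_def by blast
qed

end

lemma EQRD_equivalence_if_ess_surj:
  fixes G :: "('p, 'b, 's, 'o, 'a, 'r) rd_map"
  assumes "EQRD_obj R" "rd_arrow T R G" "fully_faithful T R G"
    and ess: "\<And>X. X \<in> Obj R \<Longrightarrow> \<exists>P \<in> Obj T. \<exists>u v. iso_pair R (fobj G P) X u v"
  shows "EQRD_equivalence T R G"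
proof -
  have "\<forall>X. \<exists>P u v. X \<in> Obj R \<longrightarrow> P \<in> Obj T \<and> iso_pair R (fobj G P) X u v"
    using ess by blast
  then obtain A u v where "\<forall>X. X \<in> Obj R \<longrightarrow> A X \<in> Obj T \<and> iso_pair R (fobj G (A X)) X (u X) (v X)"
    by metis
  then interpret ff_ess_surj T R G A u v
    using assms by (intro ff_ess_surj.intro ff_arrow.intro ff_arrow_axioms.intro
        ff_ess_surj_axioms.intro) auto
  show ?thesis by (rule EQRD_equivalence[OF assms(1)])
qed

subsection \<open>Transport of structure\<close>

text \<open>Structure on \<open>T\<close> that is carried by \<open>G\<close> bijectively, hom by hom and fibre by fibre, to
  that of a relational doctrine satisfies all the axioms, since each of them can be checked after
  applying \<open>G\<close>.\<close>

locale doctrine_transport = cod: relational_doctrine R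
  for T :: "('p, 'b, 's) reldoc" and R :: "('o, 'a, 'r) reldoc"
    and G :: "('p, 'b, 's, 'o, 'a, 'r) rd_map" +
  assumes Arr_Obj: "f \<in> Arr T \<Longrightarrow> Dom T f \<in> Obj T \<and> Cod T f \<in> Obj T"
    and G_Obj: "X \<in> Obj T \<Longrightarrow> fobj G X \<in> Obj R"
    and G_hom: "X \<in> Obj T \<Longrightarrow> Y \<in> Obj T \<Longrightarrow>
      bij_betw (farr G) (hom T X Y) (hom R (fobj G X) (fobj G Y))"
    and G_Ide: "X \<in> Obj T \<Longrightarrow>
      Ide T X \<in> hom T X X \<and> farr G (Ide T X) = Ide R (fobj G X)"
    and G_Comp: "f \<in> hom T X Y \<Longrightarrow> g \<in> hom T Y Z \<Longrightarrow>
      Comp T g f \<in> hom T X Z \<and> farr G (Comp T g f) = Comp R (farr G g) (farr G f)"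
    and G_Fib: "X \<in> Obj T \<Longrightarrow> Y \<in> Obj T \<Longrightarrow>
      bij_betw (frel G X Y) (Fib T X Y) (Fib R (fobj G X) (fobj G Y))"
    and G_Leq: "X \<in> Obj T \<Longrightarrow> Y \<in> Obj T \<Longrightarrow> \<alpha> \<in> Fib T X Y \<Longrightarrow> \<beta> \<in> Fib T X Y \<Longrightarrow>
      Leq T X Y \<alpha> \<beta> \<longleftrightarrow> Leq R (fobj G X) (fobj G Y) (frel G X Y \<alpha>) (frel G X Y \<beta>)"
    and G_Pull: "f \<in> hom T A X \<Longrightarrow> g \<in> hom T B Y \<Longrightarrow> \<alpha> \<in> Fib T X Y \<Longrightarrow>
      Pull T f g \<alpha> \<in> Fib T A B \<and>
      frel G A B (Pull T f g \<alpha>) = Pull R (farr G f) (farr G g) (frel G X Y \<alpha>)"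
    and G_Rcomp: "X \<in> Obj T \<Longrightarrow> Y \<in> Obj T \<Longrightarrow> Z \<in> Obj T \<Longrightarrow>
      \<alpha> \<in> Fib T X Y \<Longrightarrow> \<beta> \<in> Fib T Y Z \<Longrightarrow>
      Rcomp T X Y Z \<alpha> \<beta> \<in> Fib T X Z \<and> frel G X Z (Rcomp T X Y Z \<alpha> \<beta>) =
        Rcomp R (fobj G X) (fobj G Y) (fobj G Z) (frel G X Y \<alpha>) (frel G Y Z \<beta>)"
    and G_Diag: "X \<in> Obj T \<Longrightarrow>
      Diag T X \<in> Fib T X X \<and> frel G X X (Diag T X) = Diag R (fobj G X)"
    and G_Conv: "X \<in> Obj T \<Longrightarrow> Y \<in> Obj T \<Longrightarrow> \<alpha> \<in> Fib T X Y \<Longrightarrow>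
      Conv T X Y \<alpha> \<in> Fib T Y X \<and>
      frel G Y X (Conv T X Y \<alpha>) = Conv R (fobj G X) (fobj G Y) (frel G X Y \<alpha>)"
begin

lemma hom_Obj: "f \<in> hom T X Y \<Longrightarrow> X \<in> Obj T \<and> Y \<in> Obj T"
  using Arr_Obj by (auto simp: hom_def)

lemma G_homD: "f \<in> hom T X Y \<Longrightarrow> farr G f \<in> hom R (fobj G X) (fobj G Y)"
  using bij_betw_apply[OF G_hom] hom_Obj by blast

lemma G_FibD: "X \<in> Obj T \<Longrightarrow> Y \<in> Obj T \<Longrightarrow> \<alpha> \<in> Fib T X Y \<Longrightarrow>
    frel G X Y \<alpha> \<in> Fib R (fobj G X) (fobj G Y)"
  using bij_betw_apply[OF G_Fib] by blast

lemma G_hom_inj: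
  assumes "f \<in> hom T X Y" "g \<in> hom T X Y" "farr G f = farr G g"
  shows "f = g"
  using inj_onD[OF bij_betw_imp_inj_on[OF G_hom] assms(3,1,2)] hom_Obj[OF assms(1)] by simp

lemma G_Fib_inj:
  assumes "X \<in> Obj T" "Y \<in> Obj T" "\<alpha> \<in> Fib T X Y" "\<beta> \<in> Fib T X Y"
    and "frel G X Y \<alpha> = frel G X Y \<beta>"
  shows "\<alpha> = \<beta>"
  using inj_onD[OF bij_betw_imp_inj_on[OF G_Fib] assms(5,3,4)] assms(1,2) by simp

lemmas closed = conjunct1[OF G_Ide] conjunct1[OF G_Comp] conjunct1[OF G_Pull] conjunct1[OF G_Rcomp]
  conjunct1[OF G_Diag] conjunct1[OF G_Conv]

lemma category_source: "category T"
proof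
  show "Dom T f \<in> Obj T" "Cod T f \<in> Obj T" if "f \<in> Arr T" for f using Arr_Obj that by auto
  show "Ide T X \<in> hom T X X" if "X \<in> Obj T" for X using closed(1) that .
  show "Comp T g f \<in> hom T X Z" if "f \<in> hom T X Y" "g \<in> hom T Y Z" for f g X Y Z
    using closed(2) that .
  show "Comp T f (Ide T X) = f" if f: "f \<in> hom T X Y" for f X Y
  proof -
    have I: "Ide T X \<in> hom T X X" using closed(1) hom_Obj[OF f] by blast
    show ?thesis
      using G_Comp[OF I f] G_Ide[of X] hom_Obj[OF f] cod.Comp_Ide[OF G_homD[OF f]]
      by (intro G_hom_inj[OF _ f]) simp_all
  qed
  show "Comp T (Ide T Y) f = f" if f: "f \<in> hom T X Y" for f X Y
  proof -
    have I: "Ide T Y \<in> hom T Y Y" using closed(1) hom_Obj[OF f] by blast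
    show ?thesis
      using G_Comp[OF f I] G_Ide[of Y] hom_Obj[OF f] cod.Ide_Comp[OF G_homD[OF f]]
      by (intro G_hom_inj[OF _ f]) simp_all
  qed
  show "Comp T h (Comp T g f) = Comp T (Comp T h g) f"
    if f: "f \<in> hom T X Y" and g: "g \<in> hom T Y Z" and h: "h \<in> hom T Z W" for f g h X Y Z W
  proof -
    note gf = closed(2)[OF f g] and hg = closed(2)[OF g h]
    show ?thesis
      using G_Comp[OF f g] G_Comp[OF g h] G_Comp[OF gf h] G_Comp[OF f hg]
        cod.Comp_assoc[OF G_homD[OF f] G_homD[OF g] G_homD[OF h]]
      by (intro G_hom_inj[OF closed(2)[OF gf h] closed(2)[OF f hg]]) simp
  qed
qed

lemma doctrine_source: "relational_doctrine T"
proof -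
  interpret T: category T by (rule category_source)
  show ?thesis
  proof
    fix X Y \<alpha> assume ob: "X \<in> Obj T" "Y \<in> Obj T" and a: "\<alpha> \<in> Fib T X Y"
    note Ga = G_FibD[OF ob a] and Gob = G_Obj[OF ob(1)] G_Obj[OF ob(2)]
    note I = closed(1)[OF ob(1)] closed(1)[OF ob(2)]
    note D = closed(5)[OF ob(1)] closed(5)[OF ob(2)]
    note C = closed(6)[OF ob a]
    show "Leq T X Y \<alpha> \<alpha>" by (simp add: G_Leq ob a cod.Leq_refl Gob Ga)
    show "Pull T (Ide T X) (Ide T Y) \<alpha> = \<alpha>"
      by (rule G_Fib_inj[OF ob closed(3)[OF I a] a])
        (simp add: G_Pull[OF I a] G_Ide ob cod.Pull_Ide Gob Ga)
    show "Rcomp T X X Y (Diag T X) \<alpha> = \<alpha>"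
      by (rule G_Fib_inj[OF ob closed(4)[OF ob(1,1,2) D(1) a] a])
        (simp add: G_Rcomp[OF ob(1,1,2) D(1) a] G_Diag ob cod.Diag_Rcomp Gob Ga)
    show "Rcomp T X Y Y \<alpha> (Diag T Y) = \<alpha>"
      by (rule G_Fib_inj[OF ob closed(4)[OF ob(1,2,2) a D(2)] a])
        (simp add: G_Rcomp[OF ob(1,2,2) a D(2)] G_Diag ob cod.Rcomp_Diag Gob Ga)
    show "Conv T X Y \<alpha> \<in> Fib T Y X" by (rule C)
    show "Conv T Y X (Conv T X Y \<alpha>) = \<alpha>"
      by (rule G_Fib_inj[OF ob closed(6)[OF ob(2,1) C] a])
        (simp add: G_Conv[OF ob(2,1) C] G_Conv[OF ob a] cod.Conv_Conv Gob Ga)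
  next
    fix X Y \<alpha> \<beta> \<gamma>
    assume ob: "X \<in> Obj T" "Y \<in> Obj T"
      and F: "\<alpha> \<in> Fib T X Y" "\<beta> \<in> Fib T X Y" "\<gamma> \<in> Fib T X Y"
      and le: "Leq T X Y \<alpha> \<beta>" "Leq T X Y \<beta> \<gamma>"
    then show "Leq T X Y \<alpha> \<gamma>"
      using cod.Leq_trans[OF G_Obj[OF ob(1)] G_Obj[OF ob(2)] G_FibD[OF ob F(1)]
          G_FibD[OF ob F(2)] G_FibD[OF ob F(3)]]
      by (simp add: G_Leq)
  next
    fix X Y \<alpha> \<beta>
    assume ob: "X \<in> Obj T" "Y \<in> Obj T" and F: "\<alpha> \<in> Fib T X Y" "\<beta> \<in> Fib T X Y"
      and le: "Leq T X Y \<alpha> \<beta>"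
    note GF = G_FibD[OF ob F(1)] G_FibD[OF ob F(2)]
    note Gle = le[unfolded G_Leq[OF ob F]]
    show "Leq T Y X (Conv T X Y \<alpha>) (Conv T X Y \<beta>)"
      using cod.Conv_mono[OF G_Obj[OF ob(1)] G_Obj[OF ob(2)] GF Gle]
      by (simp add: G_Leq[OF ob(2,1)] closed(6)[OF ob] G_Conv[OF ob] F)
    assume "Leq T X Y \<beta> \<alpha>"
    then show "\<alpha> = \<beta>"
      using cod.Leq_antisym[OF G_Obj[OF ob(1)] G_Obj[OF ob(2)] GF Gle]
      by (intro G_Fib_inj[OF ob F]) (simp add: G_Leq[OF ob F(2,1)])
  next
    fix f g A B X Y \<alpha>
    assume f: "f \<in> hom T A X" and g: "g \<in> hom T B Y" and a: "\<alpha> \<in> Fib T X Y"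
    note ob = T.homD(4,5)[OF f] T.homD(4,5)[OF g]
    note P = closed(3)[OF f g a] and C = closed(6)[OF ob(2,4) a]
    show "Pull T f g \<alpha> \<in> Fib T A B" by (rule P)
    show "Leq T B A (Conv T A B (Pull T f g \<alpha>)) (Pull T g f (Conv T X Y \<alpha>))"
      using cod.Pull_Conv[OF G_homD[OF f] G_homD[OF g] G_FibD[OF ob(2,4) a]]
      by (simp add: G_Leq[OF ob(3,1) closed(6)[OF ob(1,3) P] closed(3)[OF g f C]]
          G_Conv[OF ob(1,3) P] G_Pull[OF f g a] G_Pull[OF g f C] G_Conv[OF ob(2,4) a])
    fix \<beta> assume b: "\<beta> \<in> Fib T X Y" and le: "Leq T X Y \<alpha> \<beta>"
    show "Leq T A B (Pull T f g \<alpha>) (Pull T f g \<beta>)"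
      using cod.Pull_mono[OF G_homD[OF f] G_homD[OF g] G_FibD[OF ob(2,4) a]
          G_FibD[OF ob(2,4) b] le[unfolded G_Leq[OF ob(2,4) a b]]]
      by (simp add: G_Leq[OF ob(1,3) P closed(3)[OF f g b]] G_Pull[OF f g a] G_Pull[OF f g b])
  next
    fix f f' g g' A A' B B' X Y \<alpha>
    assume f': "f' \<in> hom T A' A" and f: "f \<in> hom T A X"
      and g': "g' \<in> hom T B' B" and g: "g \<in> hom T B Y" and a: "\<alpha> \<in> Fib T X Y"
    note ob = T.homD(4)[OF f'] T.homD(4)[OF g'] and obX = T.homD(5)[OF f] T.homD(5)[OF g]
    note c = closed(2)[OF f' f] closed(2)[OF g' g]
    note P = closed(3)[OF f g a]
    show "Pull T (Comp T f f') (Comp T g g') \<alpha> = Pull T f' g' (Pull T f g \<alpha>)"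
      by (rule G_Fib_inj[OF ob closed(3)[OF c a] closed(3)[OF f' g' P]])
        (simp add: G_Pull[OF c a] G_Pull[OF f' g' P] G_Pull[OF f g a] G_Comp[OF f' f] G_Comp[OF g' g]
          cod.Pull_Comp[OF G_homD[OF f'] G_homD[OF f] G_homD[OF g'] G_homD[OF g]
            G_FibD[OF obX a]])
  next
    fix X Y Z \<alpha> \<beta>
    assume ob: "X \<in> Obj T" "Y \<in> Obj T" "Z \<in> Obj T"
      and a: "\<alpha> \<in> Fib T X Y" and b: "\<beta> \<in> Fib T Y Z"
    note Gob = G_Obj[OF ob(1)] G_Obj[OF ob(2)] G_Obj[OF ob(3)]
    note Ga = G_FibD[OF ob(1,2) a] and Gb = G_FibD[OF ob(2,3) b]
    note ab = closed(4)[OF ob a b] and Ca = closed(6)[OF ob(1,2) a] and Cb = closed(6)[OF ob(2,3) b]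
    show "Rcomp T X Y Z \<alpha> \<beta> \<in> Fib T X Z" by (rule ab)
    show "Conv T X Z (Rcomp T X Y Z \<alpha> \<beta>) = Rcomp T Z Y X (Conv T Y Z \<beta>) (Conv T X Y \<alpha>)"
      by (rule G_Fib_inj[OF ob(3,1) closed(6)[OF ob(1,3) ab] closed(4)[OF ob(3,2,1) Cb Ca]])
        (simp add: G_Conv[OF ob(1,3) ab] G_Rcomp[OF ob(3,2,1) Cb Ca] G_Rcomp[OF ob a b]
          G_Conv[OF ob(1,2) a] G_Conv[OF ob(2,3) b] cod.Conv_Rcomp[OF Gob Ga Gb])
    {
      fix \<alpha>' \<beta>' assume a': "\<alpha>' \<in> Fib T X Y" and b': "\<beta>' \<in> Fib T Y Z"
        and le: "Leq T X Y \<alpha> \<alpha>'" "Leq T Y Z \<beta> \<beta>'"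
      show "Leq T X Z (Rcomp T X Y Z \<alpha> \<beta>) (Rcomp T X Y Z \<alpha>' \<beta>')"
        using cod.Rcomp_mono[OF Gob Ga G_FibD[OF ob(1,2) a'] Gb G_FibD[OF ob(2,3) b']
            le(1)[unfolded G_Leq[OF ob(1,2) a a']] le(2)[unfolded G_Leq[OF ob(2,3) b b']]]
        by (simp add: G_Leq[OF ob(1,3) ab closed(4)[OF ob a' b']] G_Rcomp[OF ob a b]
            G_Rcomp[OF ob a' b'])
    }
    fix W \<gamma> assume W: "W \<in> Obj T" and c: "\<gamma> \<in> Fib T Z W"
    note bc = closed(4)[OF ob(2,3) W b c]
    show "Rcomp T X Y W \<alpha> (Rcomp T Y Z W \<beta> \<gamma>) = Rcomp T X Z W (Rcomp T X Y Z \<alpha> \<beta>) \<gamma>"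
      by (rule G_Fib_inj[OF ob(1) W closed(4)[OF ob(1,2) W a bc] closed(4)[OF ob(1,3) W ab c]])
        (simp add: G_Rcomp[OF ob(1,2) W a bc] G_Rcomp[OF ob(1,3) W ab c] G_Rcomp[OF ob(2,3) W b c]
          G_Rcomp[OF ob a b] cod.Rcomp_assoc[OF Gob G_Obj[OF W] Ga Gb G_FibD[OF ob(3) W c]])
  next
    fix X assume X: "X \<in> Obj T"
    note D = closed(5)[OF X]
    show "Diag T X \<in> Fib T X X" by (rule D)
    show "Conv T X X (Diag T X) = Diag T X"
      by (rule G_Fib_inj[OF X X closed(6)[OF X X D] D])
        (simp add: G_Conv[OF X X D] G_Diag[OF X] cod.Conv_Diag[OF G_Obj[OF X]])
  next
    fix f g h A B C X Y Z \<alpha> \<beta>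
    assume f: "f \<in> hom T A X" and g: "g \<in> hom T B Y" and h: "h \<in> hom T C Z"
      and a: "\<alpha> \<in> Fib T X Y" and b: "\<beta> \<in> Fib T Y Z"
    note ob = T.homD(4)[OF f] T.homD(4)[OF g] T.homD(4)[OF h]
      and ob' = T.homD(5)[OF f] T.homD(5)[OF g] T.homD(5)[OF h]
    note Pa = closed(3)[OF f g a] and Pb = closed(3)[OF g h b]
    note ab = closed(4)[OF ob' a b]
    show "Leq T A C (Rcomp T A B C (Pull T f g \<alpha>) (Pull T g h \<beta>)) (Pull T f h (Rcomp T X Y Z \<alpha> \<beta>))"
      using cod.Pull_Rcomp[OF G_homD[OF f] G_homD[OF g] G_homD[OF h]
          G_FibD[OF ob'(1,2) a] G_FibD[OF ob'(2,3) b]]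
      by (simp add: G_Leq[OF ob(1,3) closed(4)[OF ob Pa Pb] closed(3)[OF f h ab]]
          G_Rcomp[OF ob Pa Pb] G_Pull[OF f h ab] G_Pull[OF f g a] G_Pull[OF g h b]
          G_Rcomp[OF ob' a b])
  next
    fix f A X assume f: "f \<in> hom T A X"
    note ob = T.homD(4,5)[OF f] and D = closed(5)[OF T.homD(5)[OF f]]
    show "Leq T A A (Diag T A) (Pull T f f (Diag T X))"
      using cod.Pull_Diag[OF G_homD[OF f]]
      by (simp add: G_Leq[OF ob(1,1) closed(5)[OF ob(1)] closed(3)[OF f f D]] G_Pull[OF f f D]
          G_Diag ob)
  qed
qed

lemma ff_arrow: "ff_arrow T R G"
proof -
  interpret T: relational_doctrine T by (rule doctrine_source)
  show ?thesis
    by unfold_locales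
      (auto simp: G_Obj G_homD G_FibD G_Ide G_Comp G_Pull G_Diag G_Rcomp G_Conv G_Leq
        fully_faithful_def G_hom G_Fib)
qed

end

subsection \<open>The completion and its image under \<open>F\<^sup>\<sharp>\<close>\<close>

text \<open>\<open>lifts A B h\<close> is the equivalence class of arrows that is the arrow of the completion mapped to
  \<open>h\<close>, provided it is nonempty.\<close>

locale quotient_setup = F: ff_arrow S R F
  for S :: "('p, 'b, 's) reldoc" and R :: "('o, 'a, 'r) reldoc"
    and F :: "('p, 'b, 's, 'o, 'a, 'r) rd_map" +
  fixes q :: "'p \<times> 's \<Rightarrow> 'a"
  assumes ext: "extensional R" and choice: "quotient_choice S R F q"
begin

abbreviation E where "E \<equiv> eq_completion S"
abbreviation Q where "Q A \<equiv> Cod R (q A)"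

definition lifts :: "'p \<times> 's \<Rightarrow> 'p \<times> 's \<Rightarrow> 'a \<Rightarrow> 'b set" where
  "lifts A B h = {f \<in> hom S (fst A) (fst B). Comp R h (q A) = Comp R (q B) (farr F f)}"

section \<open>Objects of the completion and their chosen quotients\<close>

lemma Obj_E: "A \<in> Obj E \<longleftrightarrow> equiv_rel S (fst A) (snd A)"
  by (simp add: eq_completion_def case_prod_unfold)

lemma Obj_fst: "A \<in> Obj E \<Longrightarrow> fst A \<in> Obj S"
  by (simp add: Obj_E equiv_rel_def)

lemma snd_Fib: "A \<in> Obj E \<Longrightarrow> snd A \<in> Fib S (fst A) (fst A)"
  by (simp add: Obj_E equiv_rel_def)

lemma q_quotient:
  "A \<in> Obj E \<Longrightarrow> quotient_arrow_of R (fobj F (fst A)) (frel F (fst A) (fst A) (snd A)) (q A)"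
  using choice by (cases A) (simp add: quotient_choice_def Obj_E)

lemma q_kernel: "A \<in> Obj E \<Longrightarrow> frel F (fst A) (fst A) (snd A) = kernel R (q A)"
  using choice by (cases A) (simp add: quotient_choice_def Obj_E effective_def)

lemma q_descent: "A \<in> Obj E \<Longrightarrow> descent R (q A)"
  using choice by (cases A) (simp add: quotient_choice_def Obj_E)

lemma q_hom: "A \<in> Obj E \<Longrightarrow> q A \<in> hom R (fobj F (fst A)) (Q A)"
  using F.cod.quotient_arrow_ofD(4)[OF q_quotient] .

lemma Q_Obj: "A \<in> Obj E \<Longrightarrow> Q A \<in> Obj R"
  using F.cod.homD(5)[OF q_hom] .

lemma q_epi:
  "A \<in> Obj E \<Longrightarrow> h \<in> hom R (Q A) Z \<Longrightarrow> k \<in> hom R (Q A) Z \<Longrightarrow> Comp R h (q A) = Comp R k (q A) \<Longrightarrow> h = k"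
  using F.cod.quotient_epi[OF q_quotient] .

text \<open>As \<open>F\<close> sends the relation of \<open>B\<close> to the kernel of
  \<open>q B\<close>, a condition in \<open>S\<close> modulo that relation becomes a condition in
  \<open>R\<close> on arrows into \<open>Q B\<close>.\<close>

lemma frel_Pull_snd:
  assumes B: "B \<in> Obj E" and f: "f \<in> hom S X (fst B)" and g: "g \<in> hom S Y (fst B)"
  shows "frel F X Y (Pull S f g (snd B)) =
    Pull R (Comp R (q B) (farr F f)) (Comp R (q B) (farr F g)) (Diag R (Q B))"
  using F.cod.Pull_Comp[OF F.F_hom[OF f] q_hom[OF B] F.F_hom[OF g] q_hom[OF B]
      F.cod.Diag_Fib[OF Q_Obj[OF B]]]
  by (simp add: F.frel_natural[OF f g snd_Fib[OF B]] q_kernel[OF B] F.cod.kernel_eq[OF q_hom[OF B]])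

lemma eq_pre_hom_alt:
  assumes A: "A \<in> Obj E" and B: "B \<in> Obj E"
  shows "eq_pre_hom S A B =
    {f \<in> hom S (fst A) (fst B). Leq S (fst A) (fst A) (snd A) (Pull S f f (snd B))}"
  by (auto simp: eq_pre_hom_def case_prod_unfold F.dom.Pull_eq[OF _ _ snd_Fib[OF B]])

lemma eq_sim_alt:
  assumes A: "A \<in> Obj E" and B: "B \<in> Obj E"
  shows "(f, g) \<in> eq_sim S A B \<longleftrightarrow> f \<in> eq_pre_hom S A B \<and> g \<in> eq_pre_hom S A B \<and>
    Leq S (fst A) (fst A) (snd A) (Pull S f g (snd B))"
  by (auto simp: eq_sim_def case_prod_unfold eq_pre_hom_alt[OF A B, unfolded split_def]
      F.dom.Pull_eq[OF _ _ snd_Fib[OF B]])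

text \<open>Being a representative means that \<open>F f\<close> followed by \<open>q B\<close> is
  compatible with the relation of which \<open>q A\<close> is the quotient; the universal property
  of \<open>q A\<close> turns this into a factorization.\<close>

lemma mem_eq_pre_hom:
  assumes A: "A \<in> Obj E" and B: "B \<in> Obj E"
  shows "f \<in> eq_pre_hom S A B \<longleftrightarrow> (\<exists>h \<in> hom R (Q A) (Q B). f \<in> lifts A B h)"
proof (cases "f \<in> hom S (fst A) (fst B)")
  case f: True
  note qf = F.cod.Comp_hom[OF F.F_hom[OF f] q_hom[OF B]]
  have "f \<in> eq_pre_hom S A B \<longleftrightarrow> Leq R (fobj F (fst A)) (fobj F (fst A))
      (frel F (fst A) (fst A) (snd A)) (kernel R (Comp R (q B) (farr F f)))"
    using F.frel_Leq_iff[OF Obj_fst[OF A] Obj_fst[OF A] snd_Fib[OF A]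
        F.dom.Pull_Fib[OF f f snd_Fib[OF B]]] f
    by (simp add: eq_pre_hom_alt[OF A B] frel_Pull_snd[OF B f f] F.cod.kernel_eq[OF qf])
  also have "\<dots> \<longleftrightarrow> (\<exists>h \<in> hom R (Q A) (Q B). Comp R h (q A) = Comp R (q B) (farr F f))"
  proof
    assume "Leq R (fobj F (fst A)) (fobj F (fst A))
      (frel F (fst A) (fst A) (snd A)) (kernel R (Comp R (q B) (farr F f)))"
    from ex1_implies_ex[OF F.cod.quotient_factor[OF q_quotient[OF A] qf this]]
    show "\<exists>h \<in> hom R (Q A) (Q B). Comp R h (q A) = Comp R (q B) (farr F f)"
      by (elim exE) (rule bexI, auto)
  next
    assume "\<exists>h \<in> hom R (Q A) (Q B). Comp R h (q A) = Comp R (q B) (farr F f)"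
    then obtain h where h: "h \<in> hom R (Q A) (Q B)" "Comp R h (q A) = Comp R (q B) (farr F f)"
      by (rule bexE)
    show "Leq R (fobj F (fst A)) (fobj F (fst A))
      (frel F (fst A) (fst A) (snd A)) (kernel R (Comp R (q B) (farr F f)))"
      using F.cod.quotient_le_kernel_Comp[OF q_quotient[OF A] h(1)] h(2) by simp
  qed
  finally show ?thesis using f by (auto simp: lifts_def)
qed (simp add: eq_pre_hom_alt[OF A B] lifts_def)

text \<open>Here extensionality enters. For equivalent \<open>f\<close> and \<open>g\<close> the
  diagonal lies below the kernel of \<open>q A\<close>, hence below the pullback of the diagonal
  along their two composites with \<open>q B\<close>; so these composites have equal graphs and
  coincide.\<close>

lemma mem_eq_sim:
  assumes A: "A \<in> Obj E" and B: "B \<in> Obj E" and h: "h \<in> hom R (Q A) (Q B)"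
    and f: "f \<in> lifts A B h"
  shows "(f, g) \<in> eq_sim S A B \<longleftrightarrow> g \<in> lifts A B h"
proof
  have fh: "f \<in> hom S (fst A) (fst B)" and fe: "Comp R (q B) (farr F f) = Comp R h (q A)"
    using f by (auto simp: lifts_def)
  note qf = F.cod.Comp_hom[OF F.F_hom[OF fh] q_hom[OF B]]
  note FA = F.F_Obj[OF Obj_fst[OF A]]
  {
    assume l: "(f, g) \<in> eq_sim S A B"
    then have gh: "g \<in> hom S (fst A) (fst B)"
      by (simp add: eq_sim_alt[OF A B] eq_pre_hom_alt[OF A B])
    note qg = F.cod.Comp_hom[OF F.F_hom[OF gh] q_hom[OF B]]
    have P: "Pull R (Comp R (q B) (farr F f)) (Comp R (q B) (farr F g)) (Diag R (Q B)) \<in>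
        Fib R (fobj F (fst A)) (fobj F (fst A))"
      by (rule F.cod.Pull_Fib[OF qf qg F.cod.Diag_Fib[OF Q_Obj[OF B]]])
    have le: "Leq R (fobj F (fst A)) (fobj F (fst A)) (kernel R (q A))
        (Pull R (Comp R (q B) (farr F f)) (Comp R (q B) (farr F g)) (Diag R (Q B)))"
      using l F.frel_Leq_iff[OF Obj_fst[OF A] Obj_fst[OF A] snd_Fib[OF A]
          F.dom.Pull_Fib[OF fh gh snd_Fib[OF B]]]
      by (simp add: eq_sim_alt[OF A B] frel_Pull_snd[OF B fh gh] q_kernel[OF A])
    have t: "Leq R (fobj F (fst A)) (fobj F (fst A)) (Diag R (fobj F (fst A))) (kernel R (q A))"
      using F.cod.Pull_Diag[OF q_hom[OF A]] by (simp add: F.cod.kernel_eq[OF q_hom[OF A]])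
    have "graph R (Comp R (q B) (farr F f)) = graph R (Comp R (q B) (farr F g))"
      by (rule F.cod.graph_eqI[OF qf qg F.cod.Leq_trans[OF FA FA F.cod.Diag_Fib[OF FA]
              F.cod.kernel_Fib[OF q_hom[OF A]] P t le]])
    then have "Comp R (q B) (farr F f) = Comp R (q B) (farr F g)"
      using ext qf qg FA Q_Obj[OF B] unfolding extensional_def by blast
    then show "g \<in> lifts A B h" using gh fe by (simp add: lifts_def)
  }
  assume g: "g \<in> lifts A B h"
  then have gh: "g \<in> hom S (fst A) (fst B)" and ge: "Comp R (q B) (farr F g) = Comp R h (q A)"
    by (auto simp: lifts_def)
  \<comment> \<open>Both composites with \<open>q B\<close> are \<open>h\<close> after
    \<open>q A\<close>, so the pullback along the pair is a kernel.\<close>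
  have "frel F (fst A) (fst A) (Pull S f g (snd B)) = kernel R (Comp R h (q A))"
    using frel_Pull_snd[OF B fh gh] F.cod.kernel_eq[OF F.cod.Comp_hom[OF q_hom[OF A] h]]
    by (simp add: fe ge)
  then have "Leq S (fst A) (fst A) (snd A) (Pull S f g (snd B))"
    using F.frel_Leq_iff[OF Obj_fst[OF A] Obj_fst[OF A] snd_Fib[OF A]
        F.dom.Pull_Fib[OF fh gh snd_Fib[OF B]]]
      F.cod.quotient_le_kernel_Comp[OF q_quotient[OF A] h]
    by simp
  moreover have "f \<in> eq_pre_hom S A B" "g \<in> eq_pre_hom S A B"
    using f g h mem_eq_pre_hom[OF A B] by blast+
  ultimately show "(f, g) \<in> eq_sim S A B" by (simp add: eq_sim_alt[OF A B])
qed

text \<open>The completion forms identities from a singleton and composites from a set of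
  composites; any nonempty set of lifts of \<open>h\<close> generates the same class.\<close>

lemma eq_sim_Image:
  assumes "A \<in> Obj E" "B \<in> Obj E" "h \<in> hom R (Q A) (Q B)" "D \<subseteq> lifts A B h" "D \<noteq> {}"
  shows "eq_sim S A B `` D = lifts A B h"
  using assms mem_eq_sim[OF assms(1-3)] by blast

lemma mem_quotient_eq_sim:
  assumes A: "A \<in> Obj E" and B: "B \<in> Obj E"
  shows "c \<in> eq_pre_hom S A B // eq_sim S A B \<longleftrightarrow>
    (\<exists>h \<in> hom R (Q A) (Q B). lifts A B h \<noteq> {} \<and> c = lifts A B h)"
proof
  assume "c \<in> eq_pre_hom S A B // eq_sim S A B"
  then obtain f where "f \<in> eq_pre_hom S A B" and c: "c = eq_sim S A B `` {f}"
    by (rule quotientE)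
  then obtain h where h: "h \<in> hom R (Q A) (Q B)" and f: "f \<in> lifts A B h"
    unfolding mem_eq_pre_hom[OF A B] by (elim bexE)
  have "c = lifts A B h" unfolding c by (rule eq_sim_Image[OF A B h]) (use f in auto)
  then show "\<exists>h \<in> hom R (Q A) (Q B). lifts A B h \<noteq> {} \<and> c = lifts A B h"
    using f by (intro bexI[OF _ h]) auto
next
  assume "\<exists>h \<in> hom R (Q A) (Q B). lifts A B h \<noteq> {} \<and> c = lifts A B h"
  then obtain h where h: "h \<in> hom R (Q A) (Q B)" and ne: "lifts A B h \<noteq> {}"
    and c: "c = lifts A B h" by (elim bexE conjE)
  obtain f where f: "f \<in> lifts A B h" using ne by auto
  have "c = eq_sim S A B `` {f}"
    unfolding c by (rule eq_sim_Image[OF A B h, symmetric]) (use f in auto)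
  moreover have "f \<in> eq_pre_hom S A B" unfolding mem_eq_pre_hom[OF A B] using f h by (rule bexI)
  ultimately show "c \<in> eq_pre_hom S A B // eq_sim S A B" by (simp add: quotientI)
qed

section \<open>Arrows, identities and composites of the completion\<close>

lemma mem_hom_E:
  "x \<in> hom E A B \<longleftrightarrow> A \<in> Obj E \<and> B \<in> Obj E \<and>
    (\<exists>c \<in> eq_pre_hom S A B // eq_sim S A B. x = (A, B, c))"
  by (cases x) (auto simp: hom_def eq_completion_def case_prod_unfold)

lemma hom_E_I:
  assumes "A \<in> Obj E" "B \<in> Obj E" "h \<in> hom R (Q A) (Q B)" "lifts A B h \<noteq> {}"
  shows "(A, B, lifts A B h) \<in> hom E A B"
proof -
  have "lifts A B h \<in> eq_pre_hom S A B // eq_sim S A B"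
    unfolding mem_quotient_eq_sim[OF assms(1,2)] by (intro bexI[of _ h] conjI assms refl)
  then show ?thesis unfolding mem_hom_E using assms(1,2) by simp
qed

lemma hom_E_cases:
  assumes "x \<in> hom E A B"
  obtains h where "A \<in> Obj E" "B \<in> Obj E" "h \<in> hom R (Q A) (Q B)" "lifts A B h \<noteq> {}"
    "x = (A, B, lifts A B h)"
proof -
  obtain c where A: "A \<in> Obj E" and B: "B \<in> Obj E" and x: "x = (A, B, c)"
    and c: "c \<in> eq_pre_hom S A B // eq_sim S A B"
    using assms unfolding mem_hom_E by (elim conjE bexE)
  then show thesis using that unfolding mem_quotient_eq_sim[OF A B] by auto
qed

lemma Ide_E:
  assumes A: "A \<in> Obj E"
  shows "Ide E A = (A, A, lifts A A (Ide R (Q A)))" and "lifts A A (Ide R (Q A)) \<noteq> {}"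
proof -
  note I = F.cod.Ide_hom[OF Q_Obj[OF A]]
  have l: "Ide S (fst A) \<in> lifts A A (Ide R (Q A))"
    using F.cod.Ide_Comp[OF q_hom[OF A]] F.cod.Comp_Ide[OF q_hom[OF A]]
    by (simp add: lifts_def F.dom.Ide_hom Obj_fst A F.F_Ide)
  then show "lifts A A (Ide R (Q A)) \<noteq> {}" by blast
  have "eq_sim S A A `` {Ide S (fst A)} = lifts A A (Ide R (Q A))"
    by (rule eq_sim_Image[OF A A I]) (use l in auto)
  then show "Ide E A = (A, A, lifts A A (Ide R (Q A)))" by (simp add: eq_completion_def)
qed

text \<open>Two commuting squares are pasted along \<open>q B\<close>.\<close>

lemma lifts_Comp:
  assumes A: "A \<in> Obj E" and B: "B \<in> Obj E" and D: "D \<in> Obj E"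
    and h: "h \<in> hom R (Q A) (Q B)" and k: "k \<in> hom R (Q B) (Q D)"
    and f: "f \<in> lifts A B h" and g: "g \<in> lifts B D k"
  shows "Comp S g f \<in> lifts A D (Comp R k h)"
proof -
  have fh: "f \<in> hom S (fst A) (fst B)" and fe: "Comp R h (q A) = Comp R (q B) (farr F f)"
    and gh: "g \<in> hom S (fst B) (fst D)" and ge: "Comp R k (q B) = Comp R (q D) (farr F g)"
    using f g by (auto simp: lifts_def)
  have "Comp R (Comp R k h) (q A) = Comp R k (Comp R (q B) (farr F f))"
    using F.cod.Comp_assoc[OF q_hom[OF A] h k] fe by simp
  also have "\<dots> = Comp R (Comp R (q D) (farr F g)) (farr F f)"
    using F.cod.Comp_assoc[OF F.F_hom[OF fh] q_hom[OF B] k] ge by simp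
  also have "\<dots> = Comp R (q D) (farr F (Comp S g f))"
    using F.cod.Comp_assoc[OF F.F_hom[OF fh] F.F_hom[OF gh] q_hom[OF D]] F.F_Comp[OF fh gh] by simp
  finally show ?thesis using F.dom.Comp_hom[OF fh gh] by (simp add: lifts_def)
qed

lemma Comp_E:
  assumes A: "A \<in> Obj E" and B: "B \<in> Obj E" and D: "D \<in> Obj E"
    and h: "h \<in> hom R (Q A) (Q B)" and k: "k \<in> hom R (Q B) (Q D)"
    and ne: "lifts A B h \<noteq> {}" "lifts B D k \<noteq> {}"
  shows "Comp E (B, D, lifts B D k) (A, B, lifts A B h) = (A, D, lifts A D (Comp R k h))"
    and "lifts A D (Comp R k h) \<noteq> {}"
proof -
  let ?C = "{Comp S g f | g f. g \<in> lifts B D k \<and> f \<in> lifts A B h}"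
  have sub: "?C \<subseteq> lifts A D (Comp R k h)" and nC: "?C \<noteq> {}"
    using lifts_Comp[OF A B D h k] ne by blast+
  then show "lifts A D (Comp R k h) \<noteq> {}" by blast
  show "Comp E (B, D, lifts B D k) (A, B, lifts A B h) = (A, D, lifts A D (Comp R k h))"
    using eq_sim_Image[OF A D F.cod.Comp_hom[OF h k] sub nC] by (simp add: eq_completion_def)
qed

text \<open>The condition in the definite description is vacuous on an empty class. A single lift
  already determines the arrow, as \<open>q A\<close> is epi.\<close>

lemma farr_sharp:
  assumes A: "A \<in> Obj E" and B: "B \<in> Obj E" and h: "h \<in> hom R (Q A) (Q B)"
    and ne: "lifts A B h \<noteq> {}"
  shows "farr (sharp R F q) (A, B, lifts A B h) = h"
proof -
  obtain f where f: "f \<in> lifts A B h" using ne by blast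
  have "(THE k. k \<in> hom R (Q A) (Q B) \<and>
      (\<forall>f \<in> lifts A B h. Comp R k (q A) = Comp R (q B) (farr F f))) = h"
  proof (rule the_equality)
    show "h \<in> hom R (Q A) (Q B) \<and> (\<forall>f \<in> lifts A B h. Comp R h (q A) = Comp R (q B) (farr F f))"
      using h by (simp add: lifts_def)
    fix k assume k: "k \<in> hom R (Q A) (Q B) \<and>
      (\<forall>f \<in> lifts A B h. Comp R k (q A) = Comp R (q B) (farr F f))"
    then have "Comp R k (q A) = Comp R h (q A)" using f by (simp add: lifts_def)
    then show "k = h" using q_epi[OF A _ h] k by blast
  qed
  then show ?thesis by (simp add: sharp_def)
qed

lemma fobj_sharp: "fobj (sharp R F q) A = Q A"
  by (simp add: sharp_def)

lemma frel_sharp: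
  assumes A: "A \<in> Obj E" and B: "B \<in> Obj E"
  shows "frel (sharp R F q) A B \<alpha> = dimage R (q A) (q B) (frel F (fst A) (fst B) \<alpha>)"
  using F.cod.homD(2)[OF q_hom[OF A]] F.cod.homD(2)[OF q_hom[OF B]]
  by (simp add: sharp_def case_prod_unfold dimage_def)

text \<open>Under \<open>F\<close> the saturation of \<open>\<alpha>\<close> becomes the pullback of
  its direct image. A relation always lies below that, so being saturated means being equal to it,
  hence being a pullback from the quotients.\<close>

lemma mem_Fib_E:
  assumes A: "A \<in> Obj E" and B: "B \<in> Obj E"
  shows "\<alpha> \<in> Fib E A B \<longleftrightarrow> \<alpha> \<in> Fib S (fst A) (fst B) \<and>
    (\<exists>\<beta> \<in> Fib R (Q A) (Q B). frel F (fst A) (fst B) \<alpha> = Pull R (q A) (q B) \<beta>)"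
proof (cases "\<alpha> \<in> Fib S (fst A) (fst B)")
  case a: True
  note ob = Obj_fst[OF A] Obj_fst[OF B] and s = snd_Fib[OF A] snd_Fib[OF B]
  note Fob = F.F_Obj[OF ob(1)] F.F_Obj[OF ob(2)]
  note sa = F.dom.Rcomp_Fib[OF ob(1,1,2) s(1) a]
  note c = F.dom.Rcomp_Fib[OF ob(1,2,2) sa s(2)]
  note Fa = F.frel_Fib[OF ob a]
  note d = F.cod.dimage_Fib[OF q_hom[OF A] q_hom[OF B] Fa]
  let ?d = "dimage R (q A) (q B) (frel F (fst A) (fst B) \<alpha>)"
  have "\<alpha> \<in> Fib E A B \<longleftrightarrow> Leq S (fst A) (fst B) (Rcomp S (fst A) (fst B) (fst B)
      (Rcomp S (fst A) (fst A) (fst B) (snd A) \<alpha>) (snd B)) \<alpha>"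
    using a by (simp add: eq_completion_def case_prod_unfold)
  also have "\<dots> \<longleftrightarrow> Leq R (fobj F (fst A)) (fobj F (fst B)) (Pull R (q A) (q B) ?d)
      (frel F (fst A) (fst B) \<alpha>)"
    using F.frel_Leq_iff[OF ob c a]
    by (simp add: F.frel_Rcomp[OF ob(1,2,2) sa s(2)] F.frel_Rcomp[OF ob(1,1,2) s(1) a]
        q_kernel A B F.cod.Pull_dimage[OF q_hom[OF A] q_hom[OF B] Fa])
  also have "\<dots> \<longleftrightarrow> (\<exists>\<beta> \<in> Fib R (Q A) (Q B). frel F (fst A) (fst B) \<alpha> = Pull R (q A) (q B) \<beta>)"
  proof
    assume "Leq R (fobj F (fst A)) (fobj F (fst B)) (Pull R (q A) (q B) ?d)
      (frel F (fst A) (fst B) \<alpha>)"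
    then have "frel F (fst A) (fst B) \<alpha> = Pull R (q A) (q B) ?d"
      by (rule F.cod.Leq_antisym[OF Fob Fa F.cod.Pull_Fib[OF q_hom[OF A] q_hom[OF B] d]
            F.cod.le_Pull_dimage[OF q_hom[OF A] q_hom[OF B] Fa]])
    then show "\<exists>\<beta> \<in> Fib R (Q A) (Q B). frel F (fst A) (fst B) \<alpha> = Pull R (q A) (q B) \<beta>"
      using d by blast
  next
    assume "\<exists>\<beta> \<in> Fib R (Q A) (Q B). frel F (fst A) (fst B) \<alpha> = Pull R (q A) (q B) \<beta>"
    then obtain \<beta> where b: "\<beta> \<in> Fib R (Q A) (Q B)"
      and e: "frel F (fst A) (fst B) \<alpha> = Pull R (q A) (q B) \<beta>" by blast
    show "Leq R (fobj F (fst A)) (fobj F (fst B)) (Pull R (q A) (q B) ?d)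
      (frel F (fst A) (fst B) \<alpha>)"
      using F.cod.Leq_refl[OF Fob Fa]
      by (simp add: e F.cod.dimage_Pull[OF q_hom[OF A] q_hom[OF B] q_descent[OF A] q_descent[OF B] b])
  qed
  finally show ?thesis using a by simp
qed (simp add: eq_completion_def case_prod_unfold)

text \<open>To handle an operation of the completion it suffices to exhibit the relation on the
  quotients that pulls back to its result; membership and the value under \<open>sharp\<close>
  follow together.\<close>

lemma Fib_E_I:
  assumes A: "A \<in> Obj E" and B: "B \<in> Obj E" and a: "\<alpha> \<in> Fib S (fst A) (fst B)"
    and b: "\<beta> \<in> Fib R (Q A) (Q B)" and e: "frel F (fst A) (fst B) \<alpha> = Pull R (q A) (q B) \<beta>"
  shows "\<alpha> \<in> Fib E A B \<and> frel (sharp R F q) A B \<alpha> = \<beta>"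
  using assms F.cod.dimage_Pull[OF q_hom[OF A] q_hom[OF B] q_descent[OF A] q_descent[OF B] b]
  by (auto simp: mem_Fib_E[OF A B] frel_sharp[OF A B])

lemma Fib_E_D:
  assumes A: "A \<in> Obj E" and B: "B \<in> Obj E" and "\<alpha> \<in> Fib E A B"
  shows "\<alpha> \<in> Fib S (fst A) (fst B)" and "frel (sharp R F q) A B \<alpha> \<in> Fib R (Q A) (Q B)"
    and "frel F (fst A) (fst B) \<alpha> = Pull R (q A) (q B) (frel (sharp R F q) A B \<alpha>)"
  using assms(3) Fib_E_I[OF A B] by (auto simp: mem_Fib_E[OF A B])

lemma doctrine_transport_sharp:
  assumes full: "\<And>A B h. A \<in> Obj E \<Longrightarrow> B \<in> Obj E \<Longrightarrow> h \<in> hom R (Q A) (Q B) \<Longrightarrow> lifts A B h \<noteq> {}"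
  shows "doctrine_transport E R (sharp R F q)"
proof
  let ?G = "sharp R F q"
  show "Dom E x \<in> Obj E \<and> Cod E x \<in> Obj E" if "x \<in> Arr E" for x
    using that iffD1[OF mem_hom_E, of x "Dom E x" "Cod E x"] by (simp add: hom_def)
  show "fobj ?G A \<in> Obj R" if "A \<in> Obj E" for A using that by (simp add: fobj_sharp Q_Obj)
  show "bij_betw (farr ?G) (hom E A B) (hom R (fobj ?G A) (fobj ?G B))"
    if A: "A \<in> Obj E" and B: "B \<in> Obj E" for A B
  \<comment> \<open>Fullness is used for this inverse: a class of lifts is an arrow of the
    completion only when nonempty.\<close>
  proof (rule bij_betw_byWitness[where f' = "\<lambda>h. (A, B, lifts A B h)"])
    have 1: "farr ?G x \<in> hom R (Q A) (Q B) \<and> (A, B, lifts A B (farr ?G x)) = x"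
      if "x \<in> hom E A B" for x
      using that by (rule hom_E_cases) (simp add: farr_sharp)
    have 2: "(A, B, lifts A B h) \<in> hom E A B \<and> farr ?G (A, B, lifts A B h) = h"
      if h: "h \<in> hom R (Q A) (Q B)" for h
      using hom_E_I[OF A B h full[OF A B h]] farr_sharp[OF A B h full[OF A B h]] by simp
    show "\<forall>x \<in> hom E A B. (A, B, lifts A B (farr ?G x)) = x"
      and "farr ?G ` hom E A B \<subseteq> hom R (fobj ?G A) (fobj ?G B)"
      unfolding fobj_sharp using 1 by auto
    show "\<forall>h \<in> hom R (fobj ?G A) (fobj ?G B). farr ?G (A, B, lifts A B h) = h"
      and "(\<lambda>h. (A, B, lifts A B h)) ` hom R (fobj ?G A) (fobj ?G B) \<subseteq> hom E A B"
      unfolding fobj_sharp using 2 by auto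
  qed
  show "Ide E A \<in> hom E A A \<and> farr ?G (Ide E A) = Ide R (fobj ?G A)" if A: "A \<in> Obj E" for A
    unfolding Ide_E(1)[OF A] fobj_sharp
      farr_sharp[OF A A F.cod.Ide_hom[OF Q_Obj[OF A]] Ide_E(2)[OF A]]
    using hom_E_I[OF A A F.cod.Ide_hom[OF Q_Obj[OF A]] Ide_E(2)[OF A]] by simp
  show "Comp E y x \<in> hom E A D \<and> farr ?G (Comp E y x) = Comp R (farr ?G y) (farr ?G x)"
    if x: "x \<in> hom E A B" and y: "y \<in> hom E B D" for x y A B D
  proof -
    obtain h where h: "A \<in> Obj E" "B \<in> Obj E" "h \<in> hom R (Q A) (Q B)" "lifts A B h \<noteq> {}"
      and xh: "x = (A, B, lifts A B h)" by (rule hom_E_cases[OF x])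
    obtain k where k: "D \<in> Obj E" "k \<in> hom R (Q B) (Q D)" "lifts B D k \<noteq> {}"
      and yk: "y = (B, D, lifts B D k)" by (rule hom_E_cases[OF y])
    note kh = F.cod.Comp_hom[OF h(3) k(2)] and C = Comp_E[OF h(1,2) k(1) h(3) k(2) h(4) k(3)]
    have "Comp E y x \<in> hom E A D" unfolding xh yk C by (rule hom_E_I[OF h(1) k(1) kh C(2)])
    then show ?thesis
      by (simp add: xh yk C farr_sharp[OF h(1,2,3,4)] farr_sharp[OF h(2) k]
          farr_sharp[OF h(1) k(1) kh C(2)])
  qed
  show "bij_betw (frel ?G A B) (Fib E A B) (Fib R (fobj ?G A) (fobj ?G B))"
    if A: "A \<in> Obj E" and B: "B \<in> Obj E" for A B
    unfolding bij_betw_def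
  proof
    show "inj_on (frel ?G A B) (Fib E A B)"
      using Fib_E_D[OF A B] F.frel_inj[OF Obj_fst[OF A] Obj_fst[OF B]]
      by (intro inj_onI) simp
    have "\<beta> \<in> frel ?G A B ` Fib E A B" if b: "\<beta> \<in> Fib R (Q A) (Q B)" for \<beta>
    proof -
      obtain \<alpha> where a: "\<alpha> \<in> Fib S (fst A) (fst B)"
        and e: "frel F (fst A) (fst B) \<alpha> = Pull R (q A) (q B) \<beta>"
        by (rule F.frel_surj[OF Obj_fst[OF A] Obj_fst[OF B]
              F.cod.Pull_Fib[OF q_hom[OF A] q_hom[OF B] b]])
      show ?thesis by (rule image_eqI[of _ _ \<alpha>]) (use Fib_E_I[OF A B a b e] in auto)
    qed
    then show "frel ?G A B ` Fib E A B = Fib R (fobj ?G A) (fobj ?G B)"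
      using Fib_E_D(2)[OF A B] by (auto simp: fobj_sharp)
  qed
  show "Leq E A B \<alpha> \<beta> \<longleftrightarrow> Leq R (fobj ?G A) (fobj ?G B) (frel ?G A B \<alpha>) (frel ?G A B \<beta>)"
    if A: "A \<in> Obj E" and B: "B \<in> Obj E" and a: "\<alpha> \<in> Fib E A B" and b: "\<beta> \<in> Fib E A B"
    for A B \<alpha> \<beta>
  proof -
    note a = Fib_E_D[OF A B a] and b = Fib_E_D[OF A B b]
    have "Leq E A B \<alpha> \<beta> \<longleftrightarrow> Leq S (fst A) (fst B) \<alpha> \<beta>"
      by (simp add: eq_completion_def case_prod_unfold)
    also have "\<dots> \<longleftrightarrow> Leq R (Q A) (Q B) (frel ?G A B \<alpha>) (frel ?G A B \<beta>)"
      using F.frel_Leq_iff[OF Obj_fst[OF A] Obj_fst[OF B] a(1) b(1)]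
        F.cod.Pull_reflect[OF q_hom[OF A] q_hom[OF B] q_descent[OF A] q_descent[OF B] a(2) b(2)]
      by (simp add: a(3) b(3))
    finally show ?thesis by (simp add: fobj_sharp)
  qed
  show "Pull E x y \<alpha> \<in> Fib E A B \<and>
      frel ?G A B (Pull E x y \<alpha>) = Pull R (farr ?G x) (farr ?G y) (frel ?G X Y \<alpha>)"
    if x: "x \<in> hom E A X" and y: "y \<in> hom E B Y" and a: "\<alpha> \<in> Fib E X Y" for x y A B X Y \<alpha>
  proof -
    obtain h where h: "A \<in> Obj E" "X \<in> Obj E" "h \<in> hom R (Q A) (Q X)" "lifts A X h \<noteq> {}"
      and xh: "x = (A, X, lifts A X h)" by (rule hom_E_cases[OF x])
    obtain k where k: "B \<in> Obj E" "Y \<in> Obj E" "k \<in> hom R (Q B) (Q Y)" "lifts B Y k \<noteq> {}"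
      and yk: "y = (B, Y, lifts B Y k)" by (rule hom_E_cases[OF y])
    \<comment> \<open>These are the representatives selected by \<open>Pull\<close> of the
      completion. Their choice has no influence, because every lift \<open>f\<close> of
      \<open>h\<close> satisfies the same equation with \<open>q X\<close> and
      \<open>q A\<close>.\<close>
    define f g where "f = (SOME f. f \<in> lifts A X h)" and "g = (SOME g. g \<in> lifts B Y k)"
    have "f \<in> lifts A X h" "g \<in> lifts B Y k"
      unfolding f_def g_def using h(4) k(4) some_in_eq by blast+
    then have f: "f \<in> hom S (fst A) (fst X)" "Comp R (q X) (farr F f) = Comp R h (q A)"
      and g: "g \<in> hom S (fst B) (fst Y)" "Comp R (q Y) (farr F g) = Comp R k (q B)"
      by (auto simp: lifts_def)
    have P: "Pull E x y \<alpha> = Pull S f g \<alpha>"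
      by (simp add: xh yk f_def g_def eq_completion_def)
    note a = Fib_E_D[OF h(2) k(2) a]
    have "frel F (fst A) (fst B) (Pull S f g \<alpha>) =
        Pull R (Comp R (q X) (farr F f)) (Comp R (q Y) (farr F g)) (frel ?G X Y \<alpha>)"
      using F.frel_natural[OF f(1) g(1) a(1)]
        F.cod.Pull_Comp[OF F.F_hom[OF f(1)] q_hom[OF h(2)] F.F_hom[OF g(1)] q_hom[OF k(2)] a(2)]
      by (simp add: a(3))
    also have "\<dots> = Pull R (q A) (q B) (Pull R h k (frel ?G X Y \<alpha>))"
      unfolding f(2) g(2) by (rule F.cod.Pull_Comp[OF q_hom[OF h(1)] h(3) q_hom[OF k(1)] k(3) a(2)])
    finally have e: "frel F (fst A) (fst B) (Pull S f g \<alpha>) =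
        Pull R (q A) (q B) (Pull R h k (frel ?G X Y \<alpha>))" .
    have G: "farr ?G x = h" "farr ?G y = k"
      by (simp_all add: xh yk farr_sharp[OF h(1-4)] farr_sharp[OF k(1-4)])
    show ?thesis
      unfolding P G
      by (rule Fib_E_I[OF h(1) k(1) F.dom.Pull_Fib[OF f(1) g(1) a(1)]
            F.cod.Pull_Fib[OF h(3) k(3) a(2)] e])
  qed
  show "Rcomp E A B C \<alpha> \<beta> \<in> Fib E A C \<and> frel ?G A C (Rcomp E A B C \<alpha> \<beta>) =
      Rcomp R (fobj ?G A) (fobj ?G B) (fobj ?G C) (frel ?G A B \<alpha>) (frel ?G B C \<beta>)"
    if A: "A \<in> Obj E" and B: "B \<in> Obj E" and C: "C \<in> Obj E"
      and a: "\<alpha> \<in> Fib E A B" and b: "\<beta> \<in> Fib E B C" for A B C \<alpha> \<beta>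
  proof -
    note ob = Obj_fst[OF A] Obj_fst[OF B] Obj_fst[OF C]
    note a = Fib_E_D[OF A B a] and b = Fib_E_D[OF B C b]
    have P: "Rcomp E A B C \<alpha> \<beta> = Rcomp S (fst A) (fst B) (fst C) \<alpha> \<beta>"
      by (simp add: eq_completion_def case_prod_unfold)
    \<comment> \<open>Descent of the middle quotient \<open>q B\<close> gives the strict equality
      required by \<open>Fib_E_I\<close>.\<close>
    show ?thesis
      unfolding P fobj_sharp
      by (rule Fib_E_I[OF A C F.dom.Rcomp_Fib[OF ob a(1) b(1)]
            F.cod.Rcomp_Fib[OF Q_Obj[OF A] Q_Obj[OF B] Q_Obj[OF C] a(2) b(2)]])
        (simp add: F.frel_Rcomp[OF ob a(1) b(1)] a(3) b(3) F.cod.Pull_Rcomp_descent[OF q_hom[OF A]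
            q_hom[OF B] q_hom[OF C] q_descent[OF B] a(2) b(2)])
  qed
  show "Diag E A \<in> Fib E A A \<and> frel ?G A A (Diag E A) = Diag R (fobj ?G A)" if A: "A \<in> Obj E" for A
  proof -
    have P: "Diag E A = snd A" by (simp add: eq_completion_def case_prod_unfold)
    show ?thesis
      unfolding P fobj_sharp
      by (rule Fib_E_I[OF A A snd_Fib[OF A] F.cod.Diag_Fib[OF Q_Obj[OF A]]])
        (simp add: q_kernel[OF A] F.cod.kernel_eq[OF q_hom[OF A]])
  qed
  show "Conv E A B \<alpha> \<in> Fib E B A \<and>
      frel ?G B A (Conv E A B \<alpha>) = Conv R (fobj ?G A) (fobj ?G B) (frel ?G A B \<alpha>)"
    if A: "A \<in> Obj E" and B: "B \<in> Obj E" and a: "\<alpha> \<in> Fib E A B" for A B \<alpha>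
  proof -
    note ob = Obj_fst[OF A] Obj_fst[OF B]
    note a = Fib_E_D[OF A B a]
    have P: "Conv E A B \<alpha> = Conv S (fst A) (fst B) \<alpha>"
      by (simp add: eq_completion_def case_prod_unfold)
    show ?thesis
      unfolding P fobj_sharp
      by (rule Fib_E_I[OF B A F.dom.Conv_Fib[OF ob a(1)]
            F.cod.Conv_Fib[OF Q_Obj[OF A] Q_Obj[OF B] a(2)]])
        (simp add: F.frel_Conv[OF ob a(1)] a(3) F.cod.Conv_Pull[OF q_hom[OF A] q_hom[OF B] a(2)])
  qed
qed

end

section \<open>Consequences of an equivalence on objects and arrows\<close>

lemma iso_two_arrow_iso_pair:
  assumes "iso_two_arrow S R F G \<theta>"
  shows "\<exists>\<theta>'. \<forall>X \<in> Obj S. iso_pair R (fobj F X) (fobj G X) (\<theta> X) (\<theta>' X)"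
proof -
  obtain \<theta>' where "two_arrow S R F G \<theta>" "two_arrow S R G F \<theta>'"
    and "\<forall>X \<in> Obj S. Comp R (\<theta>' X) (\<theta> X) = Ide R (fobj F X) \<and>
      Comp R (\<theta> X) (\<theta>' X) = Ide R (fobj G X)"
    using assms unfolding iso_two_arrow_def by (elim conjE exE)
  then show ?thesis by (intro exI[of _ \<theta>']) (simp add: two_arrow_def iso_pair_def)
qed

text \<open>The counit gives essential surjectivity and also faithfulness of \<open>G\<close>.
  Fullness of \<open>F\<close> follows by conjugating \<open>farr G h\<close> with the unit: the
  resulting \<open>k\<close> has the same image as \<open>h\<close> under \<open>G\<close> after
  applying \<open>F\<close>.\<close>

lemma
  assumes "EQRD_equivalence T R F"
  shows EQRD_equivalence_full: "\<And>A B h. A \<in> Obj T \<Longrightarrow> B \<in> Obj T \<Longrightarrow>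
      h \<in> hom R (fobj F A) (fobj F B) \<Longrightarrow> \<exists>k \<in> hom T A B. farr F k = h"
    and EQRD_equivalence_ess_surj: "\<And>X. X \<in> Obj R \<Longrightarrow>
      \<exists>A \<in> Obj T. \<exists>u v. iso_pair R (fobj F A) X u v"
proof -
  obtain G \<eta> \<epsilon> where F: "rd_arrow T R F" and G: "rd_arrow R T G"
    and unit: "iso_two_arrow T T id_map (comp_map G F) \<eta>"
    and counit: "iso_two_arrow R R (comp_map F G) id_map \<epsilon>"
    using assms unfolding EQRD_equivalence_def EQRD_arrow_def by (elim conjE exE)
  interpret F: rd_arrow T R F by (rule F)
  interpret G: rd_arrow R T G by (rule G)
  have "\<exists>\<eta>'. \<forall>A \<in> Obj T. iso_pair T A (fobj G (fobj F A)) (\<eta> A) (\<eta>' A)"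
    using iso_two_arrow_iso_pair[OF unit] by (simp add: comp_map_def id_map_def)
  then obtain \<eta>' where eta: "\<And>A. A \<in> Obj T \<Longrightarrow> iso_pair T A (fobj G (fobj F A)) (\<eta> A) (\<eta>' A)"
    by blast
  have "\<exists>\<epsilon>'. \<forall>X \<in> Obj R. iso_pair R (fobj F (fobj G X)) X (\<epsilon> X) (\<epsilon>' X)"
    using iso_two_arrow_iso_pair[OF counit] by (simp add: comp_map_def id_map_def)
  then obtain \<epsilon>' where eps: "\<And>X. X \<in> Obj R \<Longrightarrow> iso_pair R (fobj F (fobj G X)) X (\<epsilon> X) (\<epsilon>' X)"
    by blast
  have eta_nat: "Comp T (\<eta> B) k = Comp T (farr G (farr F k)) (\<eta> A)" if k: "k \<in> hom T A B" for k A B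
    using unit k F.dom.homD[OF k] by (simp add: iso_two_arrow_def two_arrow_def comp_map_def id_map_def)
  have eps_nat: "Comp R (\<epsilon> Y) (farr F (farr G f)) = Comp R f (\<epsilon> X)"
    if f: "f \<in> hom R X Y" for f X Y
    using counit f F.cod.homD[OF f]
    by (simp add: iso_two_arrow_def two_arrow_def comp_map_def id_map_def)
  show "\<exists>A \<in> Obj T. \<exists>u v. iso_pair R (fobj F A) X u v" if "X \<in> Obj R" for X
    using eps[OF that] G.F_Obj[OF that] by blast
  \<comment> \<open>Naturality of the counit expresses \<open>f\<close> after
    \<open>\<epsilon> X\<close> through \<open>farr G f\<close>, and \<open>\<epsilon> X\<close> is
    invertible.\<close>
  have G_faithful: "f = g" if f: "f \<in> hom R X Y" and g: "g \<in> hom R X Y" and "farr G f = farr G g"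
    for f g X Y
  proof -
    note i = F.cod.iso_pair_cancel(4)[OF eps[OF F.cod.homD(4)[OF f]]]
    have "Comp R f (\<epsilon> X) = Comp R g (\<epsilon> X)"
      using eps_nat[OF f] eps_nat[OF g] that(3) by simp
    from arg_cong[OF this, of "\<lambda>x. Comp R x (\<epsilon>' X)"] show "f = g"
      unfolding i[OF f] i[OF g] .
  qed
  fix A B h assume A: "A \<in> Obj T" and B: "B \<in> Obj T" and h: "h \<in> hom R (fobj F A) (fobj F B)"
  note e = eta[OF A, unfolded iso_pair_def] eta[OF B, unfolded iso_pair_def]
  have Gh: "Comp T (farr G h) (\<eta> A) \<in> hom T A (fobj G (fobj F B))"
    using F.dom.Comp_hom[OF _ G.F_hom[OF h]] e by simp
  define k where "k = Comp T (\<eta>' B) (Comp T (farr G h) (\<eta> A))"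
  have k: "k \<in> hom T A B" unfolding k_def using F.dom.Comp_hom[OF Gh] e by simp
  have "Comp T (farr G (farr F k)) (\<eta> A) = Comp T (farr G h) (\<eta> A)"
    using eta_nat[OF k] F.dom.iso_pair_cancel(2)[OF eta[OF B] Gh, folded k_def] by (rule trans[OF sym])
  from arg_cong[OF this, of "\<lambda>x. Comp T x (\<eta>' A)"] have "farr G (farr F k) = farr G h"
    unfolding F.dom.iso_pair_cancel(4)[OF eta[OF A] G.F_hom[OF h]]
      F.dom.iso_pair_cancel(4)[OF eta[OF A] G.F_hom[OF F.F_hom[OF k]]] .
  from G_faithful[OF F.F_hom[OF k] h this] show "\<exists>k \<in> hom T A B. farr F k = h"
    by (intro bexI[of _ k] k)
qed

section \<open>Projectivity and covers in terms of lifts\<close>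

context quotient_setup
begin

lemma quotient_arrowI: "quotient_arrow_of R X \<rho> p \<Longrightarrow> quotient_arrow R p"
  using F.cod.homD(2)[OF F.cod.quotient_arrow_ofD(4)] by (auto simp: quotient_arrow_def)

text \<open>Projectivity is the surjectivity of \<open>F\<^sup>\<sharp>\<close> on arrows out of \<open>(P, Diag S P)\<close>: its quotient
  arrow is an isomorphism, and every quotient arrow in \<open>R\<close> becomes, after precomposition with
  a quotient arrow out of an object in the image of \<open>F\<close>, some \<open>q (X, \<tau>)\<close> up to isomorphism.\<close>

lemma projective_if_full:
  assumes hq: "has_quotients R"
    and full: "\<And>A B h. A \<in> Obj E \<Longrightarrow> B \<in> Obj E \<Longrightarrow> h \<in> hom R (Q A) (Q B) \<Longrightarrow> lifts A B h \<noteq> {}"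
    and ess: "\<And>X. X \<in> Obj R \<Longrightarrow> \<exists>A \<in> Obj E. \<exists>u v. iso_pair R (Q A) X u v"
    and P: "P \<in> Obj S"
  shows "projective R (fobj F P)"
  unfolding projective_def
proof (intro conjI ballI impI)
  show FP: "fobj F P \<in> Obj R" by (rule F.F_Obj[OF P])
  fix X Y f p assume X: "X \<in> Obj R" and f: "f \<in> hom R (fobj F P) Y" and p: "p \<in> hom R X Y"
    and "quotient_arrow R p"
  then obtain \<sigma> where p_quot: "quotient_arrow_of R X \<sigma> p"
    using F.cod.homD(2)[OF p] by (auto simp: quotient_arrow_def)
  define A where "A = (P, Diag S P)"
  have A: "A \<in> Obj E" by (simp add: Obj_E A_def F.dom.equiv_rel_Diag P)
  have "quotient_arrow_of R (fobj F P) (Diag R (fobj F P)) (q A)"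
    using q_quotient[OF A] by (simp add: A_def F.frel_Diag P)
  from F.cod.quotient_arrow_unique[OF F.cod.quotient_arrow_Ide[OF FP] this]
  obtain s t where st: "iso_pair R (fobj F P) (Q A) s t" and qs: "q A = Comp R s (Ide R (fobj F P))"
    using F.cod.homD(3)[OF F.cod.Ide_hom[OF FP]] by auto
  have s: "s \<in> hom R (fobj F P) (Q A)" and t: "t \<in> hom R (Q A) (fobj F P)"
    using st by (auto simp: iso_pair_def)
  have qA: "q A = s" using qs F.cod.Comp_Ide[OF s] by simp
  obtain B u u' where B: "B \<in> Obj E" and u: "iso_pair R (Q B) X u u'"
    using ess[OF X] by (elim bexE exE)
  have uh: "u \<in> hom R (Q B) X" using u by (simp add: iso_pair_def)
  define p' where "p' = Comp R u (q B)"
  have p': "p' \<in> hom R (fobj F (fst B)) X"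
    unfolding p'_def by (rule F.cod.Comp_hom[OF q_hom[OF B] uh])
  note p'_quot = F.cod.quotient_arrow_iso_Comp[OF q_quotient[OF B] u, folded p'_def]
  define r where "r = Comp R p p'"
  have r: "r \<in> hom R (fobj F (fst B)) Y" unfolding r_def by (rule F.cod.Comp_hom[OF p' p])
  have r_quot: "quotient_arrow_of R (fobj F (fst B)) (kernel R r) r"
    unfolding r_def
    using F.cod.quotient_arrow_Comp[OF p'_quot F.cod.effective_descent[OF hq p'_quot], of \<sigma> p]
      F.cod.homD(3)[OF p'] p_quot F.cod.effective_descent(1)[OF hq p_quot] by simp
  note SB = Obj_fst[OF B]
  \<comment> \<open>As \<open>F\<close> is bijective on fibres, the kernel of \<open>r\<close> has a
    counterpart in \<open>S\<close>, so \<open>r\<close> is compared with a chosen quotient.\<close>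
  obtain \<tau> where \<tau>: "\<tau> \<in> Fib S (fst B) (fst B)" and F\<tau>: "frel F (fst B) (fst B) \<tau> = kernel R r"
    by (rule F.frel_surj[OF SB SB F.cod.kernel_Fib[OF r]])
  define D where "D = (fst B, \<tau>)"
  have D: "D \<in> Obj E"
    using F.equiv_rel_iff[OF SB \<tau>] F.cod.equiv_rel_kernel[OF r] by (simp add: Obj_E D_def F\<tau>)
  have "quotient_arrow_of R (fobj F (fst B)) (kernel R r) (q D)"
    using q_quotient[OF D] by (simp add: D_def F\<tau>)
  from F.cod.quotient_arrow_unique[OF this r_quot]
  obtain v w where vw: "iso_pair R (Q D) Y v w" and rv: "r = Comp R v (q D)"
    using F.cod.homD(3)[OF r] by auto
  have v: "v \<in> hom R (Q D) Y" and w: "w \<in> hom R Y (Q D)" using vw by (auto simp: iso_pair_def)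
  note wf = F.cod.Comp_hom[OF f w]
  note h = F.cod.Comp_hom[OF t wf]
  \<comment> \<open>Between the chosen quotients, \<open>f\<close> is read through the isomorphisms
    \<open>t\<close> and \<open>w\<close>. A lift \<open>g\<close> gives a factorization of
    \<open>f\<close> through \<open>r\<close>, and \<open>r\<close> passes through
    \<open>p\<close>.\<close>
  have "lifts A D (Comp R (Comp R w f) t) \<noteq> {}" by (rule full[OF A D h])
  then obtain g where g: "g \<in> hom S P (fst B)"
    and ge: "Comp R (Comp R (Comp R w f) t) (q A) = Comp R (q D) (farr F g)"
    by (auto simp: lifts_def A_def D_def)
  note Fg = F.F_hom[OF g]
  have qD: "q D \<in> hom R (fobj F (fst B)) (Q D)" using q_hom[OF D] by (simp add: D_def)
  have "f = Comp R v (Comp R w f)" using F.cod.iso_pair_cancel(2)[OF vw f] by simp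
  also have "Comp R w f = Comp R (q D) (farr F g)"
    using ge F.cod.iso_pair_cancel(3)[OF st wf] by (simp add: qA)
  also have "Comp R v (Comp R (q D) (farr F g)) = Comp R r (farr F g)"
    unfolding rv by (rule F.cod.Comp_assoc[OF Fg qD v])
  also have "\<dots> = Comp R p (Comp R p' (farr F g))"
    unfolding r_def by (rule F.cod.Comp_assoc[OF Fg p' p, symmetric])
  finally show "\<exists>h \<in> hom R (fobj F P) X. f = Comp R p h"
    using F.cod.Comp_hom[OF Fg p'] by (rule bexI)
qed

text \<open>Projectivity lifts \<open>h\<close> after \<open>q A\<close> along the quotient arrow
  \<open>q B\<close>, and the lift comes from \<open>S\<close> by fullness of
  \<open>F\<close>.\<close>

lemma lifts_if_projective:
  assumes A: "A \<in> Obj E" and B: "B \<in> Obj E" and h: "h \<in> hom R (Q A) (Q B)"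
    and P: "projective R (fobj F (fst A))"
  shows "lifts A B h \<noteq> {}"
proof -
  note hq = F.cod.Comp_hom[OF q_hom[OF A] h]
  have "\<exists>k \<in> hom R (fobj F (fst A)) (fobj F (fst B)). Comp R h (q A) = Comp R (q B) k"
    using P F.F_Obj[OF Obj_fst[OF B]] Q_Obj[OF B] hq q_hom[OF B] quotient_arrowI[OF q_quotient[OF B]]
    by (simp add: projective_def)
  then obtain k where k: "k \<in> hom R (fobj F (fst A)) (fobj F (fst B))"
    and e: "Comp R h (q A) = Comp R (q B) k" by (elim bexE)
  obtain f where "f \<in> hom S (fst A) (fst B)" "farr F f = k"
    by (rule F.farr_surj[OF Obj_fst[OF A] Obj_fst[OF B] k])
  then have "f \<in> lifts A B h" using e by (simp add: lifts_def)
  then show ?thesis by auto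
qed

text \<open>The relation divided out by \<open>p\<close> is the image of a relation on
  \<open>P\<close>, so \<open>p\<close> and a chosen quotient have the same universal
  property.\<close>

lemma iso_Q_if_quotient:
  assumes P: "P \<in> Obj S" and p: "p \<in> hom R (fobj F P) X" and "quotient_arrow R p"
  shows "\<exists>A \<in> Obj E. \<exists>u v. iso_pair R (Q A) X u v"
proof -
  obtain \<rho>' where pq: "quotient_arrow_of R (fobj F P) \<rho>' p"
    using assms F.cod.homD(2)[OF p] by (auto simp: quotient_arrow_def)
  obtain \<rho> where \<rho>: "\<rho> \<in> Fib S P P" "frel F P P \<rho> = \<rho>'"
    by (rule F.frel_surj[OF P P F.cod.quotient_arrow_ofD(3)[OF pq]])
  have A: "(P, \<rho>) \<in> Obj E"
    using F.equiv_rel_iff[OF P \<rho>(1)] F.cod.quotient_arrow_ofD(1)[OF pq] \<rho>(2) by (simp add: Obj_E)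
  have "quotient_arrow_of R (fobj F P) \<rho>' (q (P, \<rho>))"
    using q_quotient[OF A] \<rho>(2) by simp
  from F.cod.quotient_arrow_unique[OF this pq]
  obtain u v where "iso_pair R (Q (P, \<rho>)) X u v" using F.cod.homD(3)[OF p] by auto
  then show ?thesis using A by (intro bexI[of _ "(P, \<rho>)"] exI)
qed

lemma sharp_equivalence_iff:
  assumes hq: "has_quotients R"
  shows "EQRD_equivalence E R (sharp R F q) \<longleftrightarrow>
    (\<forall>P \<in> Obj S. projective R (fobj F P)) \<and>
    (\<forall>X \<in> Obj R. \<exists>P \<in> Obj S. \<exists>p \<in> hom R (fobj F P) X. quotient_arrow R p)"
proof (intro iffI conjI ballI; (elim conjE)?)
  assume eq: "EQRD_equivalence E R (sharp R F q)"
  have full: "lifts A B h \<noteq> {}" if A: "A \<in> Obj E" and B: "B \<in> Obj E" and h: "h \<in> hom R (Q A) (Q B)"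
    for A B h
  proof -
    obtain k where k: "k \<in> hom E A B" and kh: "farr (sharp R F q) k = h"
      using EQRD_equivalence_full[OF eq A B h[folded fobj_sharp]] by (elim bexE)
    \<comment> \<open>The class \<open>k\<close> is nonempty and lifts some \<open>h'\<close>;
      evaluating \<open>sharp\<close> on it identifies \<open>h'\<close> with
      \<open>h\<close>.\<close>
    obtain h' where "h' \<in> hom R (Q A) (Q B)" "lifts A B h' \<noteq> {}" "k = (A, B, lifts A B h')"
      by (rule hom_E_cases[OF k])
    then show ?thesis using kh farr_sharp[OF A B] by simp
  qed
  note ess = EQRD_equivalence_ess_surj[OF eq, unfolded fobj_sharp]
  show "projective R (fobj F P)" if "P \<in> Obj S" for P
    by (rule projective_if_full[OF hq full ess that])
  show "\<exists>P \<in> Obj S. \<exists>p \<in> hom R (fobj F P) X. quotient_arrow R p" if X: "X \<in> Obj R" for X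
  proof -
    obtain A u v where A: "A \<in> Obj E" and u: "iso_pair R (Q A) X u v"
      using ess[OF X] by (elim bexE exE)
    note uq = F.cod.quotient_arrow_iso_Comp[OF q_quotient[OF A] u]
    have "Comp R u (q A) \<in> hom R (fobj F (fst A)) X"
      using F.cod.Comp_hom[OF q_hom[OF A]] u by (simp add: iso_pair_def)
    then show ?thesis
      by (intro bexI[OF _ Obj_fst[OF A]] bexI[of _ "Comp R u (q A)"] quotient_arrowI[OF uq])
  qed
next
  assume proj: "\<forall>P \<in> Obj S. projective R (fobj F P)"
    and cover: "\<forall>X \<in> Obj R. \<exists>P \<in> Obj S. \<exists>p \<in> hom R (fobj F P) X. quotient_arrow R p"
  have full: "lifts A B h \<noteq> {}" if "A \<in> Obj E" "B \<in> Obj E" "h \<in> hom R (Q A) (Q B)" for A B h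
    by (rule lifts_if_projective[OF that bspec[OF proj Obj_fst[OF that(1)]]])
  \<comment> \<open>With all classes of lifts nonempty, the transport along \<open>sharp\<close>
    applies; it yields that the completion is a doctrine and that \<open>sharp\<close> is a fully
    faithful 1-arrow.\<close>
  interpret G: ff_arrow E R "sharp R F q"
    by (rule doctrine_transport.ff_arrow[OF doctrine_transport_sharp[OF full]])
  have ess: "\<exists>A \<in> Obj E. \<exists>u v. iso_pair R (fobj (sharp R F q) A) X u v" if "X \<in> Obj R" for X
    unfolding fobj_sharp using bspec[OF cover that] by (elim bexE) (rule iso_Q_if_quotient)
  have "EQRD_obj R" by (simp add: EQRD_obj_def F.cod.relational_doctrine_axioms ext hq)
  then show "EQRD_equivalence E R (sharp R F q)"
    by (rule EQRD_equivalence_if_ess_surj[OF _ G.rd_arrow_axioms G.ff ess])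
qed

end

theorem theorem3p7:
  fixes R :: "('o, 'a, 'r) reldoc"
    and S :: "('p, 'b, 's) reldoc"
    and F :: "('p, 'b, 's, 'o, 'a, 'r) rd_map"
    and q :: "'p \<times> 's \<Rightarrow> 'a"
  assumes "relational_doctrine R" and "extensional R" and "has_quotients R"
    and "relational_doctrine S"
    and "rd_arrow S R F" and "fully_faithful S R F"
    and "quotient_choice S R F q"
  shows "EQRD_equivalence (eq_completion S) R (sharp R F q) \<longleftrightarrow>
    factors_through_Proj S R F \<and>
    (\<forall>X \<in> Obj R. \<exists>P \<in> Obj S. \<exists>p \<in> hom R (fobj F P) X. quotient_arrow R p)"
proof -
  interpret quotient_setup S R F q
    by (intro quotient_setup.intro ff_arrow.intro ff_arrow_axioms.intro quotient_setup_axioms.intro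
        assms)
  show ?thesis
    using sharp_equivalence_iff[OF assms(3)] factors_through_Proj_iff[OF assms(5)] by simp
qed

end
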